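(* Let $F$ be an arbitrary quasinorm on $D(e)=\mathrm{span}(X,Y)\cong\mathbb{R}^2$. For every extremal (with $M=1$) on the Cartan group starting at the unit at $t=0$, $$x(t)=\int_0^t\frac{r'(\theta(\tau))\sin\theta(\tau)+r(\theta(\tau))\cos\theta(\tau)}{r^2(\theta(\tau))}\,d\tau,\qquad y(t)=\int_0^t\frac{r(\theta(\tau))\sin\theta(\tau)-r'(\theta(\tau))\cos\theta(\tau)}{r^2(\theta(\tau))}\,d\tau,$$ where $\theta=\theta(t)$ is a continuously differentiable function with $r(\theta(0))\cos\theta(0)=\varphi_1$, $r(\theta(0))\sin\theta(0)=\varphi_2$, satisfying $$r^2(\theta(t))\,\dot\theta(t)=\varphi_3+\varphi_4x(t)+\varphi_5y(t),$$ $$\dot\theta^2=\frac{\varphi_3^2+2\varphi_4(r(\theta)\sin\theta-\varphi_2)-2\varphi_5(r(\theta)\cos\theta-\varphi_1)}{r^4(\theta)},$$ and the symbol $r'(\theta(\tau))$ stands for a value lying between the one-sided derivatives of $r$ at $\theta(\tau)$, chosen (the same choice in both integrals) so that the integrands are measurable. These measurable integrands may be arbitrary: for any $(\varphi_1,\dots,\varphi_5)$ with $F_U(\varphi_1,\varphi_2)=1$, any such choice together with a continuously differentiable $\theta$ satisfying $r(\theta(0))\cos\theta(0)=\varphi_1$, $r(\theta(0))\sin\theta(0)=\varphi_2$, $r^2(\theta(t))\,\dot\theta(t)=\varphi_3+\varphi_4x(t)+\varphi_5y(t)$ (with $x(t),y(t)$ equal to the two integrals displayed at the beginning of this claim) and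 $\dot\theta^2=\frac{\varphi_3^2+2\varphi_4(r(\theta)\sin\theta-\varphi_2)-2\varphi_5(r(\theta)\cos\theta-\varphi_1)}{r^4(\theta)}$ gives an extremal. The functions $z,v,w$ are given by $$z(t)=-\frac12x(t)y(t)+\int_0^tx(\tau)\dot y(\tau)d\tau,$$ $$v(t)=\frac1{12}x^2(t)y(t)-\frac12x(t)\int_0^tx(\tau)\dot y(\tau)d\tau+\frac12\int_0^tx^2(\tau)\dot y(\tau)d\tau,$$ $$w(t)=-\frac1{12}x(t)y^2(t)-\frac12y(t)\int_0^tx(\tau)\dot y(\tau)d\tau+\int_0^tx(\tau)y(\tau)\dot y(\tau)d\tau,$$ or, equivalently, by $$z(t)=\frac12\int_0^t(x\dot y-y\dot x)d\tau,\quad v(t)=\frac13\int_0^t(x\dot z-z\dot x)d\tau-\frac16x(t)z(t),\quad w(t)=\frac13\int_0^t(y\dot z-z\dot y)d\tau-\frac16y(t)z(t).$$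
   Context: The Cartan algebra is the 5-dimensional real Lie algebra with basis $X,Y,Z,V,W$ and $[X,Y]=Z$, $[X,Z]=V$, $[Y,Z]=W$, all other brackets of basis elements zero. The Cartan group $G$ is the connected simply connected Lie group with this Lie algebra, identified with $\mathbb{R}^5$ via $(x,y,z,v,w)\leftrightarrow\exp(xX+yY+zZ+vV+wW)$ (the unit is $0$). A quasinorm $F:\mathbb{R}^2\to[0,\infty)$ satisfies $F(u)=0$ iff $u=0$, $F(\lambda u)=\lambda F(u)$ for $\lambda\ge0$, $F(u+u')\le F(u)+F(u')$ (symmetry is not required); $u_1X+u_2Y$ is identified with $(u_1,u_2)$, and $U=\{u: F(u)\le1\}$. Trajectories are the absolutely continuous solutions of $\dot g=u_1X(g)+u_2Y(g)$ with measurable controls $u(t)=(u_1(t),u_2(t))\in U$; in coordinates $$\dot x=u_1,\quad \dot y=u_2,\quad \dot z=\tfrac12(xu_2-yu_1),$$ $$\dot v=-\tfrac12\left(z+\tfrac16xy\right)u_1+\tfrac1{12}x^2u_2,\quad \dot w=-\tfrac1{12}y^2u_1-\tfrac12\left(z-\tfrac16xy\right)u_2 .$$ For a covector $\psi=(\psi_1,\dots,\psi_5)$ at $(x,y,z,v,w)$ (components relative to $\partial_x,\partial_y,\partial_z,\partial_v,\partial_w$) put $$h_1=\psi(X)=\psi_1-\tfrac12\psi_3y-\tfrac1{12}\psi_4xy-\tfrac1{12}\psi_5y^2-\tfrac12\psi_4z,$$ $$h_2=\psi(Y)=\psi_2+\tfrac12\psi_3x+\tfrac1{12}\psi_4x^2+\tfrac1{12}\psi_5xy-\tfrac12\psi_5z,$$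 and $\mathcal H=h_1u_1+h_2u_2$. An extremal with $M=1$ is a trajectory $g(t)=(x,y,z,v,w)(t)$, $t\in\mathbb{R}$, with control $u(t)$, for which there is an absolutely continuous nowhere vanishing $\psi(t)$ with $\dot\psi=-\partial\mathcal H/\partial(x,y,z,v,w)$ a.e. and, for a.e. $t$, $h_1(t)u_1(t)+h_2(t)u_2(t)=\max_{u\in U}(h_1(t)u_1+h_2(t)u_2)=1$. Put $\varphi_i=\psi_i(0)$, $i=1,\dots,5$. $F_U(h)=\max_{u\in U}h\cdot u$ is the support function of $U$; the maximum condition means that $(h_1(t),h_2(t))$ lies on the curve $F_U=1$. This curve has the polar equation $r=r(\theta)$, $\theta\in\mathbb{R}$ ($r$ is positive, $2\pi$-periodic, continuous, with one-sided derivatives everywhere), and $\theta(t)$ is the continuous function with $h_1(t)=r(\theta(t))\cos\theta(t)$, $h_2(t)=r(\theta(t))\sin\theta(t)$. *)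

theory Defs
  imports "HOL-Analysis.Analysis"
begin

section \<open>The Cartan group in exponential coordinates\<close>

text \<open>The tuple \<open>(x, y, z, v, w)\<close> stands for the element
  \<open>x X + y Y + z Z + v V + w W\<close> of the Lie algebra and, through \<open>exp\<close>, for a point
  of the group.  The same type is used for covectors, which act by the inner product.\<close>

type_synonym cartan = "real \<times> real \<times> real \<times> real \<times> real"

fun cartan_bracket :: "cartan \<Rightarrow> cartan \<Rightarrow> cartan" where
  "cartan_bracket (a1, a2, a3, a4, a5) (b1, b2, b3, b4, b5) =
     (0, 0, a1 * b2 - a2 * b1, a1 * b3 - a3 * b1, a2 * b3 - a3 * b2)"

definition bX :: cartan where "bX = (1, 0, 0, 0, 0)"
definition bY :: cartan where "bY = (0, 1, 0, 0, 0)"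
definition bZ :: cartan where "bZ = (0, 0, 1, 0, 0)"
definition bV :: cartan where "bV = (0, 0, 0, 1, 0)"
definition bW :: cartan where "bW = (0, 0, 0, 0, 1)"

lemma cartan_bracket_basis:
  "cartan_bracket bX bY = bZ" "cartan_bracket bX bZ = bV" "cartan_bracket bY bZ = bW"
  "cartan_bracket bX bV = 0" "cartan_bracket bX bW = 0" "cartan_bracket bY bV = 0"
  "cartan_bracket bY bW = 0" "cartan_bracket bZ bV = 0" "cartan_bracket bZ bW = 0"
  "cartan_bracket bV bW = 0"
  by (simp_all add: bX_def bY_def bZ_def bV_def bW_def zero_prod_def)

lemma cartan_bracket_alt: "cartan_bracket a a = 0"
  by (cases a) (simp add: zero_prod_def mult.commute)

lemma bilinear_cartan_bracket: "bilinear cartan_bracket"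
  unfolding bilinear_def
  by (intro conjI allI linearI) (auto simp: algebra_simps)

lemma cartan_bracket_jacobi:
  "cartan_bracket a (cartan_bracket b c) + cartan_bracket b (cartan_bracket c a)
     + cartan_bracket c (cartan_bracket a b) = 0"
  by (cases a; cases b; cases c) (simp add: zero_prod_def algebra_simps)

text \<open>The algebra is nilpotent of step 3, so the Baker--Campbell--Hausdorff series for
  \<open>log (exp a exp b)\<close> terminates with the terms below.\<close>

definition cartan_mult :: "cartan \<Rightarrow> cartan \<Rightarrow> cartan" where
  "cartan_mult a b = a + b + (1/2) *\<^sub>R cartan_bracket a b
     + (1/12) *\<^sub>R cartan_bracket a (cartan_bracket a b)
     + (1/12) *\<^sub>R cartan_bracket b (cartan_bracket b a)"

lemma cartan_mult_assoc:
  "cartan_mult (cartan_mult a b) c = cartan_mult a (cartan_mult b c)"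
  by (cases a; cases b; cases c) (simp add: cartan_mult_def field_simps)

lemma cartan_mult_unit: "cartan_mult 0 a = a" "cartan_mult a 0 = a"
  by (cases a; simp add: cartan_mult_def zero_prod_def)+

lemma cartan_mult_uminus: "cartan_mult a (- a) = 0" "cartan_mult (- a) a = 0"
  by (cases a; simp add: cartan_mult_def zero_prod_def algebra_simps)+

definition left_invariant_field :: "cartan \<Rightarrow> cartan \<Rightarrow> cartan" where
  "left_invariant_field A g = vector_derivative (\<lambda>s. cartan_mult g (s *\<^sub>R A)) (at 0)"

definition field_X :: "cartan \<Rightarrow> cartan" where "field_X = left_invariant_field bX"
definition field_Y :: "cartan \<Rightarrow> cartan" where "field_Y = left_invariant_field bY"

lemma field_X_coord:
  "field_X (x, y, z, v, w) = (1, 0, - y / 2, - (z + x * y / 6) / 2, - y\<^sup>2 / 12)"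
proof -
  have "cartan_mult (x, y, z, v, w) (s *\<^sub>R bX) = (x + s, y, z - s * y / 2,
      v - s * z / 2 - s * (x * y) / 12 + s\<^sup>2 * y / 12, w - s * y\<^sup>2 / 12)" for s
    by (simp add: cartan_mult_def bX_def field_simps power2_eq_square)
  moreover have "((\<lambda>s. (x + s, y, z - s * y / 2,
      v - s * z / 2 - s * (x * y) / 12 + s\<^sup>2 * y / 12, w - s * y\<^sup>2 / 12))
      has_vector_derivative (1, 0, - y / 2, - (z + x * y / 6) / 2, - y\<^sup>2 / 12)) (at 0)"
    by (intro has_vector_derivative_Pair)
       (auto simp: has_real_derivative_iff_has_vector_derivative[symmetric]
         intro!: derivative_eq_intros)
  ultimately show ?thesis
    unfolding field_X_def left_invariant_field_def
    by (simp add: vector_derivative_at)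
qed

lemma field_Y_coord:
  "field_Y (x, y, z, v, w) = (0, 1, x / 2, x\<^sup>2 / 12, - (z - x * y / 6) / 2)"
proof -
  have "cartan_mult (x, y, z, v, w) (s *\<^sub>R bY) = (x, y + s, z + s * x / 2,
      v + s * x\<^sup>2 / 12, w - s * z / 2 + s * (x * y) / 12 - s\<^sup>2 * x / 12)" for s
    by (simp add: cartan_mult_def bY_def field_simps power2_eq_square)
  moreover have "((\<lambda>s. (x, y + s, z + s * x / 2,
      v + s * x\<^sup>2 / 12, w - s * z / 2 + s * (x * y) / 12 - s\<^sup>2 * x / 12))
      has_vector_derivative (0, 1, x / 2, x\<^sup>2 / 12, - (z - x * y / 6) / 2)) (at 0)"
    by (intro has_vector_derivative_Pair)
       (auto simp: has_real_derivative_iff_has_vector_derivative[symmetric]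
         intro!: derivative_eq_intros)
  ultimately show ?thesis
    unfolding field_Y_def left_invariant_field_def
    by (simp add: vector_derivative_at)
qed


section \<open>Quasinorms, support functions and polar radius\<close>

definition quasinorm :: "(real \<times> real \<Rightarrow> real) \<Rightarrow> bool" where
  "quasinorm F \<longleftrightarrow>
     (\<forall>u. 0 \<le> F u) \<and> (\<forall>u. F u = 0 \<longleftrightarrow> u = 0) \<and>
     (\<forall>c u. 0 \<le> c \<longrightarrow> F (c *\<^sub>R u) = c * F u) \<and>
     (\<forall>u u'. F (u + u') \<le> F u + F u')"

definition unit_ball :: "(real \<times> real \<Rightarrow> real) \<Rightarrow> (real \<times> real) set" where
  "unit_ball F = {u. F u \<le> 1}"

text \<open>For the unit ball \<open>U\<close> of a quasinorm, which is compact and nonempty, the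
  supremum is a maximum.\<close>

definition support_fun :: "(real \<times> real) set \<Rightarrow> real \<times> real \<Rightarrow> real" where
  "support_fun U h = (SUP u\<in>U. h \<bullet> u)"

definition polar_radius :: "(real \<times> real) set \<Rightarrow> real \<Rightarrow> real" where
  "polar_radius U a = (THE \<rho>. 0 < \<rho> \<and> support_fun U (\<rho> * cos a, \<rho> * sin a) = 1)"

definition between_one_sided_derivs :: "(real \<Rightarrow> real) \<Rightarrow> real \<Rightarrow> real \<Rightarrow> bool" where
  "between_one_sided_derivs f a c \<longleftrightarrow>
     (\<exists>l r. (f has_real_derivative l) (at_left a) \<and>
            (f has_real_derivative r) (at_right a) \<and> c \<in> closed_segment l r)"


section \<open>Trajectories and extremals\<close>

definition abs_continuous_on :: "real set \<Rightarrow> (real \<Rightarrow> 'a::real_normed_vector) \<Rightarrow> bool" where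
  "abs_continuous_on S f \<longleftrightarrow>
     (\<forall>\<epsilon>>0. \<exists>\<delta>>0. \<forall>D T. D division_of T \<and> T \<subseteq> S \<and> (\<Sum>k\<in>D. Sup k - Inf k) < \<delta> \<longrightarrow>
        (\<Sum>k\<in>D. norm (f (Sup k) - f (Inf k))) < \<epsilon>)"

text \<open>On the whole line, absolute continuity means absolute continuity on every
  compact interval.\<close>

definition abs_continuous :: "(real \<Rightarrow> 'a::real_normed_vector) \<Rightarrow> bool" where
  "abs_continuous f \<longleftrightarrow> (\<forall>a b. abs_continuous_on {a..b} f)"

definition trajectory ::
  "(real \<times> real \<Rightarrow> real) \<Rightarrow> (real \<Rightarrow> cartan) \<Rightarrow> (real \<Rightarrow> real \<times> real) \<Rightarrow> bool" where
  "trajectory F g u \<longleftrightarrow>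
     abs_continuous g \<and> u \<in> borel_measurable lebesgue \<and> (\<forall>t. u t \<in> unit_ball F) \<and>
     (AE t in lebesgue. (g has_vector_derivative
        (fst (u t) *\<^sub>R field_X (g t) + snd (u t) *\<^sub>R field_Y (g t))) (at t))"

lemma trajectory_rhs_coord:
  "u1 *\<^sub>R field_X (x, y, z, v, w) + u2 *\<^sub>R field_Y (x, y, z, v, w) =
     (u1, u2, (x * u2 - y * u1) / 2,
      - (1/2) * (z + x * y / 6) * u1 + (1/12) * x\<^sup>2 * u2,
      - (1/12) * y\<^sup>2 * u1 - (1/2) * (z - x * y / 6) * u2)"
  by (simp add: field_X_coord field_Y_coord field_simps)

definition momentum :: "cartan \<Rightarrow> cartan \<Rightarrow> real \<times> real" where
  "momentum g p = (p \<bullet> field_X g, p \<bullet> field_Y g)"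

lemma momentum_coord:
  "momentum (x, y, z, v, w) (p1, p2, p3, p4, p5) =
     (p1 - (1/2) * p3 * y - (1/12) * p4 * x * y - (1/12) * p5 * y\<^sup>2 - (1/2) * p4 * z,
      p2 + (1/2) * p3 * x + (1/12) * p4 * x\<^sup>2 + (1/12) * p5 * x * y - (1/2) * p5 * z)"
  by (simp add: momentum_def field_X_coord field_Y_coord field_simps)

definition hamiltonian :: "cartan \<Rightarrow> cartan \<Rightarrow> real \<times> real \<Rightarrow> real" where
  "hamiltonian g p u = momentum g p \<bullet> u"

text \<open>Extremals with \<open>M = 1\<close>; \<open>D\<close> is the gradient of the Hamiltonian in the group
  variable.\<close>

definition extremal ::
  "(real \<times> real \<Rightarrow> real) \<Rightarrow> (real \<Rightarrow> cartan) \<Rightarrow> (real \<Rightarrow> real \<times> real) \<Rightarrow>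
   (real \<Rightarrow> cartan) \<Rightarrow> bool" where
  "extremal F g u \<psi> \<longleftrightarrow>
     trajectory F g u \<and> abs_continuous \<psi> \<and> (\<forall>t. \<psi> t \<noteq> 0) \<and>
     (AE t in lebesgue. \<exists>D. GDERIV (\<lambda>q. hamiltonian q (\<psi> t) (u t)) (g t) :> D \<and>
        (\<psi> has_vector_derivative - D) (at t)) \<and>
     (AE t in lebesgue.
        hamiltonian (g t) (\<psi> t) (u t) = support_fun (unit_ball F) (momentum (g t) (\<psi> t)) \<and>
        support_fun (unit_ball F) (momentum (g t) (\<psi> t)) = 1)"

definition polar_angle ::
  "(real \<times> real \<Rightarrow> real) \<Rightarrow> (real \<Rightarrow> cartan) \<Rightarrow> (real \<Rightarrow> cartan) \<Rightarrow> (real \<Rightarrow> real) \<Rightarrow> bool" where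
  "polar_angle F g \<psi> \<theta> \<longleftrightarrow>
     continuous_on UNIV \<theta> \<and>
     (\<forall>t. momentum (g t) (\<psi> t) =
        (polar_radius (unit_ball F) (\<theta> t) * cos (\<theta> t),
         polar_radius (unit_ball F) (\<theta> t) * sin (\<theta> t)))"


section \<open>Integral representation\<close>

text \<open>The value \<open>\<rho> \<tau>\<close> is the one denoted by \<open>r' (\<theta> \<tau>)\<close>; it is chosen for each time
  \<open>\<tau>\<close> and need not be a function of \<open>\<theta> \<tau>\<close>.  Measurable means Lebesgue measurable.\<close>

definition xdot_formula ::
  "(real \<Rightarrow> real) \<Rightarrow> (real \<Rightarrow> real) \<Rightarrow> (real \<Rightarrow> real) \<Rightarrow> real \<Rightarrow> real" where
  "xdot_formula r \<theta> \<rho> \<tau> = (\<rho> \<tau> * sin (\<theta> \<tau>) + r (\<theta> \<tau>) * cos (\<theta> \<tau>)) / (r (\<theta> \<tau>))\<^sup>2"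

definition ydot_formula ::
  "(real \<Rightarrow> real) \<Rightarrow> (real \<Rightarrow> real) \<Rightarrow> (real \<Rightarrow> real) \<Rightarrow> real \<Rightarrow> real" where
  "ydot_formula r \<theta> \<rho> \<tau> = (r (\<theta> \<tau>) * sin (\<theta> \<tau>) - \<rho> \<tau> * cos (\<theta> \<tau>)) / (r (\<theta> \<tau>))\<^sup>2"

fun angle_representation ::
  "(real \<Rightarrow> real) \<Rightarrow> cartan \<Rightarrow> (real \<Rightarrow> real) \<Rightarrow> (real \<Rightarrow> real) \<Rightarrow>
   (real \<Rightarrow> real) \<Rightarrow> (real \<Rightarrow> real) \<Rightarrow> bool" where
  "angle_representation r (\<phi>1, \<phi>2, \<phi>3, \<phi>4, \<phi>5) \<theta> \<rho> x y \<longleftrightarrow>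
     \<theta> C1_differentiable_on UNIV \<and>
     r (\<theta> 0) * cos (\<theta> 0) = \<phi>1 \<and> r (\<theta> 0) * sin (\<theta> 0) = \<phi>2 \<and>
     (\<forall>\<tau>. between_one_sided_derivs r (\<theta> \<tau>) (\<rho> \<tau>)) \<and>
     xdot_formula r \<theta> \<rho> \<in> borel_measurable lebesgue \<and>
     ydot_formula r \<theta> \<rho> \<in> borel_measurable lebesgue \<and>
     (\<forall>t. x t = (LINT \<tau>=0..ereal t|lebesgue. (xdot_formula r \<theta> \<rho> \<tau>))) \<and>
     (\<forall>t. y t = (LINT \<tau>=0..ereal t|lebesgue. (ydot_formula r \<theta> \<rho> \<tau>))) \<and>
     (\<forall>t. (r (\<theta> t))\<^sup>2 * deriv \<theta> t = \<phi>3 + \<phi>4 * x t + \<phi>5 * y t) \<and>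
     (\<forall>t. (deriv \<theta> t)\<^sup>2 =
        (\<phi>3\<^sup>2 + 2 * \<phi>4 * (r (\<theta> t) * sin (\<theta> t) - \<phi>2) - 2 * \<phi>5 * (r (\<theta> t) * cos (\<theta> t) - \<phi>1))
          / (r (\<theta> t)) ^ 4)"

text \<open>In the integrals below \<open>deriv\<close> is the derivative wherever it exists.  The functions
  involved are differentiable almost everywhere, so its unspecified value elsewhere is
  irrelevant for the (complete) Lebesgue measure.\<close>

definition zvw_formulas ::
  "(real \<Rightarrow> real) \<Rightarrow> (real \<Rightarrow> real) \<Rightarrow> (real \<Rightarrow> real) \<Rightarrow> (real \<Rightarrow> real) \<Rightarrow> (real \<Rightarrow> real) \<Rightarrow> bool"
  where
  "zvw_formulas x y z v w \<longleftrightarrow>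
     (\<forall>t. z t = - (1/2) * x t * y t + (LINT \<tau>=0..ereal t|lebesgue. (x \<tau> * deriv y \<tau>))) \<and>
     (\<forall>t. v t = (1/12) * (x t)\<^sup>2 * y t
        - (1/2) * x t * (LINT \<tau>=0..ereal t|lebesgue. (x \<tau> * deriv y \<tau>))
        + (1/2) * (LINT \<tau>=0..ereal t|lebesgue. ((x \<tau>)\<^sup>2 * deriv y \<tau>))) \<and>
     (\<forall>t. w t = - (1/12) * x t * (y t)\<^sup>2
        - (1/2) * y t * (LINT \<tau>=0..ereal t|lebesgue. (x \<tau> * deriv y \<tau>))
        + (LINT \<tau>=0..ereal t|lebesgue. (x \<tau> * y \<tau> * deriv y \<tau>)))"

definition zvw_formulas_alt ::
  "(real \<Rightarrow> real) \<Rightarrow> (real \<Rightarrow> real) \<Rightarrow> (real \<Rightarrow> real) \<Rightarrow> (real \<Rightarrow> real) \<Rightarrow> (real \<Rightarrow> real) \<Rightarrow> bool"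
  where
  "zvw_formulas_alt x y z v w \<longleftrightarrow>
     (\<forall>t. z t = (1/2) * (LINT \<tau>=0..ereal t|lebesgue. (x \<tau> * deriv y \<tau> - y \<tau> * deriv x \<tau>))) \<and>
     (\<forall>t. v t = (1/3) * (LINT \<tau>=0..ereal t|lebesgue. (x \<tau> * deriv z \<tau> - z \<tau> * deriv x \<tau>))
        - (1/6) * x t * z t) \<and>
     (\<forall>t. w t = (1/3) * (LINT \<tau>=0..ereal t|lebesgue. (y \<tau> * deriv z \<tau> - z \<tau> * deriv y \<tau>))
        - (1/6) * y t * z t)"

end

theory Submission
  imports Defs
begin

text \<open>Along an extremal the covector components \<open>\<psi>\<^sub>4\<close>, \<open>\<psi>\<^sub>5\<close> are constant and
  \<open>h\<^sub>3 = \<psi>(Z) = \<phi>\<^sub>3 + \<phi>\<^sub>4 x + \<phi>\<^sub>5 y\<close>, so that \<open>h\<^sub>1' = - h\<^sub>3 u\<^sub>2\<close> and \<open>h\<^sub>2' = h\<^sub>3 u\<^sub>1\<close> almost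
  everywhere.  The increment of the angle is governed by
  \<open>h\<^sub>1(t) h\<^sub>2(s) - h\<^sub>2(t) h\<^sub>1(s) = r(\<theta>(t)) r(\<theta>(s)) sin (\<theta>(s) - \<theta>(t))\<close>; as a function of \<open>s\<close> it has
  the almost everywhere derivative \<open>h\<^sub>3(s) (h(t) \<bullet> u(s))\<close>, which tends to \<open>h\<^sub>3(t)\<close> as \<open>s\<close> tends to
  \<open>t\<close> because \<open>h(s) \<bullet> u(s) = 1\<close>.  Hence \<open>\<theta>\<close> is differentiable at every \<open>t\<close>.  The controls maximizing
  \<open>h \<bullet> u\<close> over the unit ball are the subgradients of the support function at \<open>h\<close>, which in polar
  coordinates are parametrized by the values between the one-sided derivatives of \<open>r\<close>.

  Conversely, \<open>\<psi>\<close> is chosen so that its momentum is \<open>r(\<theta>) (cos \<theta>, sin \<theta>)\<close>.  The adjoint equation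
  needs the derivative of \<open>r \<circ> \<theta>\<close> almost everywhere: where \<open>\<theta>' = 0\<close> it vanishes since \<open>r\<close> is
  Lipschitz, and the times at which \<open>\<theta>' \<noteq> 0\<close> and \<open>r\<close> has a corner at \<open>\<theta>\<close> are strict local maxima
  of \<open>r \<circ> \<theta> - q \<theta>\<close> for some rational \<open>q\<close>, hence countably many.\<close>

section \<open>Absolutely continuous functions\<close>

text \<open>The obstacle is that every equation of an extremal holds only almost everywhere, while
  \<theta> has to be differentiable at each time. Two facts bridge the gap: an absolutely continuous
  function is the integral of its almost everywhere derivative, and the primitive of a locally
  bounded measurable function has that function as its derivative almost everywhere. The first turns
  an extremal into integral formulas, the second turns integrals back into a trajectory. The
  increment of \<theta> is measured by a cross product because there the unknown control enters the
  derivative only through \<open>h(t) \<bullet> u(s)\<close>, which is close to 1 for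
  \<open>s\<close> near \<open>t\<close> although \<open>u\<close> itself may jump. The formula for
  the square of the derivative of \<theta> is a first integral:
  \<open>h3^2 - 2 \<phi>4 h2 + 2 \<phi>5 h1\<close> is constant along an extremal. All corners of
  \<open>r\<close> have the same orientation: \<open>r\<close> is the reciprocal of the convex
  function \<open>H\<close> on the unit circle, so its right slope never exceeds its left slope.
  This is why subtracting a linear function turns a corner into a maximum.\<close>

lemma straddle:
  fixes f :: "real \<Rightarrow> real"
  assumes "(f has_real_derivative k) (at x)" "e > 0"
  obtains d where "d > 0"
    "\<And>u v. \<lbrakk>u \<le> x; x \<le> v; x - d < u; v < x + d\<rbrakk> \<Longrightarrow> \<bar>f v - f u - k * (v - u)\<bar> \<le> e * (v - u)"
proof -
  obtain d where d: "d > 0" "\<And>y. norm (y - x) < d \<Longrightarrow> norm (f y - f x - k * (y - x)) \<le> e * norm (y - x)"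
    using assms unfolding has_field_derivative_def has_derivative_at_alt by (auto simp: mult.commute)
  show thesis
  proof
    fix u v assume uv: "u \<le> x" "x \<le> v" "x - d < u" "v < x + d"
    have "\<bar>f v - f u - k * (v - u)\<bar> \<le> \<bar>f v - f x - k * (v - x)\<bar> + \<bar>f u - f x - k * (u - x)\<bar>"
      by (simp add: algebra_simps)
    also have "\<dots> \<le> e * \<bar>v - x\<bar> + e * \<bar>u - x\<bar>"
      using d(2)[of v] d(2)[of u] uv by (intro add_mono) auto
    also have "\<dots> = e * (v - u)" using uv by (simp add: algebra_simps)
    finally show "\<bar>f v - f u - k * (v - u)\<bar> \<le> e * (v - u)" .
  qed (use d in auto)
qed

text \<open>Absolute continuity speaks of divisions, the gauge integral of tagged partial divisions.
  The members of \<open>p\<close> overlap only in negligible sets, so their total length is the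
  measure of their union, which is at most that of \<open>T\<close>.\<close>

lemma abs_continuous_onD_tagged:
  fixes f :: "real \<Rightarrow> real"
  assumes p: "p tagged_partial_division_of {a..b}"
    and AC: "\<And>D T. D division_of T \<Longrightarrow> T \<subseteq> {a..b} \<Longrightarrow> (\<Sum>k\<in>D. Sup k - Inf k) < \<delta> \<Longrightarrow>
        (\<Sum>k\<in>D. norm (f (Sup k) - f (Inf k))) < \<epsilon>"
    and meas: "\<And>x K. (x, K) \<in> p \<Longrightarrow> K \<subseteq> T" "T \<in> lmeasurable" "measure lebesgue T < \<delta>"
  shows "(\<Sum>(x, K)\<in>p. \<bar>f (Sup K) - f (Inf K)\<bar>) < \<epsilon>"
proof -
  let ?D = "snd ` p"
  have D: "?D division_of \<Union>?D" using p by (rule partial_division_of_tagged_division)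
  note D' = division_ofD[OF D]
  have cb: "\<exists>u v. u \<le> v \<and> K = {u..v}" if K: "K \<in> ?D" for K
  proof -
    obtain u v where "K = cbox u v" using D'(4)[OF K] by blast
    with D'(3)[OF K] show ?thesis by (intro exI[of _ u] exI[of _ v]) auto
  qed
  have neg: "pairwise (\<lambda>S T. negligible (S \<inter> T)) ?D"
  proof (rule pairwiseI)
    fix S T assume ST: "S \<in> ?D" "T \<in> ?D" "S \<noteq> T"
    obtain u v u' v' where uv: "S = {u..v}" "T = {u'..v'}" using cb ST by metis
    have "interior ({u..v} \<inter> {u'..v'}) = {}" using D'(5)[OF ST] unfolding uv by simp
    then have "min v v' \<le> max u u'" by (simp add: Int_atLeastAtMost)
    then have "S \<inter> T \<subseteq> {max u u'}" unfolding uv by auto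
    then show "negligible (S \<inter> T)" using negligible_subset negligible_sing by blast
  qed
  have "(\<Sum>k\<in>?D. Sup k - Inf k) = (\<Sum>k\<in>?D. measure lebesgue k)"
    by (rule sum.cong[OF refl]) (use cb in fastforce)
  also have "\<dots> = measure lebesgue (\<Union>?D)"
    using D'(1) neg cb by (intro measure_negligible_finite_Union[symmetric]) fastforce+
  also have "\<dots> \<le> measure lebesgue T"
  proof (rule measure_mono_fmeasurable)
    show "\<Union>?D \<subseteq> T"
    proof (rule Union_least)
      fix K assume "K \<in> ?D"
      then obtain x where "(x, K) \<in> p" by auto
      then show "K \<subseteq> T" by (rule meas(1))
    qed
    show "\<Union>?D \<in> sets lebesgue" using D'(1) cb by (intro sets.finite_Union) fastforce+
  qed (rule meas)
  also have "\<dots> < \<delta>" by (rule meas)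
  finally have "(\<Sum>k\<in>?D. norm (f (Sup k) - f (Inf k))) < \<epsilon>"
  proof (intro AC[OF D] Union_least)
    fix K assume "K \<in> ?D"
    then obtain x where "(x, K) \<in> p" by auto
    then show "K \<subseteq> {a..b}" by (rule tagged_partial_division_ofD(3)[OF p])
  qed
  moreover have "(\<Sum>(x, K)\<in>p. \<bar>f (Sup K) - f (Inf K)\<bar>) = (\<Sum>k\<in>?D. \<bar>f (Sup k) - f (Inf k)\<bar>)"
  proof -
    \<comment> \<open>Summing over intervals instead of tagged pairs requires the value 0 on
      degenerate intervals. For the empty set \<open>Sup\<close> and \<open>Inf\<close> are
      unspecified, hence the case distinction.\<close>
    let ?d = "\<lambda>k. if k = {} then 0 else \<bar>f (Sup k) - f (Inf k)\<bar>"
    have "(\<Sum>(x, K)\<in>p. ?d K) = (\<Sum>k\<in>?D. ?d k)"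
      by (rule sum.over_tagged_division_lemma[OF tagged_partial_division_of_Union_self[OF p]])
        (auto simp: box_eq_empty not_less le_less)
    moreover have "(\<Sum>(x, K)\<in>p. ?d K) = (\<Sum>(x, K)\<in>p. \<bar>f (Sup K) - f (Inf K)\<bar>)"
      by (rule sum.cong[OF refl]) (use D'(3) in fastforce)
    moreover have "(\<Sum>k\<in>?D. ?d k) = (\<Sum>k\<in>?D. \<bar>f (Sup k) - f (Inf k)\<bar>)"
      by (rule sum.cong[OF refl]) (use D'(3) in fastforce)
    ultimately show ?thesis by simp
  qed
  ultimately show ?thesis by simp
qed

text \<open>Riemann sums are split by the position of the tag. Tags outside \<open>N\<close>
  contribute a small error by \<open>straddle\<close>, in which the tag may sit anywhere in its
  interval. For tags in \<open>N\<close> the integrand is set to 0, and their intervals are forced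
  into an open set of measure below \<delta>, where absolute continuity makes the increments of
  \<open>f\<close> small. Integrability of \<open>k\<close> is part of the conclusion.\<close>

theorem abs_continuous_on_has_integral:
  fixes f k :: "real \<Rightarrow> real"
  assumes ab: "a \<le> b" and f: "abs_continuous_on {a..b} f" and N: "negligible N"
    and deriv: "\<And>t. t \<in> {a..b} - N \<Longrightarrow> (f has_real_derivative k t) (at t)"
  shows "(k has_integral f b - f a) {a..b}"
proof -
  define k' where "k' t = (if t \<in> N then 0 else k t)" for t
  have "(k' has_integral f b - f a) (cbox a b)"
    unfolding has_integral
  proof (intro allI impI)
    fix e :: real assume e: "e > 0"
    \<comment> \<open>The summand 1 keeps the denominator positive when
      \<open>a = b\<close>.\<close>
    define e' where "e' = e / 2 / (b - a + 1)"
    have e': "e' > 0" using e ab by (simp add: e'_def)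
    obtain \<delta> where \<delta>: "\<delta> > 0" "\<And>D T. D division_of T \<Longrightarrow> T \<subseteq> {a..b} \<Longrightarrow> (\<Sum>k\<in>D. Sup k - Inf k) < \<delta> \<Longrightarrow>
        (\<Sum>k\<in>D. norm (f (Sup k) - f (Inf k))) < e / 2"
      using f e unfolding abs_continuous_on_def by (meson half_gt_zero)
    have "N \<in> sets lebesgue" using N by (simp add: negligible_imp_sets)
    then obtain T where T: "open T" "N \<subseteq> T" "T - N \<in> lmeasurable" "emeasure lebesgue (T - N) < ennreal \<delta>"
      using \<delta>(1) sets_lebesgue_outer_open by metis
    have TN: "T = (T - N) \<union> N" using T by auto
    have Tm: "T \<in> lmeasurable" using T(3) N TN by (metis fmeasurable.Un negligible_imp_measurable)
    have "measure lebesgue T \<le> measure lebesgue (T - N)"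
      using T(3) N TN by (metis add.right_neutral measure_Un_le negligible_imp_measure0 negligible_imp_sets fmeasurableD)
    also have "\<dots> < \<delta>"
      using T(3,4) \<delta>(1) by (metis emeasure_eq_measure2 ennreal_less_iff measure_nonneg)
    finally have mT: "measure lebesgue T < \<delta>" .
    have "\<exists>d>0. \<forall>u v. u \<le> t \<longrightarrow> t \<le> v \<longrightarrow> t - d < u \<longrightarrow> v < t + d \<longrightarrow>
         \<bar>f v - f u - k t * (v - u)\<bar> \<le> e' * (v - u)" if "t \<in> {a..b} - N" for t
      using straddle[OF deriv[OF that] e'] by metis
    then obtain d where d: "\<And>t. t \<in> {a..b} - N \<Longrightarrow> d t > 0"
      "\<And>t u v. \<lbrakk>t \<in> {a..b} - N; u \<le> t; t \<le> v; t - d t < u; v < t + d t\<rbrakk> \<Longrightarrow>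
         \<bar>f v - f u - k t * (v - u)\<bar> \<le> e' * (v - u)"
      by metis
    \<comment> \<open>Points outside \<open>{a..b}\<close> never occur as tags, so their gauge value
      is arbitrary.\<close>
    define \<gamma> where "\<gamma> t = (if t \<in> N then T else if t \<in> {a..b} then ball t (d t) else UNIV)" for t
    have gauge: "gauge \<gamma>" using T d by (auto simp: gauge_def \<gamma>_def)
    have small: "norm ((\<Sum>(x,K)\<in>p. measure lborel K *\<^sub>R k' x) - (f b - f a)) < e"
      if p: "p tagged_division_of cbox a b" and fine: "\<gamma> fine p" for p
    proof -
      note pD = tagged_division_ofD[OF p]
      define p1 where "p1 = {q \<in> p. fst q \<in> N}"
      define p2 where "p2 = {q \<in> p. fst q \<notin> N}"
      have fin: "finite p1" "finite p2" "p = p1 \<union> p2" "p1 \<inter> p2 = {}" 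
        using pD(1) by (auto simp: p1_def p2_def)
      have K: "\<exists>u v. K = {u..v} \<and> u \<le> x \<and> x \<le> v \<and> x \<in> {a..b}" if "(x, K) \<in> p" for x K
        using pD(2)[OF that] pD(3)[OF that] pD(4)[OF that] by auto
      have part: "p1 tagged_partial_division_of {a..b}"
        using p by (auto simp: tagged_division_of_def p1_def intro: tagged_partial_division_subset)
      have s1: "(\<Sum>(x, K)\<in>p1. \<bar>f (Sup K) - f (Inf K)\<bar>) < e / 2"
      proof (rule abs_continuous_onD_tagged[OF part \<delta>(2) _ Tm mT])
        show "K \<subseteq> T" if "(x, K) \<in> p1" for x K
          using that bspec[OF fine[unfolded fine_def], of "(x, K)"] by (auto simp: p1_def \<gamma>_def)
      qed
      have s2: "\<bar>measure lborel K * k' x - (f (Sup K) - f (Inf K))\<bar> \<le> e' * measure lborel K" if xK: "(x, K) \<in> p2" for x K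
      proof -
        have xp: "(x, K) \<in> p" "x \<notin> N" using xK by (auto simp: p2_def)
        obtain u v where uv: "K = {u..v}" "u \<le> x" "x \<le> v" "x \<in> {a..b}" using K[OF xp(1)] by blast
        have Kball: "K \<subseteq> ball x (d x)" using bspec[OF fine[unfolded fine_def] xp(1)] xp uv(4) by (auto simp: \<gamma>_def)
        have "u \<in> K" "v \<in> K" using uv by auto
        then have "u \<in> ball x (d x)" "v \<in> ball x (d x)" using Kball by blast+
        then have "\<bar>f v - f u - k x * (v - u)\<bar> \<le> e' * (v - u)"
          using uv xp by (intro d) (auto simp: dist_real_def)
        then show ?thesis using uv xp by (simp add: k'_def algebra_simps abs_minus_commute)
      qed
      have fba: "f b - f a = (\<Sum>(x,K)\<in>p. f (Sup K) - f (Inf K))"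
        using additive_tagged_division_1[OF ab, of p f] p by simp
      have cba: "b - a = (\<Sum>(x,K)\<in>p. measure lborel K)"
        using additive_content_tagged_division[OF p] ab by simp
      have "(\<Sum>(x,K)\<in>p. measure lborel K *\<^sub>R k' x) - (f b - f a)
          = (\<Sum>(x,K)\<in>p. measure lborel K * k' x - (f (Sup K) - f (Inf K)))"
        unfolding fba by (simp add: sum_subtractf split_def)
      also have "\<dots> = (\<Sum>(x,K)\<in>p1. measure lborel K * k' x - (f (Sup K) - f (Inf K)))
           + (\<Sum>(x,K)\<in>p2. measure lborel K * k' x - (f (Sup K) - f (Inf K)))"
        using fin by (simp add: sum.union_disjoint)
      also have "\<bar>\<dots>\<bar> \<le> (\<Sum>(x,K)\<in>p1. \<bar>f (Sup K) - f (Inf K)\<bar>) + (\<Sum>(x,K)\<in>p2. e' * measure lborel K)"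
      proof (rule order_trans[OF abs_triangle_ineq add_mono])
        show "\<bar>\<Sum>(x,K)\<in>p1. measure lborel K * k' x - (f (Sup K) - f (Inf K))\<bar> \<le> (\<Sum>(x,K)\<in>p1. \<bar>f (Sup K) - f (Inf K)\<bar>)"
          by (rule order_trans[OF sum_abs sum_mono]) (auto simp: p1_def k'_def)
        show "\<bar>\<Sum>(x,K)\<in>p2. measure lborel K * k' x - (f (Sup K) - f (Inf K))\<bar> \<le> (\<Sum>(x,K)\<in>p2. e' * measure lborel K)"
          by (rule order_trans[OF sum_abs sum_mono]) (use s2 in auto)
      qed
      also have "\<dots> < e / 2 + e / 2"
      proof (rule add_less_le_mono[OF s1])
        have "(\<Sum>(x,K)\<in>p2. e' * measure lborel K) \<le> (\<Sum>(x,K)\<in>p. e' * measure lborel K)"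
          using pD(1) e' by (intro sum_mono2) (auto simp: p2_def)
        also have "\<dots> = e' * (b - a)" by (simp add: cba sum_distrib_left split_def)
        also have "\<dots> \<le> e / 2" using e ab by (simp add: e'_def field_simps)
        finally show "(\<Sum>(x,K)\<in>p2. e' * measure lborel K) \<le> e / 2" .
      qed
      finally show ?thesis by simp
    qed
    show "\<exists>\<gamma>. gauge \<gamma> \<and> (\<forall>p. p tagged_division_of cbox a b \<and> \<gamma> fine p \<longrightarrow>
             norm ((\<Sum>(x,K)\<in>p. measure lborel K *\<^sub>R k' x) - (f b - f a)) < e)" 
      by (intro exI[of _ \<gamma>] conjI allI impI gauge) (elim conjE, rule small)
  qed
  then have "(k' has_integral f b - f a) {a..b}" by simp
  then show ?thesis
    by (rule has_integral_spike[OF N, rotated]) (auto simp: k'_def)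
qed

section \<open>Closure properties of absolutely continuous functions\<close>

lemma abs_continuous_onE:
  assumes "abs_continuous_on S f" "\<epsilon> > 0"
  obtains \<delta> where "\<delta> > 0" "\<forall>D T. D division_of T \<and> T \<subseteq> S \<and> (\<Sum>k\<in>D. Sup k - Inf k) < \<delta> \<longrightarrow>
        (\<Sum>k\<in>D. norm (f (Sup k) - f (Inf k))) < \<epsilon>"
proof -
  have "\<exists>\<delta>>0. \<forall>D T. D division_of T \<and> T \<subseteq> S \<and> (\<Sum>k\<in>D. Sup k - Inf k) < \<delta> \<longrightarrow>
        (\<Sum>k\<in>D. norm (f (Sup k) - f (Inf k))) < \<epsilon>"
    using assms unfolding abs_continuous_on_def by simp
  with that show thesis by (elim exE conjE)
qed

lemma division_of_real_interval:
  fixes T :: "real set"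
  assumes "D division_of T" "T \<subseteq> {a..b}" "K \<in> D"
  obtains u v where "K = {u..v}" "u \<le> v" "Sup K = v" "Inf K = u" "a \<le> u" "v \<le> b"
proof -
  obtain u v where uv: "K = {u..v}" using division_ofD(4)[OF assms(1,3)] by auto
  have "K \<noteq> {}" "K \<subseteq> {a..b}" using division_ofD(2,3)[OF assms(1,3)] assms(2) by auto
  with uv show thesis by (intro that[of u v]) auto
qed

text \<open>One comparison criterion serves all closure properties. Two dominating functions are
  allowed so that sums, products and pairs are covered directly.\<close>

lemma abs_continuous_on_dominated:
  assumes f: "abs_continuous_on {a..b} f" and g: "abs_continuous_on {a..b} g"
    and le: "\<And>u v. \<lbrakk>u \<in> {a..b}; v \<in> {a..b}\<rbrakk> \<Longrightarrow> norm (h v - h u) \<le> M * (norm (f v - f u) + norm (g v - g u))"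
  shows "abs_continuous_on {a..b} h"
  unfolding abs_continuous_on_def
proof (intro allI impI)
  fix \<epsilon> :: real assume \<epsilon>: "\<epsilon> > 0"
  define M' where "M' = max M 1"
  have M': "M' > 0" "M \<le> M'" by (auto simp: M'_def)
  have e2: "\<epsilon> / (2 * M') > 0" using \<epsilon> M' by simp
  obtain \<delta>1 where \<delta>1: "\<delta>1 > 0" "\<forall>D T. D division_of T \<and> T \<subseteq> {a..b} \<and> (\<Sum>k\<in>D. Sup k - Inf k) < \<delta>1 \<longrightarrow>
        (\<Sum>k\<in>D. norm (f (Sup k) - f (Inf k))) < \<epsilon> / (2 * M')" by (rule abs_continuous_onE[OF f e2])
  obtain \<delta>2 where \<delta>2: "\<delta>2 > 0" "\<forall>D T. D division_of T \<and> T \<subseteq> {a..b} \<and> (\<Sum>k\<in>D. Sup k - Inf k) < \<delta>2 \<longrightarrow>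
        (\<Sum>k\<in>D. norm (g (Sup k) - g (Inf k))) < \<epsilon> / (2 * M')" by (rule abs_continuous_onE[OF g e2])
  show "\<exists>\<delta>>0. \<forall>D T. D division_of T \<and> T \<subseteq> {a..b} \<and> (\<Sum>k\<in>D. Sup k - Inf k) < \<delta> \<longrightarrow>
        (\<Sum>k\<in>D. norm (h (Sup k) - h (Inf k))) < \<epsilon>"
  proof (intro exI[of _ "min \<delta>1 \<delta>2"] conjI allI impI)
    fix D T assume DT: "D division_of T \<and> T \<subseteq> {a..b} \<and> (\<Sum>k\<in>D. Sup k - Inf k) < min \<delta>1 \<delta>2"
    have "(\<Sum>k\<in>D. norm (h (Sup k) - h (Inf k)))
        \<le> (\<Sum>k\<in>D. M' * (norm (f (Sup k) - f (Inf k)) + norm (g (Sup k) - g (Inf k))))"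
    proof (rule sum_mono)
      fix k assume k: "k \<in> D"
      obtain u v where "u \<le> v" "Sup k = v" "Inf k = u" "a \<le> u" "v \<le> b"
        using division_of_real_interval[of D T a b k] DT k by blast
      then have "norm (h (Sup k) - h (Inf k)) \<le> M * (norm (f (Sup k) - f (Inf k)) + norm (g (Sup k) - g (Inf k)))"
        by (intro le) auto
      also have "\<dots> \<le> M' * (norm (f (Sup k) - f (Inf k)) + norm (g (Sup k) - g (Inf k)))"
        using M' by (intro mult_right_mono) auto
      finally show "norm (h (Sup k) - h (Inf k)) \<le> M' * (norm (f (Sup k) - f (Inf k)) + norm (g (Sup k) - g (Inf k)))" .
    qed
    also have "\<dots> = M' * ((\<Sum>k\<in>D. norm (f (Sup k) - f (Inf k))) + (\<Sum>k\<in>D. norm (g (Sup k) - g (Inf k))))"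
      by (simp add: sum.distrib flip: sum_distrib_left)
    also have "\<dots> < M' * (\<epsilon> / (2 * M') + \<epsilon> / (2 * M'))"
      using \<delta>1(2)[rule_format, of D T] \<delta>2(2)[rule_format, of D T] DT M' by (intro mult_strict_left_mono add_strict_mono) auto
    also have "\<dots> = \<epsilon>" using M' by simp
    finally show "(\<Sum>k\<in>D. norm (h (Sup k) - h (Inf k))) < \<epsilon>" .
  qed (use \<delta>1 \<delta>2 in auto)
qed

lemma abs_continuous_on_imp_continuous_on:
  assumes "abs_continuous_on {a..b} f"
  shows "continuous_on {a..b} f"
  unfolding continuous_on_iff
proof (intro ballI allI impI)
  fix t \<epsilon> :: real assume t: "t \<in> {a..b}" and \<epsilon>: "\<epsilon> > 0"
  obtain \<delta> where \<delta>: "\<delta> > 0" "\<forall>D T. D division_of T \<and> T \<subseteq> {a..b} \<and> (\<Sum>k\<in>D. Sup k - Inf k) < \<delta> \<longrightarrow>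
        (\<Sum>k\<in>D. norm (f (Sup k) - f (Inf k))) < \<epsilon>" by (rule abs_continuous_onE[OF assms \<epsilon>])
  have *: "norm (f v - f u) < \<epsilon>" if "u \<in> {a..b}" "v \<in> {a..b}" "u \<le> v" "v - u < \<delta>" for u v
    using \<delta>(2)[rule_format, of "{{u..v}}" "{u..v}"] that division_of_self[of u v] by simp
  show "\<exists>d>0. \<forall>x'\<in>{a..b}. dist x' t < d \<longrightarrow> dist (f x') (f t) < \<epsilon>"
  proof (intro exI[of _ \<delta>] conjI ballI impI)
    fix s assume s: "s \<in> {a..b}" "dist s t < \<delta>"
    show "dist (f s) (f t) < \<epsilon>"
    proof (cases "s \<le> t")
      case True
      then show ?thesis using *[of s t] s t by (simp add: dist_norm norm_minus_commute dist_real_def)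
    next
      case False
      then show ?thesis using *[of t s] s t by (simp add: dist_norm dist_real_def)
    qed
  qed (rule \<delta>)
qed

lemma abs_continuous_imp_continuous:
  assumes "abs_continuous f"
  shows "continuous_on UNIV f"
proof -
  have "isCont f t" for t
  proof -
    have "continuous_on {t - 1<..<t + 1} f"
      by (rule continuous_on_subset[OF abs_continuous_on_imp_continuous_on[of "t - 1" "t + 1"]])
        (use assms in \<open>auto simp: abs_continuous_def\<close>)
    then show ?thesis by (auto simp: continuous_on_eq_continuous_at)
  qed
  then show ?thesis by (simp add: continuous_on_eq_continuous_at)
qed

lemma abs_continuous_on_const: "abs_continuous_on S (\<lambda>t. c)"
  by (auto simp: abs_continuous_on_def intro: exI[of _ 1])

lemma abs_continuous_on_ident: "abs_continuous_on {a..b} (\<lambda>t::real. t)"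
  unfolding abs_continuous_on_def
proof (intro allI impI)
  fix \<epsilon> :: real assume "\<epsilon> > 0"
  moreover have "(\<Sum>k\<in>D. norm (Sup k - Inf k)) = (\<Sum>k\<in>D. Sup k - Inf k)"
    if "D division_of T" "T \<subseteq> {a..b}" for D T
  proof (rule sum.cong[OF refl])
    fix k assume "k \<in> D"
    from division_of_real_interval[OF that this] show "norm (Sup k - Inf k) = Sup k - Inf k"
      by (metis abs_of_nonneg diff_ge_0_iff_ge real_norm_def)
  qed
  ultimately show "\<exists>\<delta>>0. \<forall>D T. D division_of T \<and> T \<subseteq> {a..b} \<and> (\<Sum>k\<in>D. Sup k - Inf k) < \<delta> \<longrightarrow>
        (\<Sum>k\<in>D. norm (Sup k - Inf k)) < \<epsilon>" by (intro exI[of _ \<epsilon>]) auto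
qed

lemma abs_continuous_dominated:
  assumes "abs_continuous f"
    and "\<And>u v. norm (h v - h u) \<le> M * norm (f v - f u)"
  shows "abs_continuous h"
  using assms abs_continuous_on_dominated[of _ _ f "\<lambda>_. 0::real" h M]
  by (auto simp: abs_continuous_def abs_continuous_on_const)

lemma abs_continuous_lipschitz:
  assumes "\<And>a b. \<exists>M. \<forall>u\<in>{a..b}. \<forall>v\<in>{a..b}. norm (h v - h u) \<le> M * \<bar>v - u\<bar>"
  shows "abs_continuous h"
  unfolding abs_continuous_def
proof (intro allI)
  fix a b
  obtain M where "\<forall>u\<in>{a..b}. \<forall>v\<in>{a..b}. norm (h v - h u) \<le> M * \<bar>v - u\<bar>" using assms by metis
  then show "abs_continuous_on {a..b} h"
    using abs_continuous_on_dominated[OF abs_continuous_on_ident abs_continuous_on_const[of _ "0::real"], of a b h M]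
    by auto
qed

lemma abs_continuous_const: "abs_continuous (\<lambda>t. c)"
  by (simp add: abs_continuous_def abs_continuous_on_const)

lemma norm_fst_le_norm: "norm (fst x) \<le> norm x" and norm_snd_le_norm: "norm (snd x) \<le> norm x"
  by (cases x, simp add: norm_Pair)+

lemma abs_continuous_fst: "abs_continuous f \<Longrightarrow> abs_continuous (\<lambda>t. fst (f t))"
  by (erule abs_continuous_dominated[of _ _ 1]) (simp flip: fst_diff add: norm_fst_le_norm)

lemma abs_continuous_snd: "abs_continuous f \<Longrightarrow> abs_continuous (\<lambda>t. snd (f t))"
  by (erule abs_continuous_dominated[of _ _ 1]) (simp flip: snd_diff add: norm_snd_le_norm)

lemma abs_continuous_Pair:
  assumes "abs_continuous f" "abs_continuous g"
  shows "abs_continuous (\<lambda>t. (f t, g t))"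
  unfolding abs_continuous_def
proof (intro allI)
  fix a b show "abs_continuous_on {a..b} (\<lambda>t. (f t, g t))"
    by (rule abs_continuous_on_dominated[of _ _ f g _ 1])
      (use assms norm_Pair_le in \<open>auto simp: abs_continuous_def\<close>)
qed

lemma abs_continuous_add:
  assumes "abs_continuous f" "abs_continuous g"
  shows "abs_continuous (\<lambda>t. f t + g t)"
  unfolding abs_continuous_def
proof (intro allI)
  fix a b show "abs_continuous_on {a..b} (\<lambda>t. f t + g t)"
    by (rule abs_continuous_on_dominated[of _ _ f g _ 1])
      (use assms in \<open>auto simp: abs_continuous_def add_diff_add norm_triangle_ineq\<close>)
qed

lemma abs_continuous_mult:
  fixes f g :: "real \<Rightarrow> real"
  assumes "abs_continuous f" "abs_continuous g"
  shows "abs_continuous (\<lambda>t. f t * g t)"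
  unfolding abs_continuous_def
proof (intro allI)
  fix a b :: real
  have "bounded (f ` {a..b})" "bounded (g ` {a..b})"
    using assms[THEN abs_continuous_imp_continuous]
    by (auto intro!: compact_imp_bounded compact_continuous_image intro: continuous_on_subset)
  then obtain A B where A: "\<And>t. t \<in> {a..b} \<Longrightarrow> \<bar>f t\<bar> \<le> A" and B: "\<And>t. t \<in> {a..b} \<Longrightarrow> \<bar>g t\<bar> \<le> B"
    unfolding bounded_iff by fastforce
  show "abs_continuous_on {a..b} (\<lambda>t. f t * g t)"
  proof (rule abs_continuous_on_dominated[of _ _ f g _ "max A B"])
    fix u v assume uv: "u \<in> {a..b}" "v \<in> {a..b}"
    have "f v * g v - f u * g u = (f v - f u) * g v + (g v - g u) * f u" by (simp add: algebra_simps)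
    then have "\<bar>f v * g v - f u * g u\<bar> \<le> \<bar>f v - f u\<bar> * \<bar>g v\<bar> + \<bar>g v - g u\<bar> * \<bar>f u\<bar>"
      by (metis abs_mult abs_triangle_ineq)
    also have "\<dots> \<le> \<bar>f v - f u\<bar> * max A B + \<bar>g v - g u\<bar> * max A B"
      using A[OF uv(1)] B[OF uv(2)] by (intro add_mono mult_left_mono) auto
    finally show "norm (f v * g v - f u * g u) \<le> max A B * (norm (f v - f u) + norm (g v - g u))"
      by (simp add: algebra_simps)
  qed (use assms in \<open>auto simp: abs_continuous_def\<close>)
qed

lemma abs_continuous_uminus: "abs_continuous f \<Longrightarrow> abs_continuous (\<lambda>t. - f t)"
  by (erule abs_continuous_dominated[of _ _ 1]) (simp add: norm_minus_commute)

lemma abs_continuous_diff: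
  assumes "abs_continuous f" "abs_continuous g"
  shows "abs_continuous (\<lambda>t. f t - g t)"
  using abs_continuous_add[OF assms(1) abs_continuous_uminus[OF assms(2)]] by simp

lemma abs_continuous_power:
  fixes f :: "real \<Rightarrow> real"
  assumes "abs_continuous f"
  shows "abs_continuous (\<lambda>t. f t ^ n)"
  by (induction n) (use assms in \<open>auto intro: abs_continuous_const abs_continuous_mult\<close>)

lemma abs_continuous_divide:
  fixes f :: "real \<Rightarrow> real"
  assumes "abs_continuous f"
  shows "abs_continuous (\<lambda>t. f t / c)"
  using abs_continuous_mult[OF assms abs_continuous_const[of "1 / c"]] by simp

lemmas abs_continuous_intros =
  abs_continuous_const abs_continuous_add abs_continuous_mult abs_continuous_diff abs_continuous_uminus
  abs_continuous_power abs_continuous_divide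

section \<open>Primitives of locally bounded measurable functions\<close>

text \<open>The class of integrands used throughout: it contains the controls and all continuous
  functions, and unlike integrability it is stable under products.\<close>

definition loc_bounded_measurable :: "(real \<Rightarrow> real) \<Rightarrow> bool" where
  "loc_bounded_measurable k \<longleftrightarrow> k \<in> borel_measurable lebesgue \<and> (\<forall>a b. bounded (k ` {a..b}))"

lemma loc_bounded_measurableE:
  assumes "loc_bounded_measurable k"
  obtains B where "B > 0" "\<And>t. t \<in> {a..b} \<Longrightarrow> \<bar>k t\<bar> \<le> B"
proof -
  have "bounded (k ` {a..b})" using assms by (simp add: loc_bounded_measurable_def)
  with that show thesis by (fastforce simp: bounded_pos)
qed

lemma loc_bounded_measurableI:
  assumes "k \<in> borel_measurable lebesgue" "\<And>a b. \<exists>B. \<forall>t\<in>{a..b}. \<bar>k t\<bar> \<le> B"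
  shows "loc_bounded_measurable k"
  using assms by (auto simp: loc_bounded_measurable_def bounded_iff)

lemma loc_bounded_measurable_const: "loc_bounded_measurable (\<lambda>_. c)"
  by (rule loc_bounded_measurableI) auto

lemma loc_bounded_measurable_continuous:
  assumes "continuous_on UNIV k"
  shows "loc_bounded_measurable k"
  unfolding loc_bounded_measurable_def
proof (intro conjI allI)
  show "k \<in> borel_measurable lebesgue"
    using assms continuous_imp_measurable_on_sets_lebesgue[of UNIV k] by simp
  show "bounded (k ` {a..b})" for a b
    using assms by (auto intro!: compact_imp_bounded compact_continuous_image intro: continuous_on_subset)
qed

lemma loc_bounded_measurable_add:
  assumes "loc_bounded_measurable k" "loc_bounded_measurable l"
  shows "loc_bounded_measurable (\<lambda>t. k t + l t)"
  using assms by (auto simp: loc_bounded_measurable_def intro: bounded_plus_comp)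

lemma loc_bounded_measurable_diff:
  assumes "loc_bounded_measurable k" "loc_bounded_measurable l"
  shows "loc_bounded_measurable (\<lambda>t. k t - l t)"
  using assms by (auto simp: loc_bounded_measurable_def intro: bounded_minus_comp)

lemma loc_bounded_measurable_mult:
  assumes "loc_bounded_measurable k" "loc_bounded_measurable l"
  shows "loc_bounded_measurable (\<lambda>t. k t * l t)"
proof (rule loc_bounded_measurableI)
  show "(\<lambda>t. k t * l t) \<in> borel_measurable lebesgue"
    using assms by (auto simp: loc_bounded_measurable_def)
  fix a b
  obtain A B where "A > 0" "\<And>t. t \<in> {a..b} \<Longrightarrow> \<bar>k t\<bar> \<le> A" "B > 0" "\<And>t. t \<in> {a..b} \<Longrightarrow> \<bar>l t\<bar> \<le> B"
    using loc_bounded_measurableE[OF assms(1)] loc_bounded_measurableE[OF assms(2)] by metis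
  then show "\<exists>B. \<forall>t\<in>{a..b}. \<bar>k t * l t\<bar> \<le> B"
    by (intro exI[of _ "A * B"]) (auto simp: abs_mult intro!: mult_mono)
qed

lemma loc_bounded_measurable_divide:
  assumes "loc_bounded_measurable k"
  shows "loc_bounded_measurable (\<lambda>t. k t / c)"
  using loc_bounded_measurable_mult[OF assms loc_bounded_measurable_const[of "1 / c"]] by simp

lemma loc_bounded_measurable_absolutely_integrable:
  assumes "loc_bounded_measurable k"
  shows "k absolutely_integrable_on {a..b}"
proof -
  obtain B where "\<And>t. t \<in> {a..b} \<Longrightarrow> \<bar>k t\<bar> \<le> B" using loc_bounded_measurableE[OF assms] by metis
  moreover have "k \<in> borel_measurable (lebesgue_on {a..b})"
    using assms by (auto simp: loc_bounded_measurable_def intro: measurable_restrict_space1)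
  ultimately show ?thesis
    by (intro measurable_bounded_by_integrable_imp_absolutely_integrable[of _ _ "\<lambda>_. B"]) auto
qed

lemma loc_bounded_measurable_integrable_on:
  "loc_bounded_measurable k \<Longrightarrow> k integrable_on {a..b}"
  using loc_bounded_measurable_absolutely_integrable set_lebesgue_integral_eq_integral(1) by blast

text \<open>This is literally the integral occurring in \<open>angle_representation\<close> and in
  the formulas for \<open>z\<close>, \<open>v\<close>, \<open>w\<close>. For negative
  \<open>t\<close> it is oriented, which makes it a primitive on the whole line.\<close>

definition primitive :: "(real \<Rightarrow> real) \<Rightarrow> real \<Rightarrow> real" where
  "primitive k t = (LINT \<tau>=0..ereal t|lebesgue. k \<tau>)"

text \<open>Completeness of the Lebesgue measure transfers measurability from \<open>k\<close> to
  \<open>l\<close>. This is what makes the unspecified values of \<open>deriv\<close>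
  harmless.\<close>

lemma primitive_cong_AE:
  assumes "k \<in> borel_measurable lebesgue" "AE \<tau> in lebesgue. k \<tau> = l \<tau>"
  shows "primitive k = primitive l"
proof -
  have l: "l \<in> borel_measurable lebesgue" by (rule borel_measurable_AE[OF assms])
  have "set_lebesgue_integral lebesgue (einterval a b) k = set_lebesgue_integral lebesgue (einterval a b) l" for a b
    unfolding set_lebesgue_integral_def
    using assms l
    by (intro integral_cong_AE borel_measurable_scaleR borel_measurable_indicator) auto
  then show ?thesis by (simp add: primitive_def interval_lebesgue_integral_def fun_eq_iff)
qed

lemma primitive_0: "primitive k 0 = 0"
  by (simp add: primitive_def interval_lebesgue_integral_def set_lebesgue_integral_def zero_ereal_def)

text \<open>Passes to the gauge integral, for which the fundamental theorem above is stated; open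
  and closed intervals give the same value.\<close>

lemma primitive_eq_integral:
  assumes "loc_bounded_measurable k"
  shows "primitive k t = (if 0 \<le> t then integral {0..t} k else - integral {t..0} k)"
proof -
  have *: "set_lebesgue_integral lebesgue {a<..<b} k = integral {a..b} k" for a b
  proof -
    have "set_integrable lebesgue {a<..<b} k"
      by (rule set_integrable_subset[OF loc_bounded_measurable_absolutely_integrable[OF assms, of a b]]) auto
    then show ?thesis
      using set_lebesgue_integral_eq_integral(2) integral_open_interval_real by metis
  qed
  show ?thesis
    by (simp add: primitive_def zero_ereal_def interval_lebesgue_integral_def *)
qed

lemma primitive_diff:
  assumes k: "loc_bounded_measurable k" and "a \<le> b"
  shows "primitive k b - primitive k a = integral {a..b} k"
proof -
  note int = loc_bounded_measurable_integrable_on[OF k]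
  consider "0 \<le> a" | "a < 0" "0 \<le> b" | "b < 0" by linarith
  then show ?thesis
  proof cases
    case 1
    then show ?thesis using assms Henstock_Kurzweil_Integration.integral_combine[OF 1 \<open>a \<le> b\<close> int]
      by (simp add: primitive_eq_integral)
  next
    case 2
    then show ?thesis using assms Henstock_Kurzweil_Integration.integral_combine[of a 0 b, OF _ _ int]
      by (simp add: primitive_eq_integral)
  next
    case 3
    then show ?thesis using assms Henstock_Kurzweil_Integration.integral_combine[of a b 0, OF _ _ int]
      by (simp add: primitive_eq_integral)
  qed
qed

lemma AE_lebesgue_negligibleE:
  assumes "AE t in lebesgue. P t"
  obtains N where "negligible N" "\<forall>t. t \<notin> N \<longrightarrow> P t"
  using assms by (auto simp: completion.AE_iff_null_sets negligible_iff_null_sets)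

lemma AE_lebesgue_negligibleI:
  assumes "negligible N" "\<And>t. t \<notin> N \<Longrightarrow> P t"
  shows "AE t in lebesgue. P t"
  by (rule AE_I'[of N]) (use assms in \<open>auto simp: negligible_iff_null_sets\<close>)

lemma abs_continuous_integral:
  assumes f: "abs_continuous f" and deriv: "AE t in lebesgue. (f has_real_derivative k t) (at t)" and "a \<le> b"
  shows "(k has_integral f b - f a) {a..b}"
proof -
  obtain N where "negligible N" "\<forall>t. t \<notin> N \<longrightarrow> (f has_real_derivative k t) (at t)"
    by (rule AE_lebesgue_negligibleE[OF deriv])
  then show ?thesis
    using assms by (intro abs_continuous_on_has_integral) (auto simp: abs_continuous_def)
qed

lemma abs_continuous_primitive:
  assumes f: "abs_continuous f" and deriv: "AE t in lebesgue. (f has_real_derivative k t) (at t)"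
    and k: "loc_bounded_measurable k"
  shows "f t = f 0 + primitive k t"
  using abs_continuous_integral[OF f deriv, of 0 t] abs_continuous_integral[OF f deriv, of t 0]
  by (auto simp: primitive_eq_integral[OF k] dest!: integral_unique)

lemma abs_continuous_deriv_zero:
  assumes "abs_continuous f" "AE t in lebesgue. (f has_real_derivative 0) (at t)"
  shows "f t = f 0"
proof -
  have "f t = f 0 + primitive (\<lambda>_. 0) t"
    by (rule abs_continuous_primitive[OF assms loc_bounded_measurable_const])
  then show ?thesis by (simp add: primitive_eq_integral[OF loc_bounded_measurable_const])
qed

lemma primitive_abs_continuous:
  assumes k: "loc_bounded_measurable k"
  shows "abs_continuous (primitive k)"
proof (rule abs_continuous_lipschitz)
  fix a b :: real
  obtain B where B: "B > 0" "\<And>t. t \<in> {a..b} \<Longrightarrow> \<bar>k t\<bar> \<le> B" using loc_bounded_measurableE[OF k] by metis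
  have *: "\<bar>primitive k v - primitive k u\<bar> \<le> B * (v - u)" if "u \<in> {a..b}" "v \<in> {a..b}" "u \<le> v" for u v
  proof -
    have "norm (integral {u..v} k) \<le> B * measure lborel {u..v}"
      by (rule has_integral_bound_real[of B "{}" k]) (use that B integrable_integral[OF loc_bounded_measurable_integrable_on[OF k]] in auto)
    then have "norm (integral {u..v} k) \<le> B * (v - u)" using that by simp
    then show ?thesis using primitive_diff[OF k that(3)] by simp
  qed
  show "\<exists>M. \<forall>u\<in>{a..b}. \<forall>v\<in>{a..b}. norm (primitive k v - primitive k u) \<le> M * \<bar>v - u\<bar>"
  proof (intro exI[of _ B] ballI)
    fix u v assume "u \<in> {a..b}" "v \<in> {a..b}"
    then show "norm (primitive k v - primitive k u) \<le> B * \<bar>v - u\<bar>"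
      using *[of u v] *[of v u] by (cases "u \<le> v") (auto simp: abs_minus_commute)
  qed
qed

section \<open>Lebesgue differentiation of primitives\<close>

text \<open>Henstock's lemma combined with a Vitali covering. The bad intervals that fit into the
  Henstock gauge cover the exceptional set finely, so disjoint ones among them cover it up to a null
  set. Finitely many of them form a fine tagged partial division; \<open>e\<close> times their total
  length is at most the Henstock error, which is below \<open>e * \<eta>\<close>.\<close>

lemma negligible_non_Lebesgue_points:
  fixes k :: "real \<Rightarrow> real"
  assumes int: "k integrable_on {a..b}" and e: "e > 0"
  shows "negligible {x \<in> {a<..<b}. \<forall>d>0. \<exists>u v. u \<le> x \<and> x \<le> v \<and> u < v \<and> x - d < u \<and> v < x + d \<and>
            e * (v - u) < \<bar>(v - u) * k x - integral {u..v} k\<bar>}" (is "negligible ?E")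
  unfolding negligible_outer_le
proof (intro allI impI)
  fix \<eta> :: real assume \<eta>: "\<eta> > 0"
  have i1: "k integrable_on cbox a b" and i2: "e * \<eta> > 0" using int e \<eta> by simp_all
  have "\<exists>\<gamma>. gauge \<gamma> \<and> (\<forall>p. p tagged_partial_division_of (cbox a b) \<longrightarrow> \<gamma> fine p \<longrightarrow>
             (\<Sum>(x,K)\<in>p. norm (measure lborel K *\<^sub>R k x - integral K k)) < e * \<eta>)"
    by (rule Henstock_lemma[OF i1 i2]) (intro exI conjI allI impI, assumption,
      drule meta_spec, drule (1) meta_mp, drule (1) meta_mp, assumption)
  then obtain \<gamma> where \<gamma>: "gauge \<gamma>"
    and H: "\<forall>p. p tagged_partial_division_of (cbox a b) \<longrightarrow> \<gamma> fine p \<longrightarrow>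
             (\<Sum>(x,K)\<in>p. norm (measure lborel K *\<^sub>R k x - integral K k)) < e * \<eta>"
    by (elim exE conjE)
  define I where "I = {(x, u, v). a < x \<and> x < b \<and> u \<le> x \<and> x \<le> v \<and> u < v \<and> {u..v} \<subseteq> \<gamma> x \<inter> {a<..<b} \<and>
            e * (v - u) < \<bar>(v - u) * k x - integral {u..v} k\<bar>}"
  \<comment> \<open>Vitali's theorem wants balls, whereas the tag \<open>x\<close> need not be the
    midpoint of \<open>{u..v}\<close>. The index therefore remembers the tag together with the
    interval, and centre and radius are read off from the endpoints.\<close>
  define c where "c = (\<lambda>(x::real, u::real, v::real). (u + v) / 2)"
  define r where "r = (\<lambda>(x::real, u::real, v::real). (v - u) / 2)"
  have cball: "cball (c (x, u, v)) (r (x, u, v)) = {u..v}" for x u v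
    by (auto simp: c_def r_def cball_eq_atLeastAtMost field_simps)
  have r: "0 < r i" if "i \<in> I" for i using that by (auto simp: I_def r_def)
  have cover: "\<exists>i. i \<in> I \<and> x \<in> cball (c i) (r i) \<and> r i < d" if x: "x \<in> ?E" and d: "d > 0" for x d
  proof -
    have "open (\<gamma> x \<inter> {a<..<b})" "x \<in> \<gamma> x \<inter> {a<..<b}" using \<gamma> x by (auto simp: gauge_def)
    then obtain d' where d': "d' > 0" "ball x d' \<subseteq> \<gamma> x \<inter> {a<..<b}" by (meson openE)
    have "min d d' > 0" using d d' by simp
    moreover have "\<forall>d>0. \<exists>u v. u \<le> x \<and> x \<le> v \<and> u < v \<and> x - d < u \<and> v < x + d \<and>
            e * (v - u) < \<bar>(v - u) * k x - integral {u..v} k\<bar>" using x by simp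
    ultimately obtain u v where uv: "u \<le> x" "x \<le> v" "u < v" "x - min d d' < u" "v < x + min d d'"
            "e * (v - u) < \<bar>(v - u) * k x - integral {u..v} k\<bar>" by metis
    have "{u..v} \<subseteq> ball x d'" using uv by (auto simp: dist_real_def)
    then have "(x, u, v) \<in> I" using uv d' x by (auto simp: I_def)
    moreover have "x \<in> cball (c (x, u, v)) (r (x, u, v))" unfolding cball using uv by simp
    moreover have "r (x, u, v) < d" using uv by (auto simp: r_def)
    ultimately show ?thesis by blast
  qed
  obtain C where C: "countable C" "C \<subseteq> I" "pairwise (\<lambda>i j. disjnt (cball (c i) (r i)) (cball (c j) (r j))) C"
     "negligible (?E - (\<Union>i\<in>C. cball (c i) (r i)))"
    by (rule Vitali_covering_theorem_cballs[of I r ?E c, OF r cover]) auto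
  define B where "B = (\<lambda>i. cball (c i) (r i))"
  have fin: "measure lebesgue (\<Union>(B ` C')) \<le> \<eta>" if C': "finite C'" "C' \<subseteq> C" for C'
  proof -
    have B: "B (x, u, v) = {u..v}" for x u v by (simp add: B_def cball)
    define g where "g = (\<lambda>i::real \<times> real \<times> real. (fst i, B i))"
    have disj: "B i \<inter> B j = {}" if "i \<in> C'" "j \<in> C'" "i \<noteq> j" for i j
      using C(3) that C' by (auto simp: pairwise_def disjnt_def B_def)
    have mem: "fst i \<in> B i \<and> B i \<subseteq> {a..b} \<and> B i \<subseteq> \<gamma> (fst i) \<and>
        e * measure lborel (B i) \<le> norm (measure lborel (B i) *\<^sub>R k (fst i) - integral (B i) k) \<and>
        (\<exists>u v. B i = cbox u v)" if "i \<in> C'" for i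
    proof -
      obtain x u v where i: "i = (x, u, v)" by (cases i)
      have iI: "(x, u, v) \<in> I" using that C' C(2) i by auto
      have "{u..v} \<subseteq> \<gamma> x \<inter> {a<..<b}" using iI by (auto simp: I_def)
      then have "{u..v} \<subseteq> {a..b}" "{u..v} \<subseteq> \<gamma> x" by (auto simp: greaterThanLessThan_def)
      moreover have "\<exists>u' v'. {u..v} = cbox u' v'" by (metis box_real(2))
      ultimately show ?thesis using iI by (simp add: i B I_def)
    qed
    \<comment> \<open>Two indices with the same image would share a tag, but the intervals of
      distinct indices are disjoint.\<close>
    have inj: "inj_on g C'"
    proof (rule inj_onI)
      fix i j assume ij: "i \<in> C'" "j \<in> C'" "g i = g j"
      show "i = j"
      proof (rule ccontr)
        assume "i \<noteq> j"
        then show False using disj[OF ij(1,2)] ij mem[OF ij(1)] by (auto simp: g_def)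
      qed
    qed
    have part: "g ` C' tagged_partial_division_of cbox a b"
      unfolding tagged_partial_division_of_def
    proof (intro conjI allI impI)
      show "finite (g ` C')" using C' by simp
    next
      fix x K assume "(x, K) \<in> g ` C'"
      then obtain i where i: "i \<in> C'" "x = fst i" "K = B i" by (auto simp: g_def)
      show "x \<in> K" "K \<subseteq> cbox a b" "\<exists>u v. K = cbox u v"
        using mem[OF i(1)] i by auto
    next
      fix x K y L assume *: "(x, K) \<in> g ` C' \<and> (y, L) \<in> g ` C' \<and> (x, K) \<noteq> (y, L)"
      then obtain i j where "i \<in> C'" "(x, K) = g i" "j \<in> C'" "(y, L) = g j" by blast
      then have ij: "i \<in> C'" "x = fst i" "K = B i" "j \<in> C'" "y = fst j" "L = B j"
        by (auto simp: g_def)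
      then have "i \<noteq> j" using * by auto
      then have "K \<inter> L = {}" using disj ij by auto
      then show "interior K \<inter> interior L = {}" using interior_subset by blast
    qed
    have fine: "\<gamma> fine g ` C'"
      unfolding fine_def using mem by (auto simp: g_def)
    have "measure lebesgue (\<Union>(B ` C')) \<le> (\<Sum>i\<in>C'. measure lebesgue (B i))"
      using C' by (intro measure_UNION_le) (auto simp: B_def)
    also have "e * \<dots> = (\<Sum>i\<in>C'. e * measure lborel (B i))"
      by (simp add: sum_distrib_left B_def)
    also have "\<dots> \<le> (\<Sum>i\<in>C'. norm (measure lborel (B i) *\<^sub>R k (fst i) - integral (B i) k))"
      using mem by (intro sum_mono) auto
    also have "\<dots> = (\<Sum>(x,K)\<in>g ` C'. norm (measure lborel K *\<^sub>R k x - integral K k))"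
      unfolding sum.reindex[OF inj] by (simp add: g_def)
    also have "\<dots> < e * \<eta>" by (rule H[rule_format, OF part fine])
    finally show ?thesis using e by simp
  qed
  have Cm: "\<Union>(B ` C) \<in> lmeasurable" "measure lebesgue (\<Union>(B ` C)) \<le> \<eta>"
  proof -
    have 1: "countable (B ` C)" using C by simp
    have 2: "D \<in> lmeasurable" if "D \<in> B ` C" for D using that by (auto simp: B_def)
    have 3: "measure lebesgue (\<Union>\<E>) \<le> \<eta>" if E: "\<E> \<subseteq> B ` C" "finite \<E>" for \<E>
    proof -
      obtain C' where "C' \<subseteq> C" "finite C'" "\<E> = B ` C'" using finite_subset_image[OF E(2,1)] by auto
      then show ?thesis using fin by auto
    qed
    show "\<Union>(B ` C) \<in> lmeasurable" by (rule fmeasurable_Union_bound[OF 1 2 3])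
    show "measure lebesgue (\<Union>(B ` C)) \<le> \<eta>" by (rule measure_Union_bound[OF 1 2 3])
  qed
  let ?N = "?E - \<Union>(B ` C)"
  have N: "negligible ?N" using C(4) by (simp add: B_def)
  show "\<exists>T. ?E \<subseteq> T \<and> T \<in> lmeasurable \<and> measure lebesgue T \<le> \<eta>"
  proof (intro exI conjI)
    show "?E \<subseteq> \<Union>(B ` C) \<union> ?N" by blast
    show "\<Union>(B ` C) \<union> ?N \<in> lmeasurable" using Cm N negligible_imp_measurable by blast
    have "measure lebesgue (\<Union>(B ` C) \<union> ?N) \<le> measure lebesgue (\<Union>(B ` C)) + measure lebesgue ?N"
      by (rule measure_Un_le) (use Cm N negligible_imp_sets in auto)
    then show "measure lebesgue (\<Union>(B ` C) \<union> ?N) \<le> \<eta>" using Cm N negligible_imp_measure0 by fastforce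
  qed
qed

text \<open>The exceptional points are collected over countably many windows \<open>n\<close> and
  tolerances \<open>1 / Suc j\<close>. Intervals having the point as an endpoint are among the
  intervals of \<open>E\<close>, and they give the difference quotients from both sides.\<close>

theorem primitive_has_derivative_AE:
  assumes k: "loc_bounded_measurable k"
  shows "AE t in lebesgue. (primitive k has_real_derivative k t) (at t)"
proof -
  define E where "E n j = {x \<in> {- real n<..<real n}. \<forall>d>0. \<exists>u v. u \<le> x \<and> x \<le> v \<and> u < v \<and> x - d < u \<and> v < x + d \<and>
            (1 / real (Suc j)) * (v - u) < \<bar>(v - u) * k x - integral {u..v} k\<bar>}" for n j :: nat
  have "negligible (E n j)" for n j
    unfolding E_def
    by (rule negligible_non_Lebesgue_points[OF loc_bounded_measurable_integrable_on[OF k]]) simp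
  then have "negligible (\<Union>n. \<Union>j. E n j)"
    by (intro negligible_countable_Union) (auto intro!: negligible_countable_Union)
  then show ?thesis
  proof (rule AE_lebesgue_negligibleI)
    fix t assume t: "t \<notin> (\<Union>n. \<Union>j. E n j)"
    obtain n where n: "\<bar>t\<bar> < real n" using reals_Archimedean2 by blast
    show "(primitive k has_real_derivative k t) (at t)"
      unfolding has_field_derivative_def has_derivative_at_alt
    proof (intro conjI allI impI)
      show "bounded_linear ((*) (k t))" by (rule bounded_linear_mult_right)
      fix e :: real assume "e > 0"
      then obtain j where j: "1 / real (Suc j) < e" using nat_approx_posE by metis
      have "t \<notin> E n j" using t by auto
      moreover have "t \<in> {- real n<..<real n}" using n by auto
      ultimately have "\<not> (\<forall>d>0. \<exists>u v. u \<le> t \<and> t \<le> v \<and> u < v \<and> t - d < u \<and> v < t + d \<and>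
            (1 / real (Suc j)) * (v - u) < \<bar>(v - u) * k t - integral {u..v} k\<bar>)"
        unfolding E_def by simp
      then obtain d where d: "d > 0" "\<not> (\<exists>u v. u \<le> t \<and> t \<le> v \<and> u < v \<and> t - d < u \<and> v < t + d \<and>
            (1 / real (Suc j)) * (v - u) < \<bar>(v - u) * k t - integral {u..v} k\<bar>)"
        by metis
      have d2: "\<bar>(v - u) * k t - integral {u..v} k\<bar> \<le> (1 / real (Suc j)) * (v - u)"
        if "u \<le> t" "t \<le> v" "u < v" "t - d < u" "v < t + d" for u v
        using d(2) that by (meson not_le)
      show "\<exists>d>0. \<forall>y. norm (y - t) < d \<longrightarrow> norm (primitive k y - primitive k t - k t * (y - t)) \<le> e * norm (y - t)"
      proof (intro exI[of _ d] conjI allI impI)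
        fix y assume y: "norm (y - t) < d"
        have less: "(1 / real (Suc j)) * s \<le> e * s" if "s \<ge> 0" for s
          using j that by (intro mult_right_mono) auto
        consider "y = t" | "t < y" | "y < t" by linarith
        then show "norm (primitive k y - primitive k t - k t * (y - t)) \<le> e * norm (y - t)"
        proof cases
          case 2
          then show ?thesis using d2[of t y] y primitive_diff[OF k, of t y] less[of "y - t"]
            by (simp add: algebra_simps abs_minus_commute)
        next
          case 3
          then show ?thesis using d2[of y t] y primitive_diff[OF k, of y t] less[of "t - y"]
            by (simp add: algebra_simps abs_minus_commute)
        qed simp
      qed (rule d)
    qed
  qed
qed

section \<open>Support function and polar radius of the unit ball\<close>

locale quasinormed_plane =
  fixes F :: "real \<times> real \<Rightarrow> real"
  assumes quasinorm: "quasinorm F"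
begin

abbreviation "U \<equiv> unit_ball F"
abbreviation "H \<equiv> support_fun U"
abbreviation "r \<equiv> polar_radius U"

lemma F_nonneg: "0 \<le> F u" and F_eq_0: "F u = 0 \<longleftrightarrow> u = 0"
  and F_scale: "0 \<le> c \<Longrightarrow> F (c *\<^sub>R u) = c * F u" and F_add: "F (u + u') \<le> F u + F u'"
  using quasinorm unfolding quasinorm_def by blast+

lemma F_upper: obtains C where "C > 0" "\<And>u. F u \<le> C * norm u"
proof -
  \<comment> \<open>Without symmetry \<open>F\<close> may take different values at opposite vectors,
    so all four signed unit vectors enter.\<close>
  define C where "C = F (1, 0) + F (-1, 0) + F (0, 1) + F (0, -1)"
  have nn: "0 \<le> F (1, 0)" "0 \<le> F (-1, 0)" "0 \<le> F (0, 1)" "0 \<le> F (0, -1)" by (simp_all add: F_nonneg)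
  have 1: "F (a, 0) \<le> (F (1, 0) + F (-1, 0)) * \<bar>a\<bar>" for a
    using F_scale[of a "(1, 0)"] F_scale[of "- a" "(-1, 0)"] nn by (cases "a \<ge> 0") (auto simp: algebra_simps mult_nonpos_nonneg)
  have 2: "F (0, b) \<le> (F (0, 1) + F (0, -1)) * \<bar>b\<bar>" for b
    using F_scale[of b "(0, 1)"] F_scale[of "- b" "(0, -1)"] nn by (cases "b \<ge> 0") (auto simp: algebra_simps mult_nonpos_nonneg)
  have "F (a, b) \<le> C * norm (a, b)" for a b
  proof -
    have "F (a, b) \<le> F (a, 0) + F (0, b)" using F_add[of "(a, 0)" "(0, b)"] by simp
    also have "\<dots> \<le> (F (1, 0) + F (-1, 0)) * \<bar>a\<bar> + (F (0, 1) + F (0, -1)) * \<bar>b\<bar>" using 1 2 by (intro add_mono)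
    also have "\<dots> \<le> (F (1, 0) + F (-1, 0)) * norm (a, b) + (F (0, 1) + F (0, -1)) * norm (a, b)"
      using nn norm_fst_le[of a b] norm_snd_le[of b a] by (intro add_mono mult_left_mono) auto
    finally show ?thesis by (simp add: C_def algebra_simps)
  qed
  moreover have "C > 0" using nn F_eq_0[of "(1, 0)"] by (simp add: C_def zero_prod_def less_le)
  ultimately show thesis using that by (metis prod.collapse)
qed

lemma F_continuous: "continuous_on S F"
proof -
  obtain C where C: "C > 0" "\<And>u. F u \<le> C * norm u" by (rule F_upper) blast
  have "\<bar>F u - F v\<bar> \<le> C * norm (u - v)" for u v
    using F_add[of "u - v" v] F_add[of "v - u" u] C(2)[of "u - v"] C(2)[of "v - u"]
    by (simp add: norm_minus_commute abs_le_iff)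
  then have "C-lipschitz_on S F"
    using C(1) by (intro lipschitz_onI) (auto simp: dist_norm)
  then show ?thesis by (rule lipschitz_on_continuous_on)
qed

lemma F_lower: obtains c where "c > 0" "\<And>u. c * norm u \<le> F u"
proof -
  have "\<exists>u\<in>sphere 0 1. \<forall>v\<in>sphere 0 1. F u \<le> F (v::real \<times> real)"
    by (rule continuous_attains_inf) (auto intro: F_continuous simp: sphere_eq_empty)
  then obtain u where u: "norm u = 1" "\<And>v. norm v = 1 \<Longrightarrow> F u \<le> F v" by auto
  have "F u * norm v \<le> F v" for v
  proof (cases "v = 0")
    case False
    then have "F u \<le> F ((1 / norm v) *\<^sub>R v)" by (intro u) simp
    also have "\<dots> = F v / norm v" by (subst F_scale) auto
    finally show ?thesis using False by (simp add: field_simps)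
  qed (simp add: F_nonneg)
  moreover have "F u > 0" using u F_eq_0[of u] F_nonneg[of u] by (auto simp: less_le)
  ultimately show thesis using that by blast
qed

lemma U_bounded: obtains R where "R > 0" "\<And>u. u \<in> U \<Longrightarrow> norm u \<le> R"
proof -
  obtain c where c: "c > 0" "\<And>u. c * norm u \<le> F u" by (rule F_lower) blast
  show thesis
  proof (rule that[of "1 / c"])
    fix u assume "u \<in> U"
    then have "c * norm u \<le> 1" using c(2)[of u] by (simp add: unit_ball_def)
    then show "norm u \<le> 1 / c" using c by (simp add: field_simps)
  qed (use c in simp)
qed

lemma U_contains_ball: obtains m where "m > 0" "\<And>u. norm u \<le> m \<Longrightarrow> u \<in> U"
proof -
  obtain C where C: "C > 0" "\<And>u. F u \<le> C * norm u" by (rule F_upper) blast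
  show thesis
  proof (rule that[of "1 / C"])
    fix u :: "real \<times> real" assume "norm u \<le> 1 / C"
    then have "C * norm u \<le> 1" using C by (simp add: field_simps)
    then show "u \<in> U" using C(2)[of u] by (simp add: unit_ball_def)
  qed (use C in simp)
qed

lemma convex_U: "convex U"
proof (rule convexI)
  fix x y :: "real \<times> real" and a b :: real
  assume *: "x \<in> U" "y \<in> U" "0 \<le> a" "0 \<le> b" "a + b = 1"
  have "F (a *\<^sub>R x + b *\<^sub>R y) \<le> a * F x + b * F y"
    using F_add[of "a *\<^sub>R x" "b *\<^sub>R y"] * by (simp add: F_scale)
  also have "\<dots> \<le> a * 1 + b * 1" using * by (intro add_mono mult_left_mono) (auto simp: unit_ball_def)
  finally show "a *\<^sub>R x + b *\<^sub>R y \<in> U" using * by (simp add: unit_ball_def)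
qed

lemma closed_U: "closed U"
  unfolding unit_ball_def by (rule closed_Collect_le) (auto intro: F_continuous)

lemma zero_in_U: "0 \<in> U"
  by (simp add: unit_ball_def F_eq_0[THEN iffD2])

lemma H_bdd: "bdd_above ((\<bullet>) h ` U)"
proof -
  obtain R where R: "R > 0" "\<And>u. u \<in> U \<Longrightarrow> norm u \<le> R" by (rule U_bounded) blast
  have "h \<bullet> u \<le> norm h * R" if "u \<in> U" for u
    using R(2)[OF that] by (meson mult_left_mono norm_cauchy_schwarz norm_ge_zero order_trans)
  then show ?thesis unfolding bdd_above_def by (intro exI[of _ "norm h * R"]) blast
qed

lemma inner_le_H: "u \<in> U \<Longrightarrow> h \<bullet> u \<le> H h"
  unfolding support_fun_def using H_bdd by (intro cSUP_upper) auto

lemma H_le: "(\<And>u. u \<in> U \<Longrightarrow> h \<bullet> u \<le> b) \<Longrightarrow> H h \<le> b"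
  unfolding support_fun_def using zero_in_U by (intro cSUP_least) auto

lemma H_add: "H (h + h') \<le> H h + H h'"
  by (rule H_le) (simp add: inner_add_left add_mono inner_le_H)

lemma H_upper: obtains R where "R > 0" "\<And>h. H h \<le> R * norm h"
proof -
  obtain R where R: "R > 0" "\<And>u. u \<in> U \<Longrightarrow> norm u \<le> R" by (rule U_bounded) blast
  show thesis
  proof (rule that[OF R(1)])
    show "H h \<le> R * norm h" for h
    proof (rule H_le)
      fix u assume u: "u \<in> U"
      have "h \<bullet> u \<le> norm h * norm u" by (rule norm_cauchy_schwarz)
      also have "\<dots> \<le> norm h * R" using R(2)[OF u] by (intro mult_left_mono) auto
      finally show "h \<bullet> u \<le> R * norm h" by (simp add: mult.commute)
    qed
  qed
qed

lemma H_lower: obtains m where "m > 0" "\<And>h. m * norm h \<le> H h"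
proof -
  obtain m where m: "m > 0" "\<And>u. norm u \<le> m \<Longrightarrow> u \<in> U" by (rule U_contains_ball) blast
  show thesis
  proof (rule that[OF m(1)])
    fix h :: "real \<times> real"
    have "norm ((m / norm h) *\<^sub>R h) \<le> m" using m by simp
    then have "h \<bullet> ((m / norm h) *\<^sub>R h) \<le> H h" by (intro inner_le_H m)
    then show "m * norm h \<le> H h"
      using inner_le_H[OF zero_in_U, of h] by (cases "h = 0") (simp_all add: dot_square_norm power2_eq_square)
  qed
qed

lemma H_scale: assumes "0 \<le> c" shows "H (c *\<^sub>R h) = c * H h"
proof -
  have le: "H (c *\<^sub>R h) \<le> c * H h" if "0 \<le> c" for c h
    using that by (intro H_le) (auto intro!: mult_left_mono inner_le_H)
  show ?thesis
  proof (cases "c = 0")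
    case True
    have "0 \<le> H (0 *\<^sub>R h)" using inner_le_H[OF zero_in_U, of "0 *\<^sub>R h"] by simp
    with le[of 0 h] True show ?thesis by simp
  next
    case False
    then have c: "c > 0" using assms by simp
    have "H h = H ((1 / c) *\<^sub>R (c *\<^sub>R h))" using c by simp
    also have "\<dots> \<le> (1 / c) * H (c *\<^sub>R h)" using c by (intro le) simp
    finally have "c * H h \<le> H (c *\<^sub>R h)" using c by (simp add: field_simps)
    with le[of c h] c show ?thesis by simp
  qed
qed

lemma H_lipschitz: obtains R where "R > 0" "\<And>h h'. \<bar>H h - H h'\<bar> \<le> R * norm (h - h')"
proof -
  obtain R where R: "R > 0" "\<And>h. H h \<le> R * norm h" by (rule H_upper) blast
  have "\<bar>H h - H h'\<bar> \<le> R * norm (h - h')" for h h'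
    using H_add[of "h - h'" h'] H_add[of "h' - h" h] R(2)[of "h - h'"] R(2)[of "h' - h"]
    by (simp add: norm_minus_commute abs_le_iff)
  with R that show thesis by blast
qed

lemma H_continuous: "continuous_on S H"
proof -
  obtain R where R: "R > 0" "\<And>h h'. \<bar>H h - H h'\<bar> \<le> R * norm (h - h')" by (rule H_lipschitz) blast
  then have "R-lipschitz_on S H" by (intro lipschitz_onI) (auto simp: dist_norm)
  then show ?thesis by (rule lipschitz_on_continuous_on)
qed

lemma H_pos: "h \<noteq> 0 \<Longrightarrow> 0 < H h"
  using H_lower by (metis less_le_trans mult_pos_pos zero_less_norm_iff)

text \<open>A closed convex set is the intersection of its supporting half-planes: a point outside
  is separated by a line, which contradicts the bound for the corresponding functional. Membership
  of a constructed control is proved through this criterion.\<close>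

lemma in_U_iff: "u \<in> U \<longleftrightarrow> (\<forall>h. h \<bullet> u \<le> H h)"
proof
  assume le: "\<forall>h. h \<bullet> u \<le> H h"
  show "u \<in> U"
  proof (rule ccontr)
    assume "u \<notin> U"
    then obtain a b where ab: "a \<bullet> u < b" "\<And>x. x \<in> U \<Longrightarrow> b < a \<bullet> x"
      using separating_hyperplane_closed_point[OF convex_U closed_U] by blast
    have "H (- a) \<le> - b" by (rule H_le) (use ab in \<open>auto intro: less_imp_le\<close>)
    moreover have "- a \<bullet> u \<le> H (- a)" using le by blast
    ultimately show False using ab by simp
  qed
qed (simp add: inner_le_H)

section \<open>One-sided directional derivatives of the support function\<close>

definition diff_quot :: "real \<times> real \<Rightarrow> real \<times> real \<Rightarrow> real \<Rightarrow> real" where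
  "diff_quot p d s = (H (p + s *\<^sub>R d) - H p) / s"

text \<open>Difference quotients of a convex function increase with the step, so this infimum is the
  one-sided directional derivative. In this form its existence needs only a lower bound.\<close>

definition dirderiv :: "real \<times> real \<Rightarrow> real \<times> real \<Rightarrow> real" where
  "dirderiv p d = Inf (diff_quot p d ` {0<..})"

lemma diff_quot_mono:
  assumes "0 < s" "s \<le> t"
  shows "diff_quot p d s \<le> diff_quot p d t"
proof -
  \<comment> \<open>The point lies on the segment from \<open>p\<close> to \<open>p + t d\<close>,
    where sublinearity of \<open>H\<close> acts as convexity.\<close>
  have "p + s *\<^sub>R d = (s / t) *\<^sub>R (p + t *\<^sub>R d) + (1 - s / t) *\<^sub>R p"
    using assms by (simp add: algebra_simps)
  then have "H (p + s *\<^sub>R d) \<le> (s / t) * H (p + t *\<^sub>R d) + (1 - s / t) * H p"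
    using H_add[of "(s / t) *\<^sub>R (p + t *\<^sub>R d)" "(1 - s / t) *\<^sub>R p"] assms by (simp add: H_scale)
  then show ?thesis using assms by (simp add: diff_quot_def field_simps)
qed

lemma diff_quot_bdd_below: "bdd_below (diff_quot p d ` {0<..})"
proof -
  obtain R where R: "R > 0" "\<And>h h'. \<bar>H h - H h'\<bar> \<le> R * norm (h - h')" by (rule H_lipschitz) blast
  have "- (R * norm d) \<le> diff_quot p d s" if "s > 0" for s
    using R(2)[of "p + s *\<^sub>R d" p] that by (simp add: diff_quot_def field_simps abs_le_iff)
  then show ?thesis by (auto simp: bdd_below_def)
qed

lemma dirderiv_le_diff_quot: "s > 0 \<Longrightarrow> dirderiv p d \<le> diff_quot p d s"
  unfolding dirderiv_def by (intro cINF_lower diff_quot_bdd_below) auto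

lemma dirderiv_geI: "(\<And>s. s > 0 \<Longrightarrow> b \<le> diff_quot p d s) \<Longrightarrow> b \<le> dirderiv p d"
  unfolding dirderiv_def by (intro cINF_greatest) auto

lemma H_ge_dirderiv: "s \<ge> 0 \<Longrightarrow> H p + s * dirderiv p d \<le> H (p + s *\<^sub>R d)"
  using dirderiv_le_diff_quot[of s p d] by (cases "s = 0") (auto simp: diff_quot_def field_simps)

lemma diff_quot_tendsto: "(diff_quot p d \<longlongrightarrow> dirderiv p d) (at_right 0)"
proof (rule order_tendstoI)
  fix b assume "b < dirderiv p d"
  then show "\<forall>\<^sub>F s in at_right 0. b < diff_quot p d s"
    using dirderiv_le_diff_quot[of _ p d] by (auto simp: eventually_at_right_field intro!: exI[of _ 1] intro: less_le_trans)
next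
  fix b assume b: "dirderiv p d < b"
  have "\<exists>s>0. diff_quot p d s < b"
    using b cINF_less_iff[OF _ diff_quot_bdd_below, of p d b] unfolding dirderiv_def by auto
  then obtain s where "s > 0" "diff_quot p d s < b" by blast
  then show "\<forall>\<^sub>F s in at_right 0. diff_quot p d s < b"
    using diff_quot_mono[of _ s p d] le_less_trans
    unfolding eventually_at_right_field by (intro exI[of _ s]) (fastforce intro: less_imp_le)
qed

text \<open>Convexity along the line through \<open>p\<close>: the left derivative does not exceed
  the right one. For equal steps this is the midpoint inequality; unequal steps are both reduced to
  the smaller one by monotonicity. It fixes the orientation of the corners of
  \<open>r\<close>.\<close>

lemma dirderiv_uminus_le: "- dirderiv p (- d) \<le> dirderiv p d"
proof -
  have same: "- diff_quot p d s \<le> diff_quot p (- d) s" if s: "s > 0" for s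
  proof -
    have "2 * H p = H ((p + s *\<^sub>R d) + (p + s *\<^sub>R (- d)))"
      using H_scale[of 2 p] by (simp add: scaleR_2)
    also have "\<dots> \<le> H (p + s *\<^sub>R d) + H (p + s *\<^sub>R (- d))" by (rule H_add)
    finally have "H p - H (p + s *\<^sub>R d) \<le> H (p + s *\<^sub>R (- d)) - H p" by simp
    from divide_right_mono[OF this, of s] show ?thesis
      using s by (simp add: diff_quot_def diff_divide_distrib)
  qed
  have "- diff_quot p d s \<le> diff_quot p (- d) t" if "s > 0" "t > 0" for s t
    using same[of "min s t"] diff_quot_mono[of "min s t" s p d] diff_quot_mono[of "min s t" t p "- d"] that by simp
  then have "- diff_quot p d s \<le> dirderiv p (- d)" if "s > 0" for s
    using that by (intro dirderiv_geI)
  then have "- dirderiv p (- d) \<le> diff_quot p d s" if "s > 0" for s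
    using that by (simp add: minus_le_iff)
  then show ?thesis by (rule dirderiv_geI)
qed

text \<open>Since \<open>H\<close> is Lipschitz, a curve may be replaced by its tangent line.\<close>

lemma H_curve_deriv_right:
  assumes "(\<gamma> has_vector_derivative d) (at a)"
  shows "((\<lambda>t. H (\<gamma> t)) has_real_derivative dirderiv (\<gamma> a) d) (at_right a)"
proof -
  obtain R where R: "R > 0" "\<And>h h'. \<bar>H h - H h'\<bar> \<le> R * norm (h - h')" by (rule H_lipschitz) blast
  have "((\<lambda>s. norm (\<gamma> (a + s) - \<gamma> a - s *\<^sub>R d) / norm s) \<longlongrightarrow> 0) (at 0)"
    using assms unfolding has_vector_derivative_def has_derivative_at by simp
  then have "((\<lambda>s. norm (\<gamma> (a + s) - \<gamma> a - s *\<^sub>R d) / norm s) \<longlongrightarrow> 0) (at_right 0)"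
    by (simp add: filterlim_at_split)
  then have "((\<lambda>s. R * (norm (\<gamma> (a + s) - \<gamma> a - s *\<^sub>R d) / norm s)) \<longlongrightarrow> 0) (at_right 0)"
    by (rule tendsto_mult_right_zero)
  then have "((\<lambda>s. (H (\<gamma> (a + s)) - H (\<gamma> a)) / s - diff_quot (\<gamma> a) d s) \<longlongrightarrow> 0) (at_right 0)"
  proof (rule Lim_null_comparison[rotated])
    show "\<forall>\<^sub>F s in at_right 0. norm ((H (\<gamma> (a + s)) - H (\<gamma> a)) / s - diff_quot (\<gamma> a) d s)
        \<le> R * (norm (\<gamma> (a + s) - \<gamma> a - s *\<^sub>R d) / norm s)"
      unfolding eventually_at_right_field
    proof (intro exI[of _ 1] conjI allI impI)
      fix s :: real assume s: "0 < s"
      have "(H (\<gamma> (a + s)) - H (\<gamma> a)) / s - diff_quot (\<gamma> a) d s = (H (\<gamma> (a + s)) - H (\<gamma> a + s *\<^sub>R d)) / s"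
        using s by (simp add: diff_quot_def field_simps)
      then show "norm ((H (\<gamma> (a + s)) - H (\<gamma> a)) / s - diff_quot (\<gamma> a) d s)
        \<le> R * (norm (\<gamma> (a + s) - \<gamma> a - s *\<^sub>R d) / norm s)"
        using R(2)[of "\<gamma> (a + s)" "\<gamma> a + s *\<^sub>R d"] s
        by (simp add: divide_right_mono diff_diff_eq)
    qed simp
  qed
  from tendsto_add[OF this diff_quot_tendsto[of "\<gamma> a" d]]
  have "((\<lambda>s. (H (\<gamma> (a + s)) - H (\<gamma> a)) / s) \<longlongrightarrow> dirderiv (\<gamma> a) d) (at_right 0)" by simp
  then show ?thesis
    unfolding has_field_derivative_iff filterlim_at_right_to_0[of _ _ a] by (simp add: add.commute)
qed

text \<open>Reversing time exchanges the two sides and turns the velocity \<open>d\<close> into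
  \<open>- d\<close>; the outer sign comes from the reversed parameter.\<close>

lemma H_curve_deriv_left:
  assumes "(\<gamma> has_vector_derivative d) (at a)"
  shows "((\<lambda>t. H (\<gamma> t)) has_real_derivative - dirderiv (\<gamma> a) (- d)) (at_left a)"
proof -
  have "((\<lambda>t. \<gamma> (- t)) has_vector_derivative - d) (at (- a))"
    using vector_diff_chain_at[OF has_vector_derivative_minus[OF has_vector_derivative_id], of \<gamma> d "- a"] assms
    by (simp add: o_def)
  from H_curve_deriv_right[OF this]
  have "((\<lambda>t. (H (\<gamma> (- t)) - H (\<gamma> a)) / (t + a)) \<longlongrightarrow> dirderiv (\<gamma> a) (- d)) (at_right (- a))"
    by (simp add: has_field_derivative_iff)
  then have "((\<lambda>t. - ((H (\<gamma> (- t)) - H (\<gamma> a)) / (t + a))) \<longlongrightarrow> - dirderiv (\<gamma> a) (- d)) (at_right (- a))"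
    by (rule tendsto_minus)
  moreover have "- ((H (\<gamma> (- t)) - H (\<gamma> a)) / (t + a)) = (H (\<gamma> (- t)) - H (\<gamma> a)) / (- t - a)" for t
    by (metis divide_minus_right minus_add_distrib uminus_add_conv_diff add.commute diff_minus_eq_add minus_diff_eq)
  ultimately show ?thesis
    unfolding has_field_derivative_iff filterlim_at_left_to_right[of _ _ a] by simp
qed

section \<open>The polar radius and its one-sided slopes\<close>

abbreviation "dir (a::real) \<equiv> (cos a, sin a)"
abbreviation "ndir (a::real) \<equiv> (- sin a, cos a)"

lemma dir_nonzero: "dir a \<noteq> 0"
  by (auto simp: zero_prod_def) (metis sin_zero_abs_cos_one abs_zero zero_neq_one)

text \<open>\<open>H\<close> is positively homogeneous, so each ray meets the level
  \<open>H = 1\<close> exactly once. Regularity of \<open>r\<close> is inherited from the convex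
  function \<open>H\<close> through this reciprocal.\<close>

lemma polar_radius_eq: "r a = 1 / H (dir a)"
  unfolding polar_radius_def
proof (rule the_equality)
  have *: "H (\<rho> * cos a, \<rho> * sin a) = \<rho> * H (dir a)" if "\<rho> > 0" for \<rho>
    using H_scale[of \<rho> "dir a"] that by simp
  note pos = H_pos[OF dir_nonzero, of a]
  show "0 < 1 / H (dir a) \<and> H (1 / H (dir a) * cos a, 1 / H (dir a) * sin a) = 1"
    using pos by (subst *) auto
  fix \<rho> assume "0 < \<rho> \<and> H (\<rho> * cos a, \<rho> * sin a) = 1"
  then show "\<rho> = 1 / H (dir a)" using pos by (auto simp: * field_simps)
qed

lemma r_pos: "r a > 0"
  using H_pos[OF dir_nonzero, of a] by (simp add: polar_radius_eq)

lemma H_r: "H (r a * cos a, r a * sin a) = 1"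
  using H_scale[of "r a" "dir a"] r_pos[of a] H_pos[OF dir_nonzero, of a] by (simp add: polar_radius_eq)

lemma r_unique: "\<rho> > 0 \<Longrightarrow> H (\<rho> * cos a, \<rho> * sin a) = 1 \<Longrightarrow> \<rho> = r a"
  using H_scale[of \<rho> "dir a"] H_pos[OF dir_nonzero, of a] by (simp add: polar_radius_eq field_simps)

lemma dir_deriv: "(dir has_vector_derivative ndir a) (at a)"
  by (intro has_vector_derivative_Pair)
    (auto simp: has_real_derivative_iff_has_vector_derivative[symmetric] intro!: derivative_eq_intros)

text \<open>The chain rule for \<open>1 / H\<close>: the factor is \<open>- r^2\<close> times the
  one-sided derivative of \<open>H\<close> along the circle. On the left that derivative is itself
  minus a directional derivative, so the two signs cancel in \<open>slope_left\<close>.\<close>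

definition "slope_right a = - (r a)\<^sup>2 * dirderiv (dir a) (ndir a)"
definition "slope_left a = (r a)\<^sup>2 * dirderiv (dir a) (- ndir a)"

lemma r_deriv_right: "(r has_real_derivative slope_right a) (at_right a)"
proof -
  have "((\<lambda>t. inverse (H (dir t))) has_real_derivative slope_right a) (at_right a)"
    using H_pos[OF dir_nonzero, of a] H_curve_deriv_right[OF dir_deriv, of a]
    by (auto intro!: derivative_eq_intros simp: slope_right_def polar_radius_eq power2_eq_square field_simps)
  then show ?thesis by (simp add: polar_radius_eq[abs_def] inverse_eq_divide)
qed

lemma r_deriv_left: "(r has_real_derivative slope_left a) (at_left a)"
proof -
  have "((\<lambda>t. inverse (H (dir t))) has_real_derivative slope_left a) (at_left a)"
    using H_pos[OF dir_nonzero, of a] H_curve_deriv_left[OF dir_deriv, of a]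
    by (auto intro!: derivative_eq_intros simp: slope_left_def polar_radius_eq power2_eq_square field_simps)
  then show ?thesis by (simp add: polar_radius_eq[abs_def] inverse_eq_divide)
qed

lemma slope_le: "slope_right a \<le> slope_left a"
  using mult_left_mono[OF dirderiv_uminus_le[of "dir a" "ndir a"], of "(r a)\<^sup>2"]
  by (simp add: slope_right_def slope_left_def)

text \<open>One-sided derivatives are unique, and \<open>closed_segment\<close> does not order its
  endpoints; \<open>slope_le\<close> puts the right slope first.\<close>

lemma between_iff: "between_one_sided_derivs r a c \<longleftrightarrow> slope_right a \<le> c \<and> c \<le> slope_left a"
proof
  assume "between_one_sided_derivs r a c"
  then obtain l s where *: "(r has_real_derivative l) (at_left a)" "(r has_real_derivative s) (at_right a)"
     "c \<in> closed_segment l s" unfolding between_one_sided_derivs_def by blast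
  have "l = slope_left a"
    using *(1) r_deriv_left[of a] unfolding has_field_derivative_iff
    by (rule tendsto_unique[OF trivial_limit_at_left_real])
  moreover have "s = slope_right a"
    using *(2) r_deriv_right[of a] unfolding has_field_derivative_iff
    by (rule tendsto_unique[OF trivial_limit_at_right_real])
  ultimately show "slope_right a \<le> c \<and> c \<le> slope_left a"
    using * slope_le[of a] by (auto simp: closed_segment_eq_real_ivl split: if_splits)
next
  assume "slope_right a \<le> c \<and> c \<le> slope_left a"
  then show "between_one_sided_derivs r a c"
    unfolding between_one_sided_derivs_def using r_deriv_left[of a] r_deriv_right[of a]
    by (intro exI[of _ "slope_left a"] exI[of _ "slope_right a"]) (auto simp: closed_segment_eq_real_ivl)
qed

text \<open>If the slopes differ, the right one is the smaller. With \<open>q\<close> strictly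
  between them, \<open>r s - q * s\<close> has positive left slope and negative right slope at
  \<open>a\<close>, hence a strict local maximum. A rational \<open>q\<close> is chosen so that only
  countably many such functions arise.\<close>

lemma r_differentiable_or_corner:
  obtains "(r has_real_derivative slope_right a) (at a)" "slope_left a = slope_right a"
  | q d where "q \<in> \<rat>" "d > 0" "\<And>s. s \<noteq> a \<Longrightarrow> \<bar>s - a\<bar> < d \<Longrightarrow> r s - q * s < r a - q * a"
proof (cases "slope_left a = slope_right a")
  case True
  then have "(r has_real_derivative slope_right a) (at a)"
    using r_deriv_left[of a] r_deriv_right[of a]
    by (auto simp: has_field_derivative_iff filterlim_at_split)
  then show thesis using that(1) True by blast
next
  case False
  then have "slope_right a < slope_left a" using slope_le[of a] by simp
  then obtain q where q: "q \<in> \<rat>" "slope_right a < q" "q < slope_left a" using Rats_dense_in_real by blast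
  have "\<forall>\<^sub>F y in at_right a. (r y - r a) / (y - a) < q"
    using r_deriv_right[of a] q(2) unfolding has_field_derivative_iff by (rule order_tendstoD)
  then obtain b where b: "b > a" "\<And>y. a < y \<Longrightarrow> y < b \<Longrightarrow> (r y - r a) / (y - a) < q"
    unfolding eventually_at_right_field by blast
  have "\<forall>\<^sub>F y in at_left a. q < (r y - r a) / (y - a)"
    using r_deriv_left[of a] q(3) unfolding has_field_derivative_iff by (rule order_tendstoD)
  then obtain b' where b': "b' < a" "\<And>y. b' < y \<Longrightarrow> y < a \<Longrightarrow> q < (r y - r a) / (y - a)"
    unfolding eventually_at_left_field by blast
  show thesis
  proof (rule that(2)[OF q(1), of "min (b - a) (a - b')"])
    fix s assume s: "s \<noteq> a" "\<bar>s - a\<bar> < min (b - a) (a - b')"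
    show "r s - q * s < r a - q * a"
    proof (cases "s > a")
      case True
      then have "r s - r a < q * (s - a)" using b(2)[of s] s by (simp add: field_simps)
      then show ?thesis by (simp add: algebra_simps)
    next
      case False
      then have "r s - r a < q * (s - a)" using b'(2)[of s] s by (simp add: neg_less_divide_eq)
      then show ?thesis by (simp add: algebra_simps)
    qed
  qed (use b b' in auto)
qed

section \<open>Maximizing controls in polar coordinates\<close>

text \<open>The control is determined by its components in the orthonormal frame
  \<open>dir a\<close>, \<open>ndir a\<close>. Maximality fixes the first as \<open>1 / r a\<close>;
  the second is \<open>- \<rho> / r^2\<close>. Testing \<open>u\<close> against
  \<open>dir a + s ndir a\<close> and \<open>dir a - s ndir a\<close> bounds the second component by
  directional derivatives, which are the slopes of \<open>r\<close> up to the factor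
  \<open>r^2\<close>.\<close>

lemma maximizer_polar:
  assumes u: "u \<in> U" and max: "r a * cos a * fst u + r a * sin a * snd u = 1"
  defines "\<rho> \<equiv> - (r a)\<^sup>2 * (ndir a \<bullet> u)"
  shows "between_one_sided_derivs r a \<rho>"
    "u = ((\<rho> * sin a + r a * cos a) / (r a)\<^sup>2, (r a * sin a - \<rho> * cos a) / (r a)\<^sup>2)"
proof -
  note r = r_pos[of a]
  have dir: "dir a \<bullet> u = 1 / r a" "H (dir a) = 1 / r a"
    using max r by (cases u; simp add: polar_radius_eq field_simps)+
  have "ndir a \<bullet> u \<le> diff_quot (dir a) (ndir a) s" if "s > 0" for s
    using inner_le_H[OF u, of "dir a + s *\<^sub>R ndir a"] that dir
    by (simp add: diff_quot_def inner_add_left le_divide_eq mult.commute del: add_Pair scaleR_Pair)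
  then have 1: "ndir a \<bullet> u \<le> dirderiv (dir a) (ndir a)" by (rule dirderiv_geI)
  have "- (ndir a \<bullet> u) \<le> diff_quot (dir a) (- ndir a) s" if "s > 0" for s
    using inner_le_H[OF u, of "dir a + s *\<^sub>R (- ndir a)"] that dir
    by (simp add: diff_quot_def inner_add_left inner_diff_left le_divide_eq mult.commute del: add_Pair scaleR_Pair uminus_Pair)
  then have 2: "- (ndir a \<bullet> u) \<le> dirderiv (dir a) (- ndir a)" by (rule dirderiv_geI)
  show "between_one_sided_derivs r a \<rho>"
    unfolding between_iff slope_right_def slope_left_def \<rho>_def
    using mult_left_mono[OF 1, of "(r a)\<^sup>2"] mult_left_mono[OF 2, of "(r a)\<^sup>2"] by (simp del: uminus_Pair)
  obtain u1 u2 where u12: "u = (u1, u2)" by (cases u)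
  have *: "cos a * u1 + sin a * u2 = 1 / r a" using dir by (simp add: u12)
  have \<rho>: "\<rho> = - (r a)\<^sup>2 * (cos a * u2 - sin a * u1)" by (simp add: \<rho>_def u12)
  have cs: "cos a * cos a + sin a * sin a = 1" by (rule sin_cos_squared_add3)
  have "u1 = cos a * (cos a * u1 + sin a * u2) - sin a * (cos a * u2 - sin a * u1)"
    using cs by algebra
  also have "\<dots> = (\<rho> * sin a + r a * cos a) / (r a)\<^sup>2"
    unfolding * \<rho> using r by (simp add: field_simps power2_eq_square)
  finally have u1: "u1 = (\<rho> * sin a + r a * cos a) / (r a)\<^sup>2" .
  have "u2 = sin a * (cos a * u1 + sin a * u2) + cos a * (cos a * u2 - sin a * u1)"
    using cs by algebra
  also have "\<dots> = (r a * sin a - \<rho> * cos a) / (r a)\<^sup>2"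
    unfolding * \<rho> using r by (simp add: field_simps power2_eq_square)
  finally have "u2 = (r a * sin a - \<rho> * cos a) / (r a)\<^sup>2" .
  with u1 show "u = ((\<rho> * sin a + r a * cos a) / (r a)\<^sup>2, (r a * sin a - \<rho> * cos a) / (r a)\<^sup>2)"
    by (simp add: u12)
qed

text \<open>The bounds on \<rho> say that \<open>d\<close> lies between the one-sided derivatives of
  \<open>H\<close> along the tangent line at \<open>dir a\<close>. By convexity the affine function
  with slope \<open>d\<close> stays below \<open>H\<close> on this line, and homogeneity carries the
  inequality to all directions.\<close>

lemma polar_maximizer:
  assumes \<rho>: "between_one_sided_derivs r a \<rho>"
  defines "u \<equiv> ((\<rho> * sin a + r a * cos a) / (r a)\<^sup>2, (r a * sin a - \<rho> * cos a) / (r a)\<^sup>2)"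
  shows "u \<in> U" "(r a * cos a, r a * sin a) \<bullet> u = 1"
proof -
  note r = r_pos[of a]
  define \<eta> where "\<eta> = 1 / r a"
  define d where "d = - \<rho> / (r a)\<^sup>2"
  have \<eta>: "H (dir a) = \<eta>" "\<eta> > 0" using r H_pos[OF dir_nonzero, of a] by (auto simp: \<eta>_def polar_radius_eq)
  have u: "u = \<eta> *\<^sub>R dir a + d *\<^sub>R ndir a"
    using r by (simp add: u_def \<eta>_def d_def field_simps power2_eq_square)
  have dd: "dir a \<bullet> dir a = 1" "ndir a \<bullet> ndir a = 1" "dir a \<bullet> ndir a = 0" "ndir a \<bullet> dir a = 0"
    using sin_cos_squared_add3[of a] by (simp_all add: algebra_simps)
  have inner: "dir a \<bullet> u = \<eta>" "ndir a \<bullet> u = d" unfolding u by (simp_all only: inner_add_right inner_scaleR_right dd mult_1_right mult_zero_right add_0_left add_0_right)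
  have "(r a * cos a, r a * sin a) \<bullet> u = r a * (dir a \<bullet> u)" by (simp add: inner_prod_def algebra_simps)
  also have "\<dots> = 1" using r by (simp only: inner) (simp add: \<eta>_def)
  finally show "(r a * cos a, r a * sin a) \<bullet> u = 1" .
  have sq: "(r a)\<^sup>2 * - dirderiv (dir a) (- ndir a) \<le> (r a)\<^sup>2 * d" "(r a)\<^sup>2 * d \<le> (r a)\<^sup>2 * dirderiv (dir a) (ndir a)"
    using \<rho> r unfolding between_iff slope_right_def slope_left_def d_def by (simp_all del: uminus_Pair)
  then have d: "- dirderiv (dir a) (- ndir a) \<le> d" "d \<le> dirderiv (dir a) (ndir a)"
    using r by (intro mult_left_le_imp_le[OF sq(1)] mult_left_le_imp_le[OF sq(2)]; simp)+
  have tangent: "\<eta> + s * d \<le> H (dir a + s *\<^sub>R ndir a)" for s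
  proof (cases "s \<ge> 0")
    case True
    have "\<eta> + s * d \<le> H (dir a) + s * dirderiv (dir a) (ndir a)"
      unfolding \<eta> using mult_left_mono[OF d(2) True] by simp
    also have "\<dots> \<le> H (dir a + s *\<^sub>R ndir a)" using True by (rule H_ge_dirderiv)
    finally show ?thesis .
  next
    case False
    then have s: "0 \<le> - s" by simp
    have "\<eta> + s * d = \<eta> + (- s) * (- d)" by simp
    also have "\<dots> \<le> \<eta> + (- s) * dirderiv (dir a) (- ndir a)"
      using d(1) s by (intro add_left_mono mult_left_mono) linarith+
    also have "\<dots> = H (dir a) + (- s) * dirderiv (dir a) (- ndir a)"
      unfolding \<eta> by simp
    also have "\<dots> \<le> H (dir a + (- s) *\<^sub>R (- ndir a))" using s by (rule H_ge_dirderiv)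
    also have "(- s) *\<^sub>R (- ndir a) = s *\<^sub>R ndir a" by simp
    finally show ?thesis .
  qed
  show "u \<in> U"
    unfolding in_U_iff
  proof
    fix p :: "real \<times> real"
    define x where "x = p \<bullet> dir a"
    define y where "y = p \<bullet> ndir a"
    have cs: "cos a * cos a + sin a * sin a = 1" by (rule sin_cos_squared_add3)
    have p: "p = x *\<^sub>R dir a + y *\<^sub>R ndir a"
    proof -
      obtain p1 p2 where p12: "p = (p1, p2)" by (cases p)
      have "x = p1 * cos a + p2 * sin a" "y = p2 * cos a - p1 * sin a" by (simp_all add: x_def y_def p12)
      then have "p1 = x * cos a - y * sin a" "p2 = x * sin a + y * cos a" using cs by algebra+
      then show ?thesis by (simp add: p12)
    qed
    \<comment> \<open>An arbitrary \<open>p\<close> need not be a positive multiple of a point of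
      the tangent line, but \<open>dir a + \<delta> p\<close> is one as soon as
      \<open>1 + \<delta> x > 0\<close>. Subadditivity then removes \<open>dir a\<close>, because
      the tangent bound is an equality there.\<close>
    define \<delta> where "\<delta> = 1 / (\<bar>x\<bar> + 1)"
    have \<delta>: "\<delta> > 0" "1 + \<delta> * x > 0" by (auto simp: \<delta>_def field_simps)
    define s where "s = \<delta> * y / (1 + \<delta> * x)"
    have ps: "dir a + \<delta> *\<^sub>R p = (1 + \<delta> * x) *\<^sub>R (dir a + s *\<^sub>R ndir a)"
    proof -
      have "(1 + \<delta> * x) * s = \<delta> * y" using \<delta>(2) by (simp add: s_def)
      then have "(1 + \<delta> * x) *\<^sub>R (dir a + s *\<^sub>R ndir a) = (1 + \<delta> * x) *\<^sub>R dir a + (\<delta> * y) *\<^sub>R ndir a"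
        by (simp only: scaleR_add_right scaleR_scaleR)
      then show ?thesis unfolding p by (simp add: algebra_simps)
    qed
    have "(1 + \<delta> * x) * \<eta> + \<delta> * y * d = (1 + \<delta> * x) * (\<eta> + s * d)"
      using \<delta>(2) by (simp add: s_def field_simps)
    also have "\<dots> \<le> (1 + \<delta> * x) * H (dir a + s *\<^sub>R ndir a)"
      using \<delta>(2) by (intro mult_left_mono tangent) simp
    also have "\<dots> = H (dir a + \<delta> *\<^sub>R p)" unfolding ps using \<delta>(2) by (subst H_scale) simp_all
    also have "\<dots> \<le> \<eta> + \<delta> * H p"
      using H_add[of "dir a" "\<delta> *\<^sub>R p"] \<delta> by (simp only: H_scale[OF less_imp_le] \<eta>)
    finally have "\<delta> * (x * \<eta> + y * d) \<le> \<delta> * H p" by (simp add: algebra_simps)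
    then have "x * \<eta> + y * d \<le> H p" using \<delta>(1) by simp
    moreover have "p \<bullet> u = x * \<eta> + y * d" unfolding u x_def y_def
      by (simp only: inner_add_right inner_scaleR_right mult.commute)
    ultimately show "p \<bullet> u \<le> H p" by simp
  qed
qed

lemma dir_lipschitz: "\<bar>cos a - cos b\<bar> \<le> \<bar>a - b\<bar>" "\<bar>sin a - sin b\<bar> \<le> \<bar>a - b\<bar>" for a b :: real
proof -
  have *: "2 * \<bar>x\<bar> * \<bar>y\<bar> \<le> \<bar>a - b\<bar>" if "\<bar>x\<bar> \<le> \<bar>(a - b) / 2\<bar>" "\<bar>y\<bar> \<le> 1" for x y :: real
    using mult_mono[OF that] by simp
  show "\<bar>cos a - cos b\<bar> \<le> \<bar>a - b\<bar>"
    using *[of "sin ((b - a) / 2)" "sin ((a + b) / 2)"] abs_sin_x_le_abs_x[of "(b - a) / 2"]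
    by (simp add: cos_diff_cos abs_mult abs_minus_commute mult.commute mult.left_commute)
  show "\<bar>sin a - sin b\<bar> \<le> \<bar>a - b\<bar>"
    using *[of "sin ((a - b) / 2)" "cos ((a + b) / 2)"] abs_sin_x_le_abs_x[of "(a - b) / 2"]
    by (simp add: sin_diff_sin abs_mult mult.commute mult.left_commute)
qed

lemma r_bounds: obtains m M where "m > 0" "\<And>a. m \<le> r a" "\<And>a. r a \<le> M"
proof -
  obtain c where c: "c > 0" "\<And>h. c * norm h \<le> H h" by (rule H_lower) blast
  obtain R where R: "R > 0" "\<And>h. H h \<le> R * norm h" by (rule H_upper) blast
  have n: "norm (dir a) = 1" for a by (simp add: norm_Pair)
  show thesis
  proof (rule that[of "1 / R" "1 / c"])
    show "1 / R \<le> r a" for a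
      using R(2)[of "dir a"] H_pos[OF dir_nonzero, of a] by (simp add: polar_radius_eq n frac_le)
    show "r a \<le> 1 / c" for a
      using c(1) c(2)[of "dir a"] by (simp add: polar_radius_eq n frac_le)
  qed (use R in simp)
qed

text \<open>Differences of \<open>r\<close> are differences of \<open>H\<close> on the unit circle
  multiplied by \<open>r a * r b\<close>, which is bounded; \<open>H\<close> and \<open>dir\<close>
  are Lipschitz.\<close>

lemma r_lipschitz: obtains L where "\<And>a b. \<bar>r a - r b\<bar> \<le> L * \<bar>a - b\<bar>"
proof -
  obtain R where R: "R > 0" "\<And>h h'. \<bar>H h - H h'\<bar> \<le> R * norm (h - h')" by (rule H_lipschitz) blast
  obtain m M where M: "m > 0" "\<And>a. m \<le> r a" "\<And>a. r a \<le> M" by (rule r_bounds) blast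
  have "\<bar>r a - r b\<bar> \<le> (M * M * (2 * R)) * \<bar>a - b\<bar>" for a b
  proof -
    have pos: "H (dir a) > 0" "H (dir b) > 0" by (intro H_pos dir_nonzero)+
    have "r a - r b = r a * r b * (H (dir b) - H (dir a))"
      using pos by (simp add: polar_radius_eq field_simps)
    then have "\<bar>r a - r b\<bar> = r a * r b * \<bar>H (dir b) - H (dir a)\<bar>"
      using r_pos[of a] r_pos[of b] by (simp add: abs_mult)
    also have "\<dots> \<le> (M * M) * (R * norm (dir b - dir a))"
      using M(3) r_pos[of a] r_pos[of b] R by (intro mult_mono) (auto intro: less_imp_le order_trans)
    also have "norm (dir b - dir a) \<le> 2 * \<bar>a - b\<bar>"
      using norm_Pair_le[of "cos b - cos a" "sin b - sin a"] dir_lipschitz[of b a]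
      by (simp add: abs_minus_commute)
    finally have "\<bar>r a - r b\<bar> \<le> M * M * (R * (2 * \<bar>a - b\<bar>))"
      using R(1) by (simp add: mult_left_mono)
    then show ?thesis by (simp add: algebra_simps)
  qed
  then show thesis by (rule that)
qed

lemma r_continuous: "continuous_on S r"
  unfolding polar_radius_eq[abs_def] using H_pos[OF dir_nonzero]
  by (intro continuous_intros continuous_on_compose2[OF H_continuous[of UNIV]]) (auto simp: less_le)

end

text \<open>Each such point is the unique strict maximum on an open interval with rational
  endpoints, and there are countably many of these intervals.\<close>

lemma countable_strict_local_max:
  fixes f :: "real \<Rightarrow> real"
  shows "countable {t. \<exists>d>0. \<forall>s. s \<noteq> t \<longrightarrow> \<bar>s - t\<bar> < d \<longrightarrow> f s < f t}"
proof -
  define M where "M p q = {t. p < t \<and> t < q \<and> (\<forall>s. p < s \<longrightarrow> s < q \<longrightarrow> s \<noteq> t \<longrightarrow> f s < f t)}" for p q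
  have "countable (M p q)" for p q
  proof -
    have "s = t" if "s \<in> M p q" "t \<in> M p q" for s t
      using that unfolding M_def by (metis (mono_tags, lifting) less_asym mem_Collect_eq)
    then have "M p q = {} \<or> (\<exists>t. M p q = {t})" by blast
    then show ?thesis by auto
  qed
  then have "countable (\<Union>p\<in>\<rat>. \<Union>q\<in>\<rat>. M p q)" by (intro countable_UN countable_rat)
  moreover have "{t. \<exists>d>0. \<forall>s. s \<noteq> t \<longrightarrow> \<bar>s - t\<bar> < d \<longrightarrow> f s < f t} \<subseteq> (\<Union>p\<in>\<rat>. \<Union>q\<in>\<rat>. M p q)"
  proof safe
    fix t d assume d: "(0::real) < d" "\<forall>s. s \<noteq> t \<longrightarrow> \<bar>s - t\<bar> < d \<longrightarrow> f s < f t"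
    obtain p where p: "p \<in> \<rat>" "t - d < p" "p < t" using Rats_dense_in_real[of "t - d" t] d by auto
    obtain q where q: "q \<in> \<rat>" "t < q" "q < t + d" using Rats_dense_in_real[of t "t + d"] d by auto
    have "t \<in> M p q" using d(2) p q by (auto simp: M_def)
    then show "t \<in> (\<Union>p\<in>\<rat>. \<Union>q\<in>\<rat>. M p q)" using p q by blast
  qed
  ultimately show ?thesis by (rule countable_subset[rotated])
qed

section \<open>Extremals have an angle representation\<close>

text \<open>Upgrades an almost everywhere derivative to a derivative at a prescribed point. The
  function \<open>k\<close> may be discontinuous, as controls are; it only has to be close to
  \<open>c\<close> near \<open>t\<close>. The increment of \<open>f\<close> minus \<open>c\<close>
  times that of the argument is the integral of \<open>k - c\<close>.\<close>

lemma abs_continuous_derivative_at: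
  assumes f: "abs_continuous f" and deriv: "AE s in lebesgue. (f has_real_derivative k s) (at s)"
    and bound: "AE s in lebesgue. \<bar>k s - c\<bar> \<le> E s" and E: "isCont E t" "E t = 0"
  shows "(f has_real_derivative c) (at t)"
  unfolding has_field_derivative_def has_derivative_at_alt
proof (intro conjI allI impI)
  show "bounded_linear ((*) c)" by (rule bounded_linear_mult_right)
  fix e :: real assume e: "e > 0"
  obtain d where d: "d > 0" "\<And>s. \<bar>s - t\<bar> < d \<Longrightarrow> E s < e"
  proof -
    have "\<forall>\<^sub>F s in at t. E s < e" using E e unfolding isCont_def by (intro order_tendstoD(2)) auto
    then obtain d where "d > 0" "\<forall>s. s \<noteq> t \<and> dist s t < d \<longrightarrow> E s < e" unfolding eventually_at by auto
    then show thesis using that[of d] E e by (metis dist_real_def)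
  qed
  obtain N where N: "negligible N" "\<forall>s. s \<notin> N \<longrightarrow> \<bar>k s - c\<bar> \<le> E s" by (rule AE_lebesgue_negligibleE[OF bound])
  have inc: "\<bar>f b - f a - c * (b - a)\<bar> \<le> e * (b - a)" if "a \<le> b" "\<And>s. s \<in> {a..b} \<Longrightarrow> \<bar>s - t\<bar> < d" for a b
  proof -
    have "((\<lambda>s. k s - c) has_integral (f b - f a) - (b - a) *\<^sub>R c) {a..b}"
      using abs_continuous_integral[OF f deriv \<open>a \<le> b\<close>] has_integral_const_real[of c a b] \<open>a \<le> b\<close>
      by (intro has_integral_diff) auto
    then have "((\<lambda>s. if s \<in> N then 0 else k s - c) has_integral (f b - f a) - (b - a) *\<^sub>R c) {a..b}"
      by (rule has_integral_spike[OF N(1), rotated]) auto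
    moreover have "\<bar>k s - c\<bar> \<le> e" if "s \<in> {a..b}" "s \<notin> N" for s
      using N(2) d(2)[of s] \<open>\<And>s. s \<in> {a..b} \<Longrightarrow> \<bar>s - t\<bar> < d\<close>[OF that(1)] that(2) by fastforce
    ultimately have "norm ((f b - f a) - (b - a) *\<^sub>R c) \<le> e * measure lborel {a..b}"
      using e by (intro has_integral_bound_real[of e "{}"]) auto
    then show ?thesis using \<open>a \<le> b\<close> by (simp add: mult.commute)
  qed
  show "\<exists>d>0. \<forall>y. norm (y - t) < d \<longrightarrow> norm (f y - f t - c * (y - t)) \<le> e * norm (y - t)"
  proof (intro exI[of _ d] conjI allI impI)
    fix y assume y: "norm (y - t) < d"
    show "norm (f y - f t - c * (y - t)) \<le> e * norm (y - t)"
    proof (cases "t \<le> y")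
      case True
      then show ?thesis using inc[of t y] y by auto
    next
      case False
      then show ?thesis using inc[of y t] y by (auto simp: abs_minus_commute algebra_simps)
    qed
  qed (rule d)
qed

section \<open>Reading curves and covectors componentwise\<close>

lemma has_vector_derivative_PairD:
  assumes "((\<lambda>t. (f t, g t)) has_vector_derivative (a, b)) F"
  shows "(f has_vector_derivative a) F" "(g has_vector_derivative b) F"
  using bounded_linear.has_vector_derivative[OF bounded_linear_fst assms]
    bounded_linear.has_vector_derivative[OF bounded_linear_snd assms] by simp_all

lemma abs_continuous_PairD:
  assumes "abs_continuous (\<lambda>t. (f t, g t))"
  shows "abs_continuous f" "abs_continuous g"
  using abs_continuous_fst[OF assms] abs_continuous_snd[OF assms] by simp_all

lemma abs_continuous_cartanD:
  assumes "abs_continuous (\<lambda>t. (a t, b t, c t, d t, e t))"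
  shows "abs_continuous a" "abs_continuous b" "abs_continuous c" "abs_continuous d" "abs_continuous e"
proof -
  note 1 = abs_continuous_PairD[OF assms]
  note 2 = abs_continuous_PairD[OF 1(2)]
  note 3 = abs_continuous_PairD[OF 2(2)]
  note 4 = abs_continuous_PairD[OF 3(2)]
  show "abs_continuous a" "abs_continuous b" "abs_continuous c" "abs_continuous d" "abs_continuous e"
    by (rule 1 2 3 4)+
qed

lemma has_vector_derivative_cartanD:
  fixes a b c d e :: "real \<Rightarrow> real"
  assumes "((\<lambda>t. (a t, b t, c t, d t, e t)) has_vector_derivative (a', b', c', d', e')) (at t)"
  shows "(a has_real_derivative a') (at t)" "(b has_real_derivative b') (at t)"
    "(c has_real_derivative c') (at t)" "(d has_real_derivative d') (at t)" "(e has_real_derivative e') (at t)"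
proof -
  note 1 = has_vector_derivative_PairD[OF assms]
  note 2 = has_vector_derivative_PairD[OF 1(2)]
  note 3 = has_vector_derivative_PairD[OF 2(2)]
  note 4 = has_vector_derivative_PairD[OF 3(2)]
  show "(a has_real_derivative a') (at t)" "(b has_real_derivative b') (at t)"
    "(c has_real_derivative c') (at t)" "(d has_real_derivative d') (at t)" "(e has_real_derivative e') (at t)"
    unfolding has_real_derivative_iff_has_vector_derivative by (rule 1 2 3 4)+
qed

text \<open>The fields do not depend on \<open>v\<close> and \<open>w\<close>, so the last two
  components vanish; this is why \<open>p4\<close> and \<open>p5\<close> are constant.\<close>

lemma GDERIV_hamiltonian:
  "GDERIV (\<lambda>q. hamiltonian q (p1, p2, p3, p4, p5) (u1, u2)) (x, y, z, v, w) :>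
     (- p4 * y * u1 / 12 + (p3 / 2 + p4 * x / 6 + p5 * y / 12) * u2,
      - (p3 / 2 + p4 * x / 12 + p5 * y / 6) * u1 + p5 * x * u2 / 12,
      - (p4 * u1 + p5 * u2) / 2, 0, 0)"
proof -
  have eq: "hamiltonian q (p1, p2, p3, p4, p5) (u1, u2) =
     (p1 - (1/2) * p3 * fst (snd q) - (1/12) * p4 * fst q * fst (snd q) - (1/12) * p5 * (fst (snd q))\<^sup>2
        - (1/2) * p4 * fst (snd (snd q))) * u1 +
     (p2 + (1/2) * p3 * fst q + (1/12) * p4 * (fst q)\<^sup>2 + (1/12) * p5 * fst q * fst (snd q)
        - (1/2) * p5 * fst (snd (snd q))) * u2" for q
    by (cases q) (simp add: hamiltonian_def momentum_coord)
  show ?thesis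
    unfolding gderiv_def eq
    by (rule derivative_eq_intros refl | simp)+ (auto simp: fun_eq_iff field_simps power2_eq_square)
qed

text \<open>The definition of \<open>extremal\<close> only asserts that some gradient exists;
  uniqueness identifies it with the computed one.\<close>

lemma GDERIV_unique:
  assumes "GDERIV f a :> D" "GDERIV f a :> D'"
  shows "D = D'"
proof -
  have "(\<lambda>h. h \<bullet> D) = (\<lambda>h. h \<bullet> D')"
    using assms unfolding gderiv_def by (rule has_derivative_unique)
  then have "(D - D') \<bullet> D = (D - D') \<bullet> D'" by meson
  then have "(D - D') \<bullet> (D - D') = 0" by (simp add: inner_diff_right)
  then show ?thesis by simp
qed

section \<open>Consequences of the adjoint system\<close>

locale cartan_extremal = quasinormed_plane +
  fixes x y z v w :: "real \<Rightarrow> real" and u :: "real \<Rightarrow> real \<times> real" and \<psi> :: "real \<Rightarrow> cartan"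
  assumes extremal: "extremal F (\<lambda>t. (x t, y t, z t, v t, w t)) u \<psi>"
    and initial: "(x 0, y 0, z 0, v 0, w 0) = 0"
begin

lemma initial_coords: "x 0 = 0" "y 0 = 0" "z 0 = 0" "v 0 = 0" "w 0 = 0"
  using initial by (simp_all add: zero_prod_def)

definition "u1 t = fst (u t)"
definition "u2 t = snd (u t)"
definition "p1 t = fst (\<psi> t)"
definition "p2 t = fst (snd (\<psi> t))"
definition "p3 t = fst (snd (snd (\<psi> t)))"
definition "p4 t = fst (snd (snd (snd (\<psi> t))))"
definition "p5 t = snd (snd (snd (snd (\<psi> t))))"
definition "h1 t = fst (momentum (x t, y t, z t, v t, w t) (\<psi> t))"
definition "h2 t = snd (momentum (x t, y t, z t, v t, w t) (\<psi> t))"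
definition "h3 t = p3 0 + p4 0 * x t + p5 0 * y t"

lemma u_eq: "u t = (u1 t, u2 t)" by (simp add: u1_def u2_def)
lemma \<psi>_eq: "\<psi> t = (p1 t, p2 t, p3 t, p4 t, p5 t)"
  by (simp add: p1_def p2_def p3_def p4_def p5_def)
lemma momentum_eq: "momentum (x t, y t, z t, v t, w t) (\<psi> t) = (h1 t, h2 t)"
  by (simp add: h1_def h2_def)

lemma trajectory: "trajectory F (\<lambda>t. (x t, y t, z t, v t, w t)) (\<lambda>t. (u1 t, u2 t))"
  using extremal by (simp add: extremal_def flip: u_eq)

lemma abs_continuous_coords:
  "abs_continuous x" "abs_continuous y" "abs_continuous z" "abs_continuous v" "abs_continuous w"
proof -
  have "abs_continuous (\<lambda>t. (x t, y t, z t, v t, w t))" using trajectory by (simp add: trajectory_def)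
  from abs_continuous_cartanD[OF this] show "abs_continuous x" "abs_continuous y" "abs_continuous z"
    "abs_continuous v" "abs_continuous w" .
qed

lemma abs_continuous_covector:
  "abs_continuous p1" "abs_continuous p2" "abs_continuous p3" "abs_continuous p4" "abs_continuous p5"
proof -
  have "abs_continuous (\<lambda>t. (p1 t, p2 t, p3 t, p4 t, p5 t))" using extremal by (simp add: extremal_def flip: \<psi>_eq)
  from abs_continuous_cartanD[OF this] show "abs_continuous p1" "abs_continuous p2" "abs_continuous p3"
    "abs_continuous p4" "abs_continuous p5" .
qed

lemma control_in_U: "(u1 t, u2 t) \<in> U"
  using trajectory by (simp add: trajectory_def)

lemma control_bounded: obtains R where "R > 0" "\<And>t. \<bar>u1 t\<bar> \<le> R" "\<And>t. \<bar>u2 t\<bar> \<le> R"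
proof -
  obtain R where R: "R > 0" "\<And>u. u \<in> U \<Longrightarrow> norm u \<le> R" by (rule U_bounded) blast
  show thesis
  proof (rule that[OF R(1)])
    show "\<bar>u1 t\<bar> \<le> R" "\<bar>u2 t\<bar> \<le> R" for t
      using R(2)[OF control_in_U[of t]] norm_fst_le[of "u1 t" "u2 t"] norm_snd_le[of "u2 t" "u1 t"] by auto
  qed
qed

lemma control_measurable: "loc_bounded_measurable u1" "loc_bounded_measurable u2"
proof -
  have u: "(\<lambda>t. (u1 t, u2 t)) \<in> borel_measurable lebesgue" using trajectory by (simp add: trajectory_def)
  have "(\<lambda>t. fst (u1 t, u2 t)) \<in> borel_measurable lebesgue"
    by (rule measurable_compose[OF u]) (intro borel_measurable_continuous_onI continuous_intros)
  moreover have "(\<lambda>t. snd (u1 t, u2 t)) \<in> borel_measurable lebesgue"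
    by (rule measurable_compose[OF u]) (intro borel_measurable_continuous_onI continuous_intros)
  moreover obtain R where "R > 0" "\<And>t. \<bar>u1 t\<bar> \<le> R" "\<And>t. \<bar>u2 t\<bar> \<le> R" by (rule control_bounded) blast
  ultimately show "loc_bounded_measurable u1" "loc_bounded_measurable u2"
    by (auto intro!: loc_bounded_measurableI)
qed

lemma AE_coords: "AE t in lebesgue.
    (x has_real_derivative u1 t) (at t) \<and> (y has_real_derivative u2 t) (at t) \<and>
    (z has_real_derivative (x t * u2 t - y t * u1 t) / 2) (at t) \<and>
    (v has_real_derivative - (1/2) * (z t + x t * y t / 6) * u1 t + (1/12) * (x t)\<^sup>2 * u2 t) (at t) \<and>
    (w has_real_derivative - (1/12) * (y t)\<^sup>2 * u1 t - (1/2) * (z t - x t * y t / 6) * u2 t) (at t)"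
proof -
  have "AE t in lebesgue. ((\<lambda>t. (x t, y t, z t, v t, w t)) has_vector_derivative
      (u1 t *\<^sub>R field_X (x t, y t, z t, v t, w t) + u2 t *\<^sub>R field_Y (x t, y t, z t, v t, w t))) (at t)"
    using trajectory by (simp add: trajectory_def)
  then show ?thesis
    unfolding trajectory_rhs_coord
    by eventually_elim (intro conjI; erule has_vector_derivative_cartanD)
qed

lemma AE_covector: "AE t in lebesgue.
    (p1 has_real_derivative p4 t * y t * u1 t / 12 - (p3 t / 2 + p4 t * x t / 6 + p5 t * y t / 12) * u2 t) (at t) \<and>
    (p2 has_real_derivative (p3 t / 2 + p4 t * x t / 12 + p5 t * y t / 6) * u1 t - p5 t * x t * u2 t / 12) (at t) \<and>
    (p3 has_real_derivative (p4 t * u1 t + p5 t * u2 t) / 2) (at t) \<and>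
    (p4 has_real_derivative 0) (at t) \<and> (p5 has_real_derivative 0) (at t)"
proof -
  have "AE t in lebesgue. \<exists>D. GDERIV (\<lambda>q. hamiltonian q (p1 t, p2 t, p3 t, p4 t, p5 t) (u1 t, u2 t)) (x t, y t, z t, v t, w t) :> D \<and>
        ((\<lambda>t. (p1 t, p2 t, p3 t, p4 t, p5 t)) has_vector_derivative - D) (at t)"
    using extremal by (simp add: extremal_def flip: u_eq \<psi>_eq)
  then show ?thesis
  proof eventually_elim
    case (elim t)
    then obtain D where D: "GDERIV (\<lambda>q. hamiltonian q (p1 t, p2 t, p3 t, p4 t, p5 t) (u1 t, u2 t)) (x t, y t, z t, v t, w t) :> D"
        "((\<lambda>t. (p1 t, p2 t, p3 t, p4 t, p5 t)) has_vector_derivative - D) (at t)" by blast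
    have neg: "- D = (p4 t * y t * u1 t / 12 - (p3 t / 2 + p4 t * x t / 6 + p5 t * y t / 12) * u2 t,
       (p3 t / 2 + p4 t * x t / 12 + p5 t * y t / 6) * u1 t - p5 t * x t * u2 t / 12,
       (p4 t * u1 t + p5 t * u2 t) / 2, 0, 0)"
      unfolding GDERIV_unique[OF D(1) GDERIV_hamiltonian] by (simp add: field_simps)
    have "((\<lambda>t. (p1 t, p2 t, p3 t, p4 t, p5 t)) has_vector_derivative
      (p4 t * y t * u1 t / 12 - (p3 t / 2 + p4 t * x t / 6 + p5 t * y t / 12) * u2 t,
       (p3 t / 2 + p4 t * x t / 12 + p5 t * y t / 6) * u1 t - p5 t * x t * u2 t / 12,
       (p4 t * u1 t + p5 t * u2 t) / 2, 0, 0)) (at t)"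
      using D(2) unfolding neg .
    from has_vector_derivative_cartanD[OF this] show ?case by blast
  qed
qed

lemma p4_const: "p4 t = p4 0" and p5_const: "p5 t = p5 0"
proof -
  have "AE t in lebesgue. (p4 has_real_derivative 0) (at t)" "AE t in lebesgue. (p5 has_real_derivative 0) (at t)"
    using AE_covector by (eventually_elim, blast)+
  from abs_continuous_deriv_zero[OF abs_continuous_covector(4) this(1)]
    abs_continuous_deriv_zero[OF abs_continuous_covector(5) this(2)]
  show "p4 t = p4 0" "p5 t = p5 0" .
qed

text \<open>\<open>p3\<close> is merely the component along \<open>z\<close>. The left-invariant
  field of \<open>bZ\<close> also has components \<open>x / 2\<close> and \<open>y / 2\<close> along
  \<open>v\<close> and \<open>w\<close>, which contribute the other half of the linear terms in
  \<open>h3\<close>.\<close>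

lemma p3_eq: "p3 t = p3 0 + (p4 0 * x t + p5 0 * y t) / 2"
proof -
  let ?f = "\<lambda>t. p3 t - (p4 0 * x t + p5 0 * y t) / 2"
  have "AE t in lebesgue. (?f has_real_derivative 0) (at t)"
    using AE_covector AE_coords
  proof eventually_elim
    case (elim t)
    then show ?case by (auto intro!: derivative_eq_intros simp: p4_const[of t] p5_const[of t])
  qed
  moreover have "abs_continuous ?f"
    by (intro abs_continuous_intros abs_continuous_covector abs_continuous_coords)
  ultimately have "?f t = ?f 0" using abs_continuous_deriv_zero[of ?f t] by simp
  then show ?thesis by (simp add: initial_coords)
qed

lemma h_eq:
  "h1 t = p1 t - (1/2) * p3 t * y t - (1/12) * p4 0 * x t * y t - (1/12) * p5 0 * (y t)\<^sup>2 - (1/2) * p4 0 * z t"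
  "h2 t = p2 t + (1/2) * p3 t * x t + (1/12) * p4 0 * (x t)\<^sup>2 + (1/12) * p5 0 * x t * y t - (1/2) * p5 0 * z t"
proof -
  have "momentum (x t, y t, z t, v t, w t) (\<psi> t) =
    (p1 t - (1/2) * p3 t * y t - (1/12) * p4 0 * x t * y t - (1/12) * p5 0 * (y t)\<^sup>2 - (1/2) * p4 0 * z t,
     p2 t + (1/2) * p3 t * x t + (1/12) * p4 0 * (x t)\<^sup>2 + (1/12) * p5 0 * x t * y t - (1/2) * p5 0 * z t)"
    by (simp only: \<psi>_eq[of t] momentum_coord p4_const[of t] p5_const[of t])
  then show
    "h1 t = p1 t - (1/2) * p3 t * y t - (1/12) * p4 0 * x t * y t - (1/12) * p5 0 * (y t)\<^sup>2 - (1/2) * p4 0 * z t"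
    "h2 t = p2 t + (1/2) * p3 t * x t + (1/12) * p4 0 * (x t)\<^sup>2 + (1/12) * p5 0 * x t * y t - (1/2) * p5 0 * z t"
    by (simp_all only: h1_def h2_def fst_conv snd_conv)
qed

lemma h_initial: "h1 0 = p1 0" "h2 0 = p2 0"
  by (simp_all add: h_eq initial_coords)

lemma abs_continuous_h: "abs_continuous h1" "abs_continuous h2"
  unfolding h_eq[abs_def]
  by (intro abs_continuous_intros abs_continuous_covector abs_continuous_coords)+

text \<open>The coordinate form of the bracket relation between \<open>bX\<close>, \<open>bY\<close>
  and \<open>bZ\<close>. The polynomial terms combine into \<open>h3\<close> once \<open>p3\<close>
  is eliminated.\<close>

lemma AE_h: "AE t in lebesgue. (h1 has_real_derivative - h3 t * u2 t) (at t) \<and> (h2 has_real_derivative h3 t * u1 t) (at t)"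
  using AE_covector AE_coords
proof eventually_elim
  case (elim t)
  have *: "p3 t = p3 0 + (p4 0 * x t + p5 0 * y t) / 2" by (rule p3_eq)
  have "(h1 has_real_derivative - h3 t * u2 t) (at t)"
    unfolding h_eq[abs_def] using elim
    by (auto intro!: derivative_eq_intros) (simp add: * h3_def p4_const[of t] p5_const[of t] field_simps)
  moreover have "(h2 has_real_derivative h3 t * u1 t) (at t)"
    unfolding h_eq[abs_def] using elim
    by (auto intro!: derivative_eq_intros) (simp add: * h3_def p4_const[of t] p5_const[of t] field_simps)
  ultimately show ?case by simp
qed

text \<open>The derivative of \<open>h3^2\<close> is \<open>2 * h3 * (p4 * u1 + p5 * u2)\<close>,
  and \<open>h3 * u1\<close>, \<open>- h3 * u2\<close> are the derivatives of \<open>h2\<close>,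
  \<open>h1\<close>. Dividing by \<open>r^4\<close> gives the equation for the square of the
  derivative of \<theta>.\<close>

lemma energy: "(h3 t)\<^sup>2 = (p3 0)\<^sup>2 + 2 * p4 0 * (h2 t - p2 0) - 2 * p5 0 * (h1 t - p1 0)"
proof -
  let ?f = "\<lambda>t. (h3 t)\<^sup>2 - 2 * p4 0 * h2 t + 2 * p5 0 * h1 t"
  have "AE t in lebesgue. (?f has_real_derivative 0) (at t)"
    using AE_h AE_coords
    by eventually_elim (unfold h3_def, auto intro!: derivative_eq_intros simp: algebra_simps)
  moreover have "abs_continuous ?f"
    unfolding h3_def by (intro abs_continuous_intros abs_continuous_h abs_continuous_coords)
  ultimately have "?f t = ?f 0" using abs_continuous_deriv_zero[of ?f t] by simp
  then show ?thesis by (simp add: h_initial) (simp add: h3_def initial_coords algebra_simps)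
qed

lemma AE_maximum: "AE t in lebesgue. h1 t * u1 t + h2 t * u2 t = 1"
proof -
  have "AE t in lebesgue. hamiltonian (x t, y t, z t, v t, w t) (\<psi> t) (u t) = H (momentum (x t, y t, z t, v t, w t) (\<psi> t)) \<and>
        H (momentum (x t, y t, z t, v t, w t) (\<psi> t)) = 1"
    using extremal by (simp add: extremal_def)
  then show ?thesis
    by eventually_elim (simp add: hamiltonian_def momentum_eq u_eq)
qed

lemma continuous_h: "continuous_on S h1" "continuous_on S h2" "continuous_on S h3"
proof -
  have "continuous_on UNIV x" "continuous_on UNIV y" "continuous_on UNIV h1" "continuous_on UNIV h2"
    by (intro abs_continuous_imp_continuous abs_continuous_coords abs_continuous_h)+
  then show "continuous_on S h1" "continuous_on S h2" "continuous_on S h3"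
    unfolding h3_def[abs_def] by (auto intro!: continuous_intros elim: continuous_on_subset)
qed

text \<open>The exceptional set is open by continuity and negligible by assumption, hence
  empty.\<close>

lemma H_h: "H (h1 t, h2 t) = 1"
proof -
  have "AE t in lebesgue. H (momentum (x t, y t, z t, v t, w t) (\<psi> t)) = 1"
    using extremal by (auto simp: extremal_def)
  then obtain N where N: "negligible N" "\<forall>t. t \<notin> N \<longrightarrow> H (h1 t, h2 t) = 1"
    unfolding momentum_eq by (rule AE_lebesgue_negligibleE)
  have c: "continuous_on UNIV (\<lambda>t. H (h1 t, h2 t))"
    by (intro continuous_on_compose2[OF H_continuous[of UNIV]] continuous_intros continuous_h) auto
  have "open {t. H (h1 t, h2 t) \<noteq> 1}"
    by (rule open_Collect_neq) (use c in auto)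
  moreover have "negligible {t. H (h1 t, h2 t) \<noteq> 1}"
    using N by (intro negligible_subset[OF N(1)]) auto
  ultimately have "{t. H (h1 t, h2 t) \<noteq> 1} = {}" using open_not_negligible by blast
  then show ?thesis by auto
qed

section \<open>The polar angle and its derivative\<close>

text \<open>The momentum never vanishes and the line is contractible, so it has a continuous complex
  logarithm. The imaginary part is the angle; the modulus must be \<open>r\<close> because each ray
  meets \<open>H = 1\<close> once.\<close>

lemma polar_angle_exists: "\<exists>\<theta>. polar_angle F (\<lambda>t. (x t, y t, z t, v t, w t)) \<psi> \<theta>"
proof -
  define f where "f t = Complex (h1 t) (h2 t)" for t
  have "continuous_on UNIV f"
    unfolding f_def Complex_eq by (intro continuous_intros continuous_h)
  moreover have "f t \<noteq> 0" for t
  proof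
    assume "f t = 0"
    then have "h1 t = 0" "h2 t = 0" by (auto simp: f_def complex_eq_iff)
    then have "H (0 *\<^sub>R (h1 t, h2 t)) = 1" using H_h[of t] by simp
    then show False by (subst (asm) H_scale) auto
  qed
  ultimately obtain g where g: "continuous_on UNIV g" "\<And>t. f t = exp (g t)"
    using continuous_logarithm_on_contractible[of UNIV f] contractible_UNIV by (metis UNIV_I)
  have h: "h1 t = exp (Re (g t)) * cos (Im (g t))" "h2 t = exp (Re (g t)) * sin (Im (g t))" for t
    using g(2)[of t] by (metis Re_exp complex.sel(1) f_def, metis Im_exp complex.sel(2) f_def)
  have "exp (Re (g t)) = r (Im (g t))" for t
    using H_h[of t] by (intro r_unique) (auto simp: h)
  then have "polar_angle F (\<lambda>t. (x t, y t, z t, v t, w t)) \<psi> (\<lambda>t. Im (g t))"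
    unfolding polar_angle_def momentum_eq using g(1) h by (auto intro!: continuous_intros)
  then show ?thesis by blast
qed

lemma polar_angle_derivative:
  assumes \<theta>: "polar_angle F (\<lambda>t. (x t, y t, z t, v t, w t)) \<psi> \<theta>"
  shows "(\<theta> has_real_derivative h3 t / (r (\<theta> t))\<^sup>2) (at t)"
proof -
  have h: "h1 s = r (\<theta> s) * cos (\<theta> s)" "h2 s = r (\<theta> s) * sin (\<theta> s)" for s
    using \<theta> by (auto simp: polar_angle_def momentum_eq)
  have cont: "continuous_on UNIV \<theta>" using \<theta> by (simp add: polar_angle_def)
  define G where "G s = h1 t * h2 s - h2 t * h1 s" for s
  obtain R where R: "R > 0" "\<And>t. \<bar>u1 t\<bar> \<le> R" "\<And>t. \<bar>u2 t\<bar> \<le> R" by (rule control_bounded) blast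
  \<comment> \<open>Since \<open>h(s) \<bullet> u(s) = 1\<close> almost everywhere,
    \<open>h(t) \<bullet> u(s)\<close> differs from 1 by
    \<open>(h(t) - h(s)) \<bullet> u(s)\<close>, which \<open>R\<close> bounds.\<close>
  define E where "E s = \<bar>h3 s - h3 t\<bar> + \<bar>h3 s\<bar> * (R * (\<bar>h1 t - h1 s\<bar> + \<bar>h2 t - h2 s\<bar>))" for s
  have G: "(G has_real_derivative h3 t) (at t)"
  proof (rule abs_continuous_derivative_at)
    show "abs_continuous G"
      unfolding G_def by (intro abs_continuous_intros abs_continuous_h)
    show "AE s in lebesgue. (G has_real_derivative h3 s * (h1 t * u1 s + h2 t * u2 s)) (at s)"
      using AE_h by eventually_elim (unfold G_def, auto intro!: derivative_eq_intros simp: algebra_simps)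
    show "AE s in lebesgue. \<bar>h3 s * (h1 t * u1 s + h2 t * u2 s) - h3 t\<bar> \<le> E s"
      using AE_maximum
    proof eventually_elim
      case (elim s)
      have "\<bar>(h1 t - h1 s) * u1 s\<bar> \<le> R * \<bar>h1 t - h1 s\<bar>" "\<bar>(h2 t - h2 s) * u2 s\<bar> \<le> R * \<bar>h2 t - h2 s\<bar>"
        using R by (simp_all add: abs_mult mult.commute[of "\<bar>h1 t - h1 s\<bar>"] mult.commute[of "\<bar>h2 t - h2 s\<bar>"] mult_right_mono)
      then have le: "\<bar>(h1 t - h1 s) * u1 s + (h2 t - h2 s) * u2 s\<bar> \<le> R * (\<bar>h1 t - h1 s\<bar> + \<bar>h2 t - h2 s\<bar>)"
        by (simp add: distrib_left)
      have "h3 s * (h1 t * u1 s + h2 t * u2 s) - h3 t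
          = (h3 s - h3 t) + h3 s * ((h1 t - h1 s) * u1 s + (h2 t - h2 s) * u2 s) + h3 s * (h1 s * u1 s + h2 s * u2 s - 1)"
        by (simp add: algebra_simps)
      then have "\<bar>h3 s * (h1 t * u1 s + h2 t * u2 s) - h3 t\<bar>
          = \<bar>(h3 s - h3 t) + h3 s * ((h1 t - h1 s) * u1 s + (h2 t - h2 s) * u2 s)\<bar>"
        using elim by simp
      also have "\<dots> \<le> \<bar>h3 s - h3 t\<bar> + \<bar>h3 s\<bar> * \<bar>(h1 t - h1 s) * u1 s + (h2 t - h2 s) * u2 s\<bar>"
        by (rule order_trans[OF abs_triangle_ineq]) (simp add: abs_mult)
      also have "\<dots> \<le> E s" unfolding E_def by (intro add_left_mono mult_left_mono le) simp
      finally show ?case .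
    qed
    have "continuous_on UNIV E" unfolding E_def by (intro continuous_intros continuous_h)
    then show "isCont E t" by (simp add: continuous_on_eq_continuous_at)
    show "E t = 0" by (simp add: E_def)
  qed
  have rc: "continuous_on UNIV (\<lambda>s. r (\<theta> s))"
    by (rule continuous_on_compose2[OF r_continuous[of UNIV] cont]) auto
  define Q where "Q s = G s / (r (\<theta> t) * r (\<theta> s))" for s
  have Qsin: "Q s = sin (\<theta> s - \<theta> t)" for s
    using r_pos[of "\<theta> s"] r_pos[of "\<theta> t"] by (simp add: Q_def G_def h sin_diff field_simps)
  \<comment> \<open>As \<open>G t = 0\<close>, the varying denominator can be pulled out of the
    difference quotient, and continuity of \<open>r (\<theta> s)\<close> suffices for the
    limit.\<close>
  have "(Q has_real_derivative h3 t / (r (\<theta> t))\<^sup>2) (at t)"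
  proof -
    have "((\<lambda>s. (G s - G t) / (s - t)) \<longlongrightarrow> h3 t) (at t)" using G by (simp add: has_field_derivative_iff)
    moreover have "((\<lambda>s. r (\<theta> s)) \<longlongrightarrow> r (\<theta> t)) (at t)"
      using rc by (simp add: continuous_on_eq_continuous_at isCont_def)
    ultimately have "((\<lambda>s. (G s - G t) / (s - t) / (r (\<theta> t) * r (\<theta> s))) \<longlongrightarrow> h3 t / (r (\<theta> t) * r (\<theta> t))) (at t)"
      using r_pos[of "\<theta> t"] by (intro tendsto_intros) auto
    moreover have "(G s - G t) / (s - t) / (r (\<theta> t) * r (\<theta> s)) = (Q s - Q t) / (s - t)" for s
      by (simp add: Q_def G_def)
    ultimately show ?thesis by (simp add: has_field_derivative_iff power2_eq_square)
  qed
  \<comment> \<open>\<open>arcsin\<close> has derivative 1 at 0 and recovers the angle increment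
    while it stays below \<open>pi / 2\<close>, that is near \<open>t\<close>.\<close>
  moreover have "(arcsin has_real_derivative 1) (at (Q t))" using DERIV_arcsin[of 0] by (simp add: Qsin)
  ultimately have "((\<lambda>s. arcsin (Q s)) has_real_derivative 1 * (h3 t / (r (\<theta> t))\<^sup>2)) (at t)"
    by (intro DERIV_chain2[of arcsin])
  from DERIV_add[OF DERIV_const this]
  have "((\<lambda>s. \<theta> t + arcsin (Q s)) has_real_derivative h3 t / (r (\<theta> t))\<^sup>2) (at t)" by simp
  moreover have "\<forall>\<^sub>F s in nhds t. \<theta> t + arcsin (Q s) = \<theta> s"
  proof -
    have "\<forall>\<^sub>F s in nhds t. \<theta> s \<in> {\<theta> t - pi / 2<..<\<theta> t + pi / 2}"
      by (rule topological_tendstoD[of \<theta> "\<theta> t"])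
        (use cont in \<open>auto simp: continuous_on_eq_continuous_at continuous_at tendsto_nhds_iff isCont_def\<close>)
    then show ?thesis
      by eventually_elim (auto simp: Qsin arcsin_sin)
  qed
  ultimately show ?thesis
    using DERIV_cong_ev[OF refl _ refl] by metis
qed

theorem angle_representation_exists:
  assumes \<theta>: "polar_angle F (\<lambda>t. (x t, y t, z t, v t, w t)) \<psi> \<theta>"
  shows "\<exists>\<rho>. angle_representation r (\<psi> 0) \<theta> \<rho> x y"
proof -
  have h: "h1 s = r (\<theta> s) * cos (\<theta> s)" "h2 s = r (\<theta> s) * sin (\<theta> s)" for s
    using \<theta> by (auto simp: polar_angle_def momentum_eq)
  have cont: "continuous_on UNIV \<theta>" using \<theta> by (simp add: polar_angle_def)
  have rc: "continuous_on UNIV (\<lambda>s. r (\<theta> s))"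
    by (rule continuous_on_compose2[OF r_continuous[of UNIV] cont]) auto
  note D = polar_angle_derivative[OF \<theta>]
  \<comment> \<open>\<open>angle_representation\<close> asks for an admissible value at every time.
    Where the maximum condition fails, a null set, \<open>slope_right\<close> is an arbitrary
    admissible choice; measurability survives the change.\<close>
  define \<rho> where "\<rho> s = (if h1 s * u1 s + h2 s * u2 s = 1
      then - (r (\<theta> s))\<^sup>2 * (ndir (\<theta> s) \<bullet> (u1 s, u2 s)) else slope_right (\<theta> s))" for s
  have max: "between_one_sided_derivs r (\<theta> s) (\<rho> s)"
     "u1 s = xdot_formula r \<theta> \<rho> s" "u2 s = ydot_formula r \<theta> \<rho> s" if "h1 s * u1 s + h2 s * u2 s = 1" for s
    using maximizer_polar[OF control_in_U, of "\<theta> s" s] that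
    by (simp_all add: \<rho>_def h xdot_formula_def ydot_formula_def)
  have between: "between_one_sided_derivs r (\<theta> s) (\<rho> s)" for s
    using max(1)[of s] slope_le[of "\<theta> s"] by (cases "h1 s * u1 s + h2 s * u2 s = 1") (auto simp: between_iff \<rho>_def)
  have ae1: "AE s in lebesgue. u1 s = xdot_formula r \<theta> \<rho> s" using AE_maximum by eventually_elim (rule max)
  have ae2: "AE s in lebesgue. u2 s = ydot_formula r \<theta> \<rho> s" using AE_maximum by eventually_elim (rule max)
  have m: "u1 \<in> borel_measurable lebesgue" "u2 \<in> borel_measurable lebesgue"
    using control_measurable by (auto simp: loc_bounded_measurable_def)
  have "AE s in lebesgue. (x has_real_derivative u1 s) (at s)" "AE s in lebesgue. (y has_real_derivative u2 s) (at s)"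
    using AE_coords by (eventually_elim, blast)+
  then have xy: "x t = primitive (xdot_formula r \<theta> \<rho>) t" "y t = primitive (ydot_formula r \<theta> \<rho>) t" for t
    using abs_continuous_primitive[OF abs_continuous_coords(1) _ control_measurable(1), of t]
      abs_continuous_primitive[OF abs_continuous_coords(2) _ control_measurable(2), of t]
      primitive_cong_AE[OF m(1) ae1] primitive_cong_AE[OF m(2) ae2] by (simp_all add: initial_coords)
  have "\<theta> C1_differentiable_on UNIV"
    unfolding C1_differentiable_on_def
  proof (intro exI[of _ "\<lambda>t. h3 t / (r (\<theta> t))\<^sup>2"] conjI ballI)
    show "(\<theta> has_vector_derivative h3 t / (r (\<theta> t))\<^sup>2) (at t)" for t
      using D by (simp add: has_real_derivative_iff_has_vector_derivative)
    show "continuous_on UNIV (\<lambda>t. h3 t / (r (\<theta> t))\<^sup>2)"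
      using r_pos by (intro continuous_intros rc continuous_h) (auto simp: less_imp_neq[symmetric])
  qed
  moreover have "deriv \<theta> t = h3 t / (r (\<theta> t))\<^sup>2" for t using D by (rule DERIV_imp_deriv)
  moreover have "(h3 t / (r (\<theta> t))\<^sup>2)\<^sup>2 =
        ((p3 0)\<^sup>2 + 2 * p4 0 * (r (\<theta> t) * sin (\<theta> t) - p2 0) - 2 * p5 0 * (r (\<theta> t) * cos (\<theta> t) - p1 0)) / (r (\<theta> t)) ^ 4" for t
    by (simp add: power_divide energy h flip: power_mult)
  moreover have "xdot_formula r \<theta> \<rho> \<in> borel_measurable lebesgue" "ydot_formula r \<theta> \<rho> \<in> borel_measurable lebesgue"
    using borel_measurable_AE[OF m(1) ae1] borel_measurable_AE[OF m(2) ae2] .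
  moreover have "(r (\<theta> t))\<^sup>2 * (h3 t / (r (\<theta> t))\<^sup>2) = p3 0 + p4 0 * x t + p5 0 * y t" for t
    using r_pos[of "\<theta> t"] by (simp add: h3_def)
  ultimately have "angle_representation r (p1 0, p2 0, p3 0, p4 0, p5 0) \<theta> \<rho> x y"
    using between xy h_initial by (simp add: h primitive_def)
  then show ?thesis by (auto simp: \<psi>_eq[of 0])
qed

section \<open>Integral formulas for \<open>z\<close>, \<open>v\<close>, \<open>w\<close>\<close>

lemma AE_deriv_coords: "AE t in lebesgue. deriv x t = u1 t \<and> deriv y t = u2 t \<and> deriv z t = (x t * u2 t - y t * u1 t) / 2"
  using AE_coords by eventually_elim (auto dest: DERIV_imp_deriv)

lemma continuous_coords: "continuous_on UNIV x" "continuous_on UNIV y" "continuous_on UNIV z"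
  by (intro abs_continuous_imp_continuous abs_continuous_coords)+

lemmas lbm_intros = loc_bounded_measurable_mult loc_bounded_measurable_add loc_bounded_measurable_diff
  loc_bounded_measurable_divide loc_bounded_measurable_continuous continuous_coords continuous_intros
  control_measurable

text \<open>Here \<open>k\<close> is an integrand written with controls and \<open>l\<close> the
  same integrand written with \<open>deriv\<close>.\<close>

lemma primitive_along:
  assumes "loc_bounded_measurable k" "AE t in lebesgue. k t = l t"
    and "abs_continuous f" "AE t in lebesgue. (f has_real_derivative k t) (at t)" "f 0 = 0"
  shows "f t = (LINT \<tau>=0..ereal t|lebesgue. l \<tau>)"
  using abs_continuous_primitive[OF assms(3,4,1), of t] primitive_cong_AE[OF _ assms(2)] assms(1,5)
  by (simp add: loc_bounded_measurable_def flip: primitive_def)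

text \<open>Each formula is solved for its integral. The resulting polynomial in the coordinates
  vanishes at 0, and by the trajectory equations its derivative is the integrand.\<close>

lemma zvw: "zvw_formulas x y z v w"
proof -
  have 1: "z t + x t * y t / 2 = (LINT \<tau>=0..ereal t|lebesgue. (x \<tau> * deriv y \<tau>))" for t
  proof (rule primitive_along[where k="\<lambda>t. x t * u2 t"])
    show "loc_bounded_measurable (\<lambda>t. x t * u2 t)" by (intro lbm_intros)
    show "AE t in lebesgue. x t * u2 t = x t * deriv y t" using AE_deriv_coords by eventually_elim simp
    show "abs_continuous (\<lambda>t. z t + x t * y t / 2)" by (intro abs_continuous_intros abs_continuous_coords)
    show "AE t in lebesgue. ((\<lambda>t. z t + x t * y t / 2) has_real_derivative x t * u2 t) (at t)"
      using AE_coords by eventually_elim (auto intro!: derivative_eq_intros simp: field_simps)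
  qed (simp add: initial_coords)
  have 2: "2 * v t - (x t)\<^sup>2 * y t / 6 + x t * (z t + x t * y t / 2) = (LINT \<tau>=0..ereal t|lebesgue. ((x \<tau>)\<^sup>2 * deriv y \<tau>))" for t
  proof (rule primitive_along[where k="\<lambda>t. (x t)\<^sup>2 * u2 t"])
    show "loc_bounded_measurable (\<lambda>t. (x t)\<^sup>2 * u2 t)" by (intro lbm_intros)
    show "AE t in lebesgue. (x t)\<^sup>2 * u2 t = (x t)\<^sup>2 * deriv y t" using AE_deriv_coords by eventually_elim simp
    show "abs_continuous (\<lambda>t. 2 * v t - (x t)\<^sup>2 * y t / 6 + x t * (z t + x t * y t / 2))"
      by (intro abs_continuous_intros abs_continuous_coords)
    show "AE t in lebesgue. ((\<lambda>t. 2 * v t - (x t)\<^sup>2 * y t / 6 + x t * (z t + x t * y t / 2)) has_real_derivative (x t)\<^sup>2 * u2 t) (at t)"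
      using AE_coords by eventually_elim (auto intro!: derivative_eq_intros simp: field_simps power2_eq_square)
  qed (simp add: initial_coords)
  have 3: "w t + x t * (y t)\<^sup>2 / 12 + y t * (z t + x t * y t / 2) / 2 = (LINT \<tau>=0..ereal t|lebesgue. (x \<tau> * y \<tau> * deriv y \<tau>))" for t
  proof (rule primitive_along[where k="\<lambda>t. x t * y t * u2 t"])
    show "loc_bounded_measurable (\<lambda>t. x t * y t * u2 t)" by (intro lbm_intros)
    show "AE t in lebesgue. x t * y t * u2 t = x t * y t * deriv y t" using AE_deriv_coords by eventually_elim simp
    show "abs_continuous (\<lambda>t. w t + x t * (y t)\<^sup>2 / 12 + y t * (z t + x t * y t / 2) / 2)"
      by (intro abs_continuous_intros abs_continuous_coords)
    show "AE t in lebesgue. ((\<lambda>t. w t + x t * (y t)\<^sup>2 / 12 + y t * (z t + x t * y t / 2) / 2) has_real_derivative x t * y t * u2 t) (at t)"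
      using AE_coords by eventually_elim (auto intro!: derivative_eq_intros simp: field_simps power2_eq_square)
  qed (simp add: initial_coords)
  show ?thesis
    unfolding zvw_formulas_def 1[symmetric] 2[symmetric] 3[symmetric] by (simp add: field_simps power2_eq_square)
qed

text \<open>Solving for the integrals clears the factors \<open>1/3\<close> and \<open>1/6\<close>
  into the combinations \<open>3 v + x z / 2\<close> and \<open>3 w + y z / 2\<close>.\<close>

lemma zvw_alt: "zvw_formulas_alt x y z v w"
proof -
  have 1: "2 * z t = (LINT \<tau>=0..ereal t|lebesgue. (x \<tau> * deriv y \<tau> - y \<tau> * deriv x \<tau>))" for t
  proof (rule primitive_along[where k="\<lambda>t. x t * u2 t - y t * u1 t"])
    show "loc_bounded_measurable (\<lambda>t. x t * u2 t - y t * u1 t)" by (intro lbm_intros)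
    show "AE t in lebesgue. x t * u2 t - y t * u1 t = x t * deriv y t - y t * deriv x t" using AE_deriv_coords by eventually_elim simp
    show "abs_continuous (\<lambda>t. 2 * z t)" by (intro abs_continuous_intros abs_continuous_coords)
    show "AE t in lebesgue. ((\<lambda>t. 2 * z t) has_real_derivative x t * u2 t - y t * u1 t) (at t)"
      using AE_coords by eventually_elim (auto intro!: derivative_eq_intros simp: field_simps)
  qed (simp add: initial_coords)
  have 2: "3 * v t + x t * z t / 2 = (LINT \<tau>=0..ereal t|lebesgue. (x \<tau> * deriv z \<tau> - z \<tau> * deriv x \<tau>))" for t
  proof (rule primitive_along[where k="\<lambda>t. x t * ((x t * u2 t - y t * u1 t) / 2) - z t * u1 t"])
    show "loc_bounded_measurable (\<lambda>t. x t * ((x t * u2 t - y t * u1 t) / 2) - z t * u1 t)" by (intro lbm_intros)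
    show "AE t in lebesgue. x t * ((x t * u2 t - y t * u1 t) / 2) - z t * u1 t = x t * deriv z t - z t * deriv x t"
      using AE_deriv_coords by eventually_elim simp
    show "abs_continuous (\<lambda>t. 3 * v t + x t * z t / 2)" by (intro abs_continuous_intros abs_continuous_coords)
    show "AE t in lebesgue. ((\<lambda>t. 3 * v t + x t * z t / 2) has_real_derivative x t * ((x t * u2 t - y t * u1 t) / 2) - z t * u1 t) (at t)"
      using AE_coords by eventually_elim (auto intro!: derivative_eq_intros simp: field_simps power2_eq_square)
  qed (simp add: initial_coords)
  have 3: "3 * w t + y t * z t / 2 = (LINT \<tau>=0..ereal t|lebesgue. (y \<tau> * deriv z \<tau> - z \<tau> * deriv y \<tau>))" for t
  proof (rule primitive_along[where k="\<lambda>t. y t * ((x t * u2 t - y t * u1 t) / 2) - z t * u2 t"])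
    show "loc_bounded_measurable (\<lambda>t. y t * ((x t * u2 t - y t * u1 t) / 2) - z t * u2 t)" by (intro lbm_intros)
    show "AE t in lebesgue. y t * ((x t * u2 t - y t * u1 t) / 2) - z t * u2 t = y t * deriv z t - z t * deriv y t"
      using AE_deriv_coords by eventually_elim simp
    show "abs_continuous (\<lambda>t. 3 * w t + y t * z t / 2)" by (intro abs_continuous_intros abs_continuous_coords)
    show "AE t in lebesgue. ((\<lambda>t. 3 * w t + y t * z t / 2) has_real_derivative y t * ((x t * u2 t - y t * u1 t) / 2) - z t * u2 t) (at t)"
      using AE_coords by eventually_elim (auto intro!: derivative_eq_intros simp: field_simps power2_eq_square)
  qed (simp add: initial_coords)
  show ?thesis
    unfolding zvw_formulas_alt_def 1[symmetric] 2[symmetric] 3[symmetric] by (simp add: field_simps)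
qed

end

section \<open>Angle representations give extremals\<close>

lemma has_vector_derivative_cartanI:
  fixes a b c d e :: "real \<Rightarrow> real"
  assumes "(a has_real_derivative a') (at t)" "(b has_real_derivative b') (at t)"
    "(c has_real_derivative c') (at t)" "(d has_real_derivative d') (at t)" "(e has_real_derivative e') (at t)"
  shows "((\<lambda>t. (a t, b t, c t, d t, e t)) has_vector_derivative (a', b', c', d', e')) (at t)"
  using assms unfolding has_real_derivative_iff_has_vector_derivative by (intro has_vector_derivative_Pair)

lemma has_real_derivative_lipschitz_comp:
  fixes f g :: "real \<Rightarrow> real"
  assumes lip: "\<And>a b. \<bar>f a - f b\<bar> \<le> L * \<bar>a - b\<bar>" and g: "(g has_real_derivative 0) (at t)"
  shows "((\<lambda>s. f (g s)) has_real_derivative 0) (at t)"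
  unfolding has_field_derivative_iff
proof (rule Lim_null_comparison)
  show "\<forall>\<^sub>F s in at t. norm ((f (g s) - f (g t)) / (s - t)) \<le> L * norm ((g s - g t) / (s - t))"
    using lip by (intro always_eventually allI) (simp add: divide_right_mono)
  show "((\<lambda>s. L * norm ((g s - g t) / (s - t))) \<longlongrightarrow> 0) (at t)"
    using g unfolding has_field_derivative_iff by (intro tendsto_mult_right_zero tendsto_norm_zero)
qed

context quasinormed_plane begin

lemma AE_comp_r_differentiable:
  assumes \<theta>: "\<And>t. (\<theta> has_real_derivative \<theta>' t) (at t)"
    and \<rho>: "\<And>t. between_one_sided_derivs r (\<theta> t) (\<rho> t)"
  shows "AE t in lebesgue. ((\<lambda>s. r (\<theta> s)) has_real_derivative \<rho> t * \<theta>' t) (at t)"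
proof -
  define S where "S q = {t. \<exists>d>0. \<forall>s. s \<noteq> t \<longrightarrow> \<bar>s - t\<bar> < d \<longrightarrow> r (\<theta> s) - q * \<theta> s < r (\<theta> t) - q * \<theta> t}" for q
  have "countable (\<Union>q\<in>\<rat>. S q)"
    unfolding S_def by (intro countable_UN countable_rat countable_strict_local_max)
  then have neg: "negligible (\<Union>q\<in>\<rat>. S q)" 
    using countable_imp_null_set_lborel negligible_iff_null_sets null_sets_completionI by blast
  obtain L where L: "\<And>a b. \<bar>r a - r b\<bar> \<le> L * \<bar>a - b\<bar>" by (rule r_lipschitz) blast
  show ?thesis
  proof (rule AE_lebesgue_negligibleI[OF neg])
    fix t assume t: "t \<notin> (\<Union>q\<in>\<rat>. S q)"
    show "((\<lambda>s. r (\<theta> s)) has_real_derivative \<rho> t * \<theta>' t) (at t)"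
    proof (cases "\<theta>' t = 0")
      case True
      then show ?thesis using has_real_derivative_lipschitz_comp[OF L, of \<theta> t] \<theta>[of t] by simp
    next
      case False
      show ?thesis
      proof (rule r_differentiable_or_corner[of "\<theta> t"])
        assume *: "(r has_real_derivative slope_right (\<theta> t)) (at (\<theta> t))" "slope_left (\<theta> t) = slope_right (\<theta> t)"
        then have "\<rho> t = slope_right (\<theta> t)" using \<rho>[of t] by (simp add: between_iff)
        with DERIV_chain2[OF *(1) \<theta>[of t]] show ?thesis by simp
      next
        fix q d assume q: "q \<in> \<rat>" and d: "d > 0"
          and max: "\<And>s. s \<noteq> \<theta> t \<Longrightarrow> \<bar>s - \<theta> t\<bar> < d \<Longrightarrow> r s - q * s < r (\<theta> t) - q * \<theta> t"
        \<comment> \<open>A nonzero derivative keeps \<theta> away from its value at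
          \<open>t\<close> nearby, so the strict maximum of \<open>r s - q * s\<close> at the corner
          pulls back to a strict maximum in time.\<close>
        have "((\<lambda>s. (\<theta> s - \<theta> t) / (s - t)) \<longlongrightarrow> \<theta>' t) (at t)" using \<theta>[of t] by (simp add: has_field_derivative_iff)
        then have "\<forall>\<^sub>F s in at t. (\<theta> s - \<theta> t) / (s - t) \<noteq> 0" using False by (rule tendsto_imp_eventually_ne)
        then have ev1: "\<forall>\<^sub>F s in at t. \<theta> s \<noteq> \<theta> t" by eventually_elim auto
        have "(\<theta> \<longlongrightarrow> \<theta> t) (at t)" using DERIV_isCont[OF \<theta>[of t]] by (simp add: isCont_def)
        then have ev2: "\<forall>\<^sub>F s in at t. \<bar>\<theta> s - \<theta> t\<bar> < d" using d by (auto simp: tendsto_iff dist_real_def)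
        have "\<forall>\<^sub>F s in at t. r (\<theta> s) - q * \<theta> s < r (\<theta> t) - q * \<theta> t"
          using ev1 ev2 by eventually_elim (rule max)
        then have "t \<in> S q" by (auto simp: S_def eventually_at dist_real_def)
        then show ?thesis using t q by blast
      qed
    qed
  qed
qed

lemma abs_continuous_polar_curve:
  assumes \<theta>: "\<And>t. (\<theta> has_real_derivative \<theta>' t) (at t)" and cont: "continuous_on UNIV \<theta>'"
  shows "abs_continuous (\<lambda>t. r (\<theta> t) * cos (\<theta> t))" "abs_continuous (\<lambda>t. r (\<theta> t) * sin (\<theta> t))"
proof -
  obtain L where L: "\<And>a b. \<bar>r a - r b\<bar> \<le> L * \<bar>a - b\<bar>" by (rule r_lipschitz) blast
  have "abs_continuous \<theta>"
  proof (rule abs_continuous_lipschitz)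
    fix a b :: real
    have "bounded (\<theta>' ` {a..b})"
      using cont by (auto intro!: compact_imp_bounded compact_continuous_image intro: continuous_on_subset)
    then obtain B where B: "\<And>t. t \<in> {a..b} \<Longrightarrow> \<bar>\<theta>' t\<bar> \<le> B" unfolding bounded_iff by fastforce
    show "\<exists>M. \<forall>s\<in>{a..b}. \<forall>t\<in>{a..b}. norm (\<theta> t - \<theta> s) \<le> M * \<bar>t - s\<bar>"
    proof (intro exI[of _ B] ballI)
      fix s t assume st: "s \<in> {a..b}" "t \<in> {a..b}"
      have "norm (\<theta> t - \<theta> s) \<le> B * norm (t - s)"
        by (rule field_differentiable_bound[of "{a..b}" \<theta> \<theta>'])
          (use st B \<theta> in \<open>auto intro: has_field_derivative_at_within\<close>)
      then show "norm (\<theta> t - \<theta> s) \<le> B * \<bar>t - s\<bar>" by simp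
    qed
  qed
  note dom = abs_continuous_dominated[OF this]
  have "abs_continuous (\<lambda>t. r (\<theta> t))" by (rule dom[of _ L]) (simp add: L)
  moreover have "abs_continuous (\<lambda>t. cos (\<theta> t))" "abs_continuous (\<lambda>t. sin (\<theta> t))"
    by (rule dom[of _ 1], simp add: dir_lipschitz)+
  ultimately show "abs_continuous (\<lambda>t. r (\<theta> t) * cos (\<theta> t))" "abs_continuous (\<lambda>t. r (\<theta> t) * sin (\<theta> t))"
    by (auto intro: abs_continuous_mult)
qed

text \<open>Both sets of formulas lead to the same equations. Since \<open>x\<close> and
  \<open>y\<close> are primitives of the controls, \<open>deriv\<close> may be replaced by them
  almost everywhere. In the second set \<open>z\<close> has to be settled first, because its
  derivative occurs in the integrals for \<open>v\<close> and \<open>w\<close>.\<close>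

lemma zvw_ode:
  assumes u: "loc_bounded_measurable u1" "loc_bounded_measurable u2"
    and x: "\<And>t. x t = primitive u1 t" and y: "\<And>t. y t = primitive u2 t"
    and zvw: "zvw_formulas x y z v w \<or> zvw_formulas_alt x y z v w"
  shows "abs_continuous z \<and> abs_continuous v \<and> abs_continuous w \<and> z 0 = 0 \<and> v 0 = 0 \<and> w 0 = 0 \<and>
    (AE t in lebesgue.
      (z has_real_derivative (x t * u2 t - y t * u1 t) / 2) (at t) \<and>
      (v has_real_derivative - (1/2) * (z t + x t * y t / 6) * u1 t + (1/12) * (x t)\<^sup>2 * u2 t) (at t) \<and>
      (w has_real_derivative - (1/12) * (y t)\<^sup>2 * u1 t - (1/2) * (z t - x t * y t / 6) * u2 t) (at t))"
proof -
  have xy0: "x 0 = 0" "y 0 = 0" by (simp_all add: x y primitive_0)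
  have x': "x = primitive u1" and y': "y = primitive u2" using x y by (simp_all add: fun_eq_iff)
  have AC: "abs_continuous x" "abs_continuous y" unfolding x' y' by (intro primitive_abs_continuous u)+
  have AEx: "AE t in lebesgue. (x has_real_derivative u1 t) (at t)"
    and AEy: "AE t in lebesgue. (y has_real_derivative u2 t) (at t)"
    unfolding x' y' by (intro primitive_has_derivative_AE u)+
  have dx: "AE t in lebesgue. deriv x t = u1 t" using AEx by eventually_elim (rule DERIV_imp_deriv)
  have dy: "AE t in lebesgue. deriv y t = u2 t" using AEy by eventually_elim (rule DERIV_imp_deriv)
  note cont = AC[THEN abs_continuous_imp_continuous]
  note lbm = loc_bounded_measurable_mult loc_bounded_measurable_add loc_bounded_measurable_diff
    loc_bounded_measurable_divide loc_bounded_measurable_continuous cont continuous_intros u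
  have cong: "primitive k = primitive l" if "loc_bounded_measurable k" "AE t in lebesgue. k t = l t" for k l
    using that by (intro primitive_cong_AE) (simp_all add: loc_bounded_measurable_def)
  from zvw show ?thesis
  proof
    assume f: "zvw_formulas x y z v w"
    define P1 where "P1 = primitive (\<lambda>t. x t * u2 t)"
    define P2 where "P2 = primitive (\<lambda>t. (x t)\<^sup>2 * u2 t)"
    define P3 where "P3 = primitive (\<lambda>t. x t * y t * u2 t)"
    have l: "loc_bounded_measurable (\<lambda>t. x t * u2 t)" "loc_bounded_measurable (\<lambda>t. (x t)\<^sup>2 * u2 t)"
      "loc_bounded_measurable (\<lambda>t. x t * y t * u2 t)" by (intro lbm)+
    have P: "P1 = primitive (\<lambda>t. x t * deriv y t)" "P2 = primitive (\<lambda>t. (x t)\<^sup>2 * deriv y t)"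
      "P3 = primitive (\<lambda>t. x t * y t * deriv y t)"
      unfolding P1_def P2_def P3_def using dy by (intro cong l; eventually_elim; simp)+
    have P0: "P1 0 = 0" "P2 0 = 0" "P3 0 = 0" by (simp_all add: P1_def P2_def P3_def primitive_0)
    have PAC: "abs_continuous P1" "abs_continuous P2" "abs_continuous P3"
      unfolding P1_def P2_def P3_def by (intro primitive_abs_continuous l)+
    have PAE: "AE t in lebesgue. (P1 has_real_derivative x t * u2 t) (at t)"
      "AE t in lebesgue. (P2 has_real_derivative (x t)\<^sup>2 * u2 t) (at t)"
      "AE t in lebesgue. (P3 has_real_derivative x t * y t * u2 t) (at t)"
      unfolding P1_def P2_def P3_def by (intro primitive_has_derivative_AE l)+
    have z: "z = (\<lambda>t. - (1/2) * x t * y t + P1 t)"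
      and v: "v = (\<lambda>t. (1/12) * (x t)\<^sup>2 * y t - (1/2) * x t * P1 t + (1/2) * P2 t)"
      and w: "w = (\<lambda>t. - (1/12) * x t * (y t)\<^sup>2 - (1/2) * y t * P1 t + P3 t)"
      unfolding P primitive_def fun_eq_iff using f unfolding zvw_formulas_def by blast+
    have "abs_continuous z" "abs_continuous v" "abs_continuous w"
      unfolding z v w by (intro abs_continuous_intros AC PAC)+
    moreover have "z 0 = 0" "v 0 = 0" "w 0 = 0" by (simp_all add: z v w P0 xy0)
    moreover have "AE t in lebesgue.
      (z has_real_derivative (x t * u2 t - y t * u1 t) / 2) (at t) \<and>
      (v has_real_derivative - (1/2) * (z t + x t * y t / 6) * u1 t + (1/12) * (x t)\<^sup>2 * u2 t) (at t) \<and>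
      (w has_real_derivative - (1/12) * (y t)\<^sup>2 * u1 t - (1/2) * (z t - x t * y t / 6) * u2 t) (at t)"
      using AEx AEy PAE
    proof eventually_elim
      case (elim t)
      have "(z has_real_derivative (x t * u2 t - y t * u1 t) / 2) (at t)"
        unfolding z by (rule derivative_eq_intros elim refl)+ (simp add: field_simps)
      moreover have "(v has_real_derivative - (1/2) * (z t + x t * y t / 6) * u1 t + (1/12) * (x t)\<^sup>2 * u2 t) (at t)"
        unfolding z v by (rule derivative_eq_intros elim refl)+ (simp add: field_simps power2_eq_square)
      moreover have "(w has_real_derivative - (1/12) * (y t)\<^sup>2 * u1 t - (1/2) * (z t - x t * y t / 6) * u2 t) (at t)"
        unfolding z w by (rule derivative_eq_intros elim refl)+ (simp add: field_simps power2_eq_square)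
      ultimately show ?case by blast
    qed
    ultimately show ?thesis by blast
  next
    assume f: "zvw_formulas_alt x y z v w"
    define zd where "zd t = (x t * u2 t - y t * u1 t) / 2" for t
    define P1 where "P1 = primitive (\<lambda>t. x t * u2 t - y t * u1 t)"
    have l1: "loc_bounded_measurable (\<lambda>t. x t * u2 t - y t * u1 t)" by (intro lbm)
    have "P1 = primitive (\<lambda>t. x t * deriv y t - y t * deriv x t)"
      unfolding P1_def using dx dy by (intro cong l1; eventually_elim; simp)
    then have z: "z = (\<lambda>t. (1/2) * P1 t)"
      unfolding primitive_def fun_eq_iff using f unfolding zvw_formulas_alt_def by simp
    have zAC: "abs_continuous z" unfolding z P1_def
      by (intro abs_continuous_intros primitive_abs_continuous l1)
    have zAE: "AE t in lebesgue. (z has_real_derivative zd t) (at t)"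
    proof -
      have "AE t in lebesgue. (P1 has_real_derivative x t * u2 t - y t * u1 t) (at t)"
        unfolding P1_def by (rule primitive_has_derivative_AE[OF l1])
      then show ?thesis unfolding z zd_def by eventually_elim (auto intro!: derivative_eq_intros)
    qed
    have dz: "AE t in lebesgue. deriv z t = zd t" using zAE by eventually_elim (rule DERIV_imp_deriv)
    have z0: "z 0 = 0" by (simp add: z P1_def primitive_0)
    note contz = zAC[THEN abs_continuous_imp_continuous]
    define P2 where "P2 = primitive (\<lambda>t. x t * zd t - z t * u1 t)"
    define P3 where "P3 = primitive (\<lambda>t. y t * zd t - z t * u2 t)"
    have l: "loc_bounded_measurable (\<lambda>t. x t * zd t - z t * u1 t)" "loc_bounded_measurable (\<lambda>t. y t * zd t - z t * u2 t)"
      unfolding zd_def by (intro lbm contz)+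
    have P: "P2 = primitive (\<lambda>t. x t * deriv z t - z t * deriv x t)"
      "P3 = primitive (\<lambda>t. y t * deriv z t - z t * deriv y t)"
      unfolding P2_def P3_def using dx dy dz by (intro cong l; eventually_elim; simp)+
    have P0: "P2 0 = 0" "P3 0 = 0" by (simp_all add: P2_def P3_def primitive_0)
    have PAC: "abs_continuous P2" "abs_continuous P3"
      unfolding P2_def P3_def by (intro primitive_abs_continuous l)+
    have PAE: "AE t in lebesgue. (P2 has_real_derivative x t * zd t - z t * u1 t) (at t)"
      "AE t in lebesgue. (P3 has_real_derivative y t * zd t - z t * u2 t) (at t)"
      unfolding P2_def P3_def by (intro primitive_has_derivative_AE l)+
    have v: "v = (\<lambda>t. (1/3) * P2 t - (1/6) * x t * z t)"
      and w: "w = (\<lambda>t. (1/3) * P3 t - (1/6) * y t * z t)"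
      unfolding P primitive_def fun_eq_iff using f unfolding zvw_formulas_alt_def by blast+
    have "abs_continuous v" "abs_continuous w"
      unfolding v w by (intro abs_continuous_intros AC PAC zAC)+
    moreover have "v 0 = 0" "w 0 = 0" by (simp_all add: v w P0 xy0)
    moreover have "AE t in lebesgue.
      (z has_real_derivative (x t * u2 t - y t * u1 t) / 2) (at t) \<and>
      (v has_real_derivative - (1/2) * (z t + x t * y t / 6) * u1 t + (1/12) * (x t)\<^sup>2 * u2 t) (at t) \<and>
      (w has_real_derivative - (1/12) * (y t)\<^sup>2 * u1 t - (1/2) * (z t - x t * y t / 6) * u2 t) (at t)"
      using AEx AEy zAE PAE
    proof eventually_elim
      case (elim t)
      have "(z has_real_derivative (x t * u2 t - y t * u1 t) / 2) (at t)"
        using elim(3) by (simp add: zd_def)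
      moreover have "(v has_real_derivative - (1/2) * (z t + x t * y t / 6) * u1 t + (1/12) * (x t)\<^sup>2 * u2 t) (at t)"
        unfolding v by (rule derivative_eq_intros elim refl)+ (simp add: zd_def field_simps power2_eq_square)
      moreover have "(w has_real_derivative - (1/12) * (y t)\<^sup>2 * u1 t - (1/2) * (z t - x t * y t / 6) * u2 t) (at t)"
        unfolding w by (rule derivative_eq_intros elim refl)+ (simp add: zd_def field_simps power2_eq_square)
      ultimately show ?case by blast
    qed
    ultimately show ?thesis using zAC z0 by blast
  qed
qed

section \<open>The extremal belonging to a given angle representation\<close>

theorem extremal_of_angle_representation:
  assumes rep: "angle_representation r (\<phi>1, \<phi>2, \<phi>3, \<phi>4, \<phi>5) \<theta> \<rho> x y"
    and zvw: "zvw_formulas x y z v w \<or> zvw_formulas_alt x y z v w"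
  shows "\<exists>u \<psi>. extremal F (\<lambda>t. (x t, y t, z t, v t, w t)) u \<psi> \<and>
             (x 0, y 0, z 0, v 0, w 0) = 0 \<and>
             \<psi> 0 = (\<phi>1, \<phi>2, \<phi>3, \<phi>4, \<phi>5) \<and>
             polar_angle F (\<lambda>t. (x t, y t, z t, v t, w t)) \<psi> \<theta>"
proof -
  define u1 where "u1 = xdot_formula r \<theta> \<rho>"
  define u2 where "u2 = ydot_formula r \<theta> \<rho>"
  have C1: "\<theta> C1_differentiable_on UNIV"
    and init: "r (\<theta> 0) * cos (\<theta> 0) = \<phi>1" "r (\<theta> 0) * sin (\<theta> 0) = \<phi>2"
    and \<rho>: "\<And>t. between_one_sided_derivs r (\<theta> t) (\<rho> t)"
    and meas: "u1 \<in> borel_measurable lebesgue" "u2 \<in> borel_measurable lebesgue"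
    and x: "\<And>t. x t = primitive u1 t" and y: "\<And>t. y t = primitive u2 t"
    and h3: "\<And>t. (r (\<theta> t))\<^sup>2 * deriv \<theta> t = \<phi>3 + \<phi>4 * x t + \<phi>5 * y t"
    using rep by (simp_all add: u1_def u2_def primitive_def)
  obtain D where D: "\<And>t. (\<theta> has_real_derivative D t) (at t)" "continuous_on UNIV D"
    using C1 unfolding C1_differentiable_on_def has_real_derivative_iff_has_vector_derivative by blast
  have D_eq: "deriv \<theta> = D" using D(1) DERIV_imp_deriv by blast
  have U: "(u1 t, u2 t) \<in> U" and max: "(r (\<theta> t) * cos (\<theta> t), r (\<theta> t) * sin (\<theta> t)) \<bullet> (u1 t, u2 t) = 1" for t
    using polar_maximizer[OF \<rho>[of t]] by (simp_all add: u1_def u2_def xdot_formula_def ydot_formula_def)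
  obtain R where R: "R > 0" "\<And>u. u \<in> U \<Longrightarrow> norm u \<le> R" by (rule U_bounded) blast
  have "\<bar>u1 t\<bar> \<le> R" "\<bar>u2 t\<bar> \<le> R" for t
    using R(2)[OF U[of t]] norm_fst_le[of "u1 t" "u2 t"] norm_snd_le[of "u2 t" "u1 t"] by auto
  then have u: "loc_bounded_measurable u1" "loc_bounded_measurable u2"
    using meas by (auto intro!: loc_bounded_measurableI)
  have x': "x = primitive u1" and y': "y = primitive u2" using x y by (simp_all add: fun_eq_iff)
  have AC: "abs_continuous x" "abs_continuous y" unfolding x' y' by (intro primitive_abs_continuous u)+
  have AEx: "AE t in lebesgue. (x has_real_derivative u1 t) (at t)"
    and AEy: "AE t in lebesgue. (y has_real_derivative u2 t) (at t)"
    unfolding x' y' by (intro primitive_has_derivative_AE u)+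
  have xy0: "x 0 = 0" "y 0 = 0" by (simp_all add: x y primitive_0)
  note ode = zvw_ode[OF u x y zvw]
  have AC': "abs_continuous z" "abs_continuous v" "abs_continuous w" and zvw0: "z 0 = 0" "v 0 = 0" "w 0 = 0"
    using ode by blast+
  have AE: "AE t in lebesgue.
      (z has_real_derivative (x t * u2 t - y t * u1 t) / 2) (at t) \<and>
      (v has_real_derivative - (1/2) * (z t + x t * y t / 6) * u1 t + (1/12) * (x t)\<^sup>2 * u2 t) (at t) \<and>
      (w has_real_derivative - (1/12) * (y t)\<^sup>2 * u1 t - (1/2) * (z t - x t * y t / 6) * u2 t) (at t)"
    using ode by blast
  define k1 where "k1 t = r (\<theta> t) * cos (\<theta> t)" for t
  define k2 where "k2 t = r (\<theta> t) * sin (\<theta> t)" for t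
  have ACk: "abs_continuous k1" "abs_continuous k2"
    unfolding k1_def[abs_def] k2_def[abs_def] by (rule abs_continuous_polar_curve[OF D])+
  have AEk: "AE t in lebesgue. (k1 has_real_derivative - (\<phi>3 + \<phi>4 * x t + \<phi>5 * y t) * u2 t) (at t) \<and>
      (k2 has_real_derivative (\<phi>3 + \<phi>4 * x t + \<phi>5 * y t) * u1 t) (at t)"
    using AE_comp_r_differentiable[OF D(1) \<rho>]
  proof eventually_elim
    case (elim t)
    have pos: "r (\<theta> t) > 0" by (rule r_pos)
    have e: "\<phi>3 + \<phi>4 * x t + \<phi>5 * y t = (r (\<theta> t))\<^sup>2 * D t" using h3[of t] by (simp add: D_eq)
    \<comment> \<open>The factor \<open>r^2\<close> cancels the denominators of the velocity
      formulas. What remains is, up to sign for \<open>k1\<close>, the product rule for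
      \<open>r (\<theta> t)\<close> times cosine or sine, with \<open>\<rho> t * D t\<close> as
      derivative of \<open>r (\<theta> t)\<close>.\<close>
    have e2: "(r (\<theta> t))\<^sup>2 * D t * u2 t = (r (\<theta> t) * sin (\<theta> t) - \<rho> t * cos (\<theta> t)) * D t"
      and e1: "(r (\<theta> t))\<^sup>2 * D t * u1 t = (\<rho> t * sin (\<theta> t) + r (\<theta> t) * cos (\<theta> t)) * D t"
      using pos by (simp_all add: u1_def u2_def xdot_formula_def ydot_formula_def)
    have "(k1 has_real_derivative - ((r (\<theta> t))\<^sup>2 * D t) * u2 t) (at t)"
      unfolding k1_def[abs_def] by (rule derivative_eq_intros elim D refl)+ (use e2 in \<open>simp add: algebra_simps\<close>)
    moreover have "(k2 has_real_derivative ((r (\<theta> t))\<^sup>2 * D t) * u1 t) (at t)"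
      unfolding k2_def[abs_def] by (rule derivative_eq_intros elim D refl)+ (use e1 in \<open>simp add: algebra_simps\<close>)
    ultimately show ?case unfolding e by blast
  qed
  \<comment> \<open>\<open>p3\<close> integrates its adjoint equation; \<open>p1\<close> and
    \<open>p2\<close> come from solving \<open>momentum_coord\<close> for the first two components,
    so that the momentum is \<open>(k1, k2)\<close> by construction.\<close>
  define p3 where "p3 t = \<phi>3 + (\<phi>4 * x t + \<phi>5 * y t) / 2" for t
  define p1 where "p1 t = k1 t + (1/2) * p3 t * y t + (1/12) * \<phi>4 * x t * y t + (1/12) * \<phi>5 * (y t)\<^sup>2 + (1/2) * \<phi>4 * z t" for t
  define p2 where "p2 t = k2 t - (1/2) * p3 t * x t - (1/12) * \<phi>4 * (x t)\<^sup>2 - (1/12) * \<phi>5 * x t * y t + (1/2) * \<phi>5 * z t" for t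
  define \<psi> where "\<psi> t = (p1 t, p2 t, p3 t, \<phi>4, \<phi>5)" for t
  have mom: "momentum (x t, y t, z t, v t, w t) (\<psi> t) = (k1 t, k2 t)" for t
    by (simp add: \<psi>_def momentum_coord p1_def p2_def)
  have Hk: "H (k1 t, k2 t) = 1" for t unfolding k1_def k2_def by (rule H_r)
  have "extremal F (\<lambda>t. (x t, y t, z t, v t, w t)) (\<lambda>t. (u1 t, u2 t)) \<psi>"
    unfolding extremal_def
  proof (intro conjI allI)
    show "trajectory F (\<lambda>t. (x t, y t, z t, v t, w t)) (\<lambda>t. (u1 t, u2 t))"
      unfolding trajectory_def
    proof (intro conjI allI)
      show "abs_continuous (\<lambda>t. (x t, y t, z t, v t, w t))" by (intro abs_continuous_Pair AC AC')
      show "(\<lambda>t. (u1 t, u2 t)) \<in> borel_measurable lebesgue" using meas by (rule borel_measurable_Pair)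
      show "(u1 t, u2 t) \<in> U" for t by (rule U)
      show "AE t in lebesgue. ((\<lambda>t. (x t, y t, z t, v t, w t)) has_vector_derivative
          (fst (u1 t, u2 t) *\<^sub>R field_X (x t, y t, z t, v t, w t) + snd (u1 t, u2 t) *\<^sub>R field_Y (x t, y t, z t, v t, w t))) (at t)"
        using AEx AEy AE unfolding fst_conv snd_conv trajectory_rhs_coord
        by eventually_elim (intro has_vector_derivative_cartanI; blast)
    qed
    have ACp3: "abs_continuous p3" unfolding p3_def[abs_def] by (intro abs_continuous_intros AC)
    then show "abs_continuous \<psi>"
      unfolding \<psi>_def[abs_def] p1_def[abs_def] p2_def[abs_def]
      by (intro abs_continuous_Pair abs_continuous_intros ACk AC AC')
    \<comment> \<open>A vanishing covector would have zero momentum, where \<open>H\<close> is 0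
      instead of 1.\<close>
    show "\<psi> t \<noteq> 0" for t
    proof
      assume "\<psi> t = 0"
      then have "momentum (x t, y t, z t, v t, w t) (\<psi> t) = (0, 0)"
        unfolding momentum_def by (simp only: inner_zero_left)
      then have "(k1 t, k2 t) = 0 *\<^sub>R (k1 t, k2 t)" unfolding mom by simp
      then have "H (0 *\<^sub>R (k1 t, k2 t)) = 1" using Hk[of t] by simp
      then show False by (subst (asm) H_scale) auto
    qed
    show "AE t in lebesgue. \<exists>D. GDERIV (\<lambda>q. hamiltonian q (\<psi> t) (u1 t, u2 t)) (x t, y t, z t, v t, w t) :> D \<and>
        (\<psi> has_vector_derivative - D) (at t)"
      using AEx AEy AE AEk
    proof eventually_elim
      case (elim t)
      have d: "(x has_real_derivative u1 t) (at t)" "(y has_real_derivative u2 t) (at t)"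
        "(z has_real_derivative (x t * u2 t - y t * u1 t) / 2) (at t)"
        "(k1 has_real_derivative - (\<phi>3 + \<phi>4 * x t + \<phi>5 * y t) * u2 t) (at t)"
        "(k2 has_real_derivative (\<phi>3 + \<phi>4 * x t + \<phi>5 * y t) * u1 t) (at t)"
        using elim by blast+
      have d3: "(p3 has_real_derivative (\<phi>4 * u1 t + \<phi>5 * u2 t) / 2) (at t)"
        unfolding p3_def[abs_def] by (auto intro!: derivative_eq_intros d)
      have d1: "(p1 has_real_derivative \<phi>4 * y t * u1 t / 12 - (p3 t / 2 + \<phi>4 * x t / 6 + \<phi>5 * y t / 12) * u2 t) (at t)"
        unfolding p1_def[abs_def] by (rule derivative_eq_intros d d3 refl)+ (simp add: p3_def field_simps)
      have d2: "(p2 has_real_derivative (p3 t / 2 + \<phi>4 * x t / 12 + \<phi>5 * y t / 6) * u1 t - \<phi>5 * x t * u2 t / 12) (at t)"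
        unfolding p2_def[abs_def] by (rule derivative_eq_intros d d3 refl)+ (simp add: p3_def field_simps)
      let ?D = "(- \<phi>4 * y t * u1 t / 12 + (p3 t / 2 + \<phi>4 * x t / 6 + \<phi>5 * y t / 12) * u2 t,
          - (p3 t / 2 + \<phi>4 * x t / 12 + \<phi>5 * y t / 6) * u1 t + \<phi>5 * x t * u2 t / 12,
          - (\<phi>4 * u1 t + \<phi>5 * u2 t) / 2, 0, 0) :: cartan"
      have "- ?D = (\<phi>4 * y t * u1 t / 12 - (p3 t / 2 + \<phi>4 * x t / 6 + \<phi>5 * y t / 12) * u2 t,
          (p3 t / 2 + \<phi>4 * x t / 12 + \<phi>5 * y t / 6) * u1 t - \<phi>5 * x t * u2 t / 12,
          (\<phi>4 * u1 t + \<phi>5 * u2 t) / 2, 0, 0)" by (simp add: field_simps)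
      then have "(\<psi> has_vector_derivative - ?D) (at t)"
        using has_vector_derivative_cartanI[OF d1 d2 d3 DERIV_const DERIV_const] by (simp only: \<psi>_def[abs_def])
      moreover have "GDERIV (\<lambda>q. hamiltonian q (\<psi> t) (u1 t, u2 t)) (x t, y t, z t, v t, w t) :> ?D"
        unfolding \<psi>_def by (rule GDERIV_hamiltonian)
      ultimately show ?case by blast
    qed
    show "AE t in lebesgue.
        hamiltonian (x t, y t, z t, v t, w t) (\<psi> t) (u1 t, u2 t) = H (momentum (x t, y t, z t, v t, w t) (\<psi> t)) \<and>
        H (momentum (x t, y t, z t, v t, w t) (\<psi> t)) = 1"
      unfolding hamiltonian_def mom Hk using max by (simp add: k1_def k2_def)
  qed
  moreover have "(x 0, y 0, z 0, v 0, w 0) = 0" by (simp add: xy0 zvw0 zero_prod_def)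
  moreover have "\<psi> 0 = (\<phi>1, \<phi>2, \<phi>3, \<phi>4, \<phi>5)"
    by (simp add: \<psi>_def p1_def p2_def p3_def xy0 zvw0 k1_def k2_def init)
  moreover have "polar_angle F (\<lambda>t. (x t, y t, z t, v t, w t)) \<psi> \<theta>"
    unfolding polar_angle_def mom using D(1)
    by (auto simp: k1_def k2_def intro: DERIV_continuous_on has_field_derivative_at_within)
  ultimately show ?thesis by blast
qed

end

theorem theorem1:
  fixes F :: "real \<times> real \<Rightarrow> real"
  assumes "quasinorm F"
  shows
    "(\<forall>x y z v w u \<psi>.
        extremal F (\<lambda>t. (x t, y t, z t, v t, w t)) u \<psi> \<and>
        (x 0, y 0, z 0, v 0, w 0) = 0 \<longrightarrow>
          (\<exists>\<theta>. polar_angle F (\<lambda>t. (x t, y t, z t, v t, w t)) \<psi> \<theta>) \<and>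
          (\<forall>\<theta>. polar_angle F (\<lambda>t. (x t, y t, z t, v t, w t)) \<psi> \<theta> \<longrightarrow>
             (\<exists>\<rho>. angle_representation (polar_radius (unit_ball F)) (\<psi> 0) \<theta> \<rho> x y)) \<and>
          zvw_formulas x y z v w \<and> zvw_formulas_alt x y z v w)
     \<and>
     (\<forall>\<phi>1 \<phi>2 \<phi>3 \<phi>4 \<phi>5 \<theta> \<rho> x y z v w.
        support_fun (unit_ball F) (\<phi>1, \<phi>2) = 1 \<and>
        angle_representation (polar_radius (unit_ball F)) (\<phi>1, \<phi>2, \<phi>3, \<phi>4, \<phi>5) \<theta> \<rho> x y \<and>
        (zvw_formulas x y z v w \<or> zvw_formulas_alt x y z v w) \<longrightarrow>
          (\<exists>u \<psi>. extremal F (\<lambda>t. (x t, y t, z t, v t, w t)) u \<psi> \<and>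
             (x 0, y 0, z 0, v 0, w 0) = 0 \<and>
             \<psi> 0 = (\<phi>1, \<phi>2, \<phi>3, \<phi>4, \<phi>5) \<and>
             polar_angle F (\<lambda>t. (x t, y t, z t, v t, w t)) \<psi> \<theta>))"
proof -
  interpret quasinormed_plane F by unfold_locales (rule assms)
  show ?thesis
  proof (intro conjI allI impI; (elim conjE)?)
    fix x y z v w u \<psi>
    assume "extremal F (\<lambda>t. (x t, y t, z t, v t, w t)) u \<psi>" "(x 0, y 0, z 0, v 0, w 0) = 0"
    then interpret cartan_extremal F x y z v w u \<psi> by unfold_locales
    show "\<exists>\<theta>. polar_angle F (\<lambda>t. (x t, y t, z t, v t, w t)) \<psi> \<theta>" by (rule polar_angle_exists)
    show "\<exists>\<rho>. angle_representation r (\<psi> 0) \<theta> \<rho> x y"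
      if "polar_angle F (\<lambda>t. (x t, y t, z t, v t, w t)) \<psi> \<theta>" for \<theta>
      using that by (rule angle_representation_exists)
    show "zvw_formulas x y z v w" by (rule zvw)
    show "zvw_formulas_alt x y z v w" by (rule zvw_alt)
  qed (rule extremal_of_angle_representation)
qed

end
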